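(* Let $\mathcal D_n=\{0,1\}$ for all $n\ge 1$. Then there exists a sequence $\{M_n\}_{n\ge 1}$ of integers with $M_n\ge 2$ such that the Cantor-Moran measure $$\mu=\mathop{\ast}_{n=1}^{\infty}\Big(\tfrac12\delta_0+\tfrac12\delta_{(M_1\cdots M_n)^{-1}}\Big)$$ satisfies the $\mathsf{DEL}$ criterion for all integers $b\ge 2$, and hence is a pointwise absolutely normal measure. Moreover, the Moran set $$K=\Big\{\sum_{n=1}^\infty \frac{d_n}{M_1\cdots M_n}: d_n\in\mathcal D_n \text{ for all } n\Big\}$$ is a set of uniqueness.
   Context: $\delta_a$ is the Dirac measure at $a$, and $\mathop{\ast}$ denotes (infinite) convolution of probability measures. The Fourier transform of a Borel probability measure $\mu$ is $\widehat\mu(\xi)=\int e^{-2\pi i\xi x}\,d\mu(x)$. $\mathsf{DEL}$ criterion: $\mu$ satisfies the $\mathsf{DEL}$ criterion for an integer $b\ge 2$ if for all non-zero integers $h$, $$\sum_{N=1}^\infty \frac1{N^3}\sum_{m=0}^{N-1}\sum_{n=0}^{N-1}\widehat\mu\big(h(b^n-b^m)\big)<\infty .$$ A real number $x$ is $b$-normal if the sequence of fractional parts $\{b^kx\}_{k\ge1}$ is equidistributed in $[0,1]$ with respect to Lebesgue measure; $x$ is absolutely normal if it is $b$-normal for every integer $b\ge2$. A Borel probability measure $\mu$ is pointwise absolutely normal if $\mu$-a.e. $x$ is absolutely normal. A set $E\subset[0,1]$ is a set of uniqueness if $\sum_{n=0}^\infty (a_n\cos(2\pi nx)+b_n\sin(2\pi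 nx))=0$ for all $x\in[0,1]\setminus E$ implies that $a_n=b_n=0$ for each $n$ (where for $n=0$ only $a_0$ is relevant). *)

theory Defs
  imports "HOL-Probability.Probability"
begin

text \<open>The equal-weight mixture \<open>1/2 M + 1/2 N\<close> of two measures on the same measurable space.\<close>

definition half_mixture :: "'a measure \<Rightarrow> 'a measure \<Rightarrow> 'a measure" where
  "half_mixture M N =
     measure_of (space M) (sets M) (\<lambda>A. (emeasure M A + emeasure N A) / 2)"

lemma space_half_mixture [simp]: "space (half_mixture M N) = space M"
  and sets_half_mixture [simp]: "sets (half_mixture M N) = sets M"
  by (simp_all add: half_mixture_def)

text \<open>\<open>measure_of\<close> yields the null measure when its argument is not countably additive;
  the next lemma shows that this does not happen here.\<close>

lemma emeasure_half_mixture: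
  assumes "sets N = sets M" and "A \<in> sets M"
  shows "emeasure (half_mixture M N) A = (emeasure M A + emeasure N A) / 2"
  unfolding half_mixture_def
proof (rule emeasure_measure_of_sigma)
  show "sigma_algebra (space M) (sets M)" ..
  show "positive (sets M) (\<lambda>A. (emeasure M A + emeasure N A) / 2)"
    by (simp add: positive_def)
  show "countably_additive (sets M) (\<lambda>A. (emeasure M A + emeasure N A) / 2)"
  proof (rule countably_additiveI)
    fix B :: "nat \<Rightarrow> 'a set"
    assume B: "range B \<subseteq> sets M" "disjoint_family B"
    have "(\<Sum>i. (emeasure M (B i) + emeasure N (B i)) / 2)
        = (\<Sum>i. emeasure M (B i) + emeasure N (B i)) / 2"
      by (simp add: ennreal_suminf_divide)
    also have "\<dots> = ((\<Sum>i. emeasure M (B i)) + (\<Sum>i. emeasure N (B i))) / 2"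
      by (simp add: suminf_add)
    also have "\<dots> = (emeasure M (\<Union>i. B i) + emeasure N (\<Union>i. B i)) / 2"
      using B assms by (simp add: suminf_emeasure)
    finally show "(\<Sum>i. (emeasure M (B i) + emeasure N (B i)) / 2)
        = (emeasure M (\<Union>i. B i) + emeasure N (\<Union>i. B i)) / 2" .
  qed
qed (fact assms)

text \<open>Sequences are indexed from 1: \<open>partial_convolution \<nu> n\<close> is
  \<open>\<nu> 1 \<star> \<dots> \<star> \<nu> n\<close>, the value \<open>\<nu> 0\<close> being irrelevant; the empty convolution is the
  Dirac measure at 0. The infinite convolution is the weak limit of the partial ones, which is
  unique among probability measures when it exists.\<close>

primrec partial_convolution :: "(nat \<Rightarrow> real measure) \<Rightarrow> nat \<Rightarrow> real measure" where
  "partial_convolution \<nu> 0 = return borel 0"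
| "partial_convolution \<nu> (Suc n) = (partial_convolution \<nu> n \<star> \<nu> (Suc n))"

definition has_infinite_convolution :: "(nat \<Rightarrow> real measure) \<Rightarrow> real measure \<Rightarrow> bool" where
  "has_infinite_convolution \<nu> \<mu> \<longleftrightarrow>
     real_distribution \<mu> \<and> weak_conv_m (partial_convolution \<nu>) \<mu>"

definition fourier_measure :: "real measure \<Rightarrow> real \<Rightarrow> complex" where
  "fourier_measure \<mu> \<xi> = (LINT x|\<mu>. exp (- (2 * of_real pi * \<i> * of_real \<xi> * of_real x)))"

text \<open>The inner double sum is the integral of \<open>\<bar>\<Sum>n<N. exp (-2 \<pi> \<i> h b^n x)\<bar>^2\<close>,
  hence real and nonnegative; so finiteness of the series is its convergence. The series runs over
  \<open>N \<ge> 1\<close>, whence the shift by \<open>Suc\<close>.\<close>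

definition DEL_criterion :: "real measure \<Rightarrow> int \<Rightarrow> bool" where
  "DEL_criterion \<mu> b \<longleftrightarrow>
     (\<forall>h::int. h \<noteq> 0 \<longrightarrow>
        summable (\<lambda>k. let N = Suc k in
          1 / of_nat N ^ 3 *
            (\<Sum>m<N. \<Sum>n<N. fourier_measure \<mu> (of_int (h * (b ^ n - b ^ m))))))"

definition equidistributed :: "(nat \<Rightarrow> real) \<Rightarrow> bool" where
  "equidistributed y \<longleftrightarrow>
     (\<forall>a c. 0 \<le> a \<and> a < c \<and> c \<le> 1 \<longrightarrow>
        (\<lambda>N. real (card {k \<in> {1..N}. y k \<in> {a..<c}}) / real N) \<longlonglongrightarrow> c - a)"

definition normal_in_base :: "int \<Rightarrow> real \<Rightarrow> bool" where
  "normal_in_base b x \<longleftrightarrow> equidistributed (\<lambda>k. frac (of_int (b ^ k) * x))"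

definition absolutely_normal :: "real \<Rightarrow> bool" where
  "absolutely_normal x \<longleftrightarrow> (\<forall>b\<ge>2. normal_in_base b x)"

definition pointwise_absolutely_normal :: "real measure \<Rightarrow> bool" where
  "pointwise_absolutely_normal \<mu> \<longleftrightarrow> (AE x in \<mu>. absolutely_normal x)"

text \<open>The coefficient \<open>b 0\<close> multiplies \<open>sin 0\<close> and is unconstrained.\<close>

definition set_of_uniqueness :: "real set \<Rightarrow> bool" where
  "set_of_uniqueness E \<longleftrightarrow>
     E \<subseteq> {0..1} \<and>
     (\<forall>a b :: nat \<Rightarrow> real.
        (\<forall>x\<in>{0..1} - E.
           (\<lambda>n. a n * cos (2 * pi * real n * x) + b n * sin (2 * pi * real n * x)) sums 0)
        \<longrightarrow> (\<forall>n. a n = 0) \<and> (\<forall>n\<ge>1. b n = 0))"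

definition moran_set :: "(nat \<Rightarrow> int) \<Rightarrow> (nat \<Rightarrow> int set) \<Rightarrow> real set" where
  "moran_set M D =
     {x. \<exists>d. (\<forall>n\<ge>1. d n \<in> D n) \<and>
        (\<lambda>n. of_int (d (Suc n)) / of_int (\<Prod>k=1..Suc n. M k)) sums x}"

end

theory Submission
  imports Defs "HOL-Number_Theory.Number_Theory" "HOL-Real_Asymp.Real_Asymp"
begin

text \<open>The sequence \<open>M\<close> consists of blocks: the \<open>i\<close>-th block repeats the \<open>i\<close>-th prime \<open>p \<ge> 5\<close> exactly
  \<open>p^3\<close> times. Given a base \<open>b\<close> and \<open>h \<noteq> 0\<close>, take a block with \<open>p > b, \<bar>h\<bar>\<close> and let \<open>Q\<close> be the product of
  all earlier blocks. A period \<open>E\<close> of \<open>b^n\<close> modulo \<open>Q\<close> is prime to \<open>p\<close>, as it is composed of factors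
  \<open>q\<close> and \<open>q - 1\<close> with \<open>q < p\<close>; hence, with \<open>L = E (p - 1)\<close>, the power of \<open>p\<close> dividing \<open>b^L - 1\<close> is that
  dividing \<open>b^(p - 1) - 1\<close>, so it is less than \<open>p^p\<close>. Along a progression of difference \<open>L\<close>,
  each further \<open>p\<close>-adic digit is therefore equidistributed and lowers the average of
  \<open>\<Prod> \<bar>cos (\<pi> h (b^n - b^m) / (M\<^sub>1 \<dots> M\<^sub>j))\<bar>\<close> by a constant factor. The total gain is exponential in \<open>p^3\<close>, while the
  logarithm of the denominators up to the next block is only \<open>exp (O(p ln p))\<close>; so the mean of \<open>\<bar>\<mu>^(h (b^n - b^m))\<bar>\<close> over
  \<open>m, n < N\<close> is \<open>O(1 / ln(N)^4)\<close>. This gives the DEL criterion, and normality through Weyl's criterion.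

  As all \<open>M\<^sub>n \<ge> 5\<close>, multiplication by \<open>P = M\<^sub>1 \<dots> M\<^sub>n\<close> maps \<open>K\<close> into \<open>[0, 1/4]\<close> modulo 1. If a
  trigonometric series vanishes off \<open>K\<close>, its second formal integral \<open>F\<close> is affine on each interval
  \<open>((i + 1/4) / P, (i + 1) / P)\<close> by Riemann and Schwarz. Averaging the vanishing second differences of
  \<open>F\<close> at the \<open>P\<close> midpoints against \<open>exp (-2 \<pi> \<i> m x)\<close> isolates the frequencies congruent to \<open>\<plusminus> m\<close>
  modulo \<open>P\<close>; all of them but \<open>m\<close> tend to infinity with \<open>P\<close>, and the coefficients tend to 0, so
  the \<open>m\<close>-th coefficient vanishes.\<close>

section \<open>Multiplicative orders and averages of cosine products\<close>

lemma cong_sum_powers_of_one_mod: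
  fixes g p :: int
  assumes "[g = 1] (mod p)"
  shows "[(\<Sum>i<n. g ^ i) = int n] (mod p)"
proof (induction n)
  case (Suc n)
  have "[g ^ n = 1] (mod p)" using cong_pow[OF assms, of n] by simp
  from cong_add[OF Suc this] show ?case by (simp add: ac_simps)
qed simp

lemma power_minus_one_prime_part:
  fixes g u :: int and p :: nat
  assumes "prime p" "r \<ge> 1" "g - 1 = int p ^ r * u" "\<not> int p dvd u" "\<not> p dvd E"
  shows "\<exists>v. g ^ E - 1 = int p ^ r * v \<and> \<not> int p dvd v"
proof -
  have "int p dvd g - 1" using assms(2,3) by (simp add: dvd_mult2 dvd_power)
  hence "[g = 1] (mod int p)" by (simp add: cong_iff_dvd_diff)
  hence "[(\<Sum>i<E. g ^ i) = int E] (mod int p)" by (rule cong_sum_powers_of_one_mod)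
  hence "\<not> int p dvd (\<Sum>i<E. g ^ i)"
    using assms(5) cong_dvd_iff[of _ "int E" "int p"] by auto
  hence "\<not> int p dvd u * (\<Sum>i<E. g ^ i)"
    using assms(1,4) by (simp add: prime_dvd_mult_iff)
  moreover have "g ^ E - 1 = int p ^ r * (u * (\<Sum>i<E. g ^ i))"
    using assms(3) by (simp add: power_diff_1_eq)
  ultimately show ?thesis by blast
qed

lemma power_prime_minus_one_prime_part:
  fixes g u :: int and p :: nat
  assumes "prime p" "odd p" "r \<ge> 1" "g - 1 = int p ^ r * u" "\<not> int p dvd u"
  shows "\<exists>v. g ^ p - 1 = int p ^ Suc r * v \<and> \<not> int p dvd v"
proof -
  have p0: "p > 0" using assms(1) by (simp add: prime_gt_0_nat)
  obtain w where w: "g = 1 + int p * w"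
  proof -
    have "g = 1 + int p * (int p ^ (r - 1) * u)"
      using assms(3,4) by (cases r) auto
    thus ?thesis by (rule that)
  qed
  have pow: "[g ^ i = 1 + int i * (int p * w)] (mod int p ^ 2)" for i
  proof (induction i)
    case (Suc i)
    have "[g ^ i * g = (1 + int i * (int p * w)) * (1 + int p * w)] (mod int p ^ 2)"
      using Suc w by (intro cong_mult) auto
    also have "(1 + int i * (int p * w)) * (1 + int p * w) =
        1 + int (Suc i) * (int p * w) + int p ^ 2 * (int i * w ^ 2)"
      by (simp add: algebra_simps power2_eq_square)
    also have "[\<dots> = 1 + int (Suc i) * (int p * w)] (mod int p ^ 2)"
      by (simp add: cong_iff_dvd_diff)
    finally show ?case by (simp add: mult.commute)
  qed simp
  have "[(\<Sum>i<p. g ^ i) = (\<Sum>i<p. 1 + int i * (int p * w))] (mod int p ^ 2)"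
    by (intro cong_sum pow)
  also have "(\<Sum>i<p. 1 + int i * (int p * w)) = int p + (\<Sum>i<p. int i) * (int p * w)"
    by (simp add: sum.distrib sum_distrib_right)
  also have "(\<Sum>i<p. int i) = int p * int ((p - 1) div 2)"
  proof -
    obtain k where k: "p = 2 * k + 1" using assms(2) by (elim oddE)
    have "2 * (\<Sum>i<n. int i) = int n * (int n - 1)" for n :: nat
      by (induction n) (auto simp: algebra_simps)
    from this[of p] show ?thesis using k by simp
  qed
  also have "int p + int p * int ((p - 1) div 2) * (int p * w) =
      int p + int p ^ 2 * (int ((p - 1) div 2) * w)"
    by (simp add: algebra_simps power2_eq_square)
  also have "[\<dots> = int p] (mod int p ^ 2)" by (simp add: cong_iff_dvd_diff)
  finally have "int p ^ 2 dvd (\<Sum>i<p. g ^ i) - int p" by (simp add: cong_iff_dvd_diff)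
  then obtain z where "(\<Sum>i<p. g ^ i) - int p = int p ^ 2 * z" by (elim dvdE)
  hence s: "(\<Sum>i<p. g ^ i) = int p * (1 + int p * z)"
    by (simp add: algebra_simps power2_eq_square)
  have "\<not> int p dvd 1 + int p * z"
  proof
    assume "int p dvd 1 + int p * z"
    hence "int p dvd 1" by (simp add: dvd_add_left_iff)
    thus False using assms(1) by (simp add: zdvd1_eq prime_nat_iff)
  qed
  hence "\<not> int p dvd u * (1 + int p * z)" using assms(1,5) by (simp add: prime_dvd_mult_iff)
  moreover have "g ^ p - 1 = int p ^ Suc r * (u * (1 + int p * z))"
    using assms(4) s by (simp add: power_diff_1_eq)
  ultimately show ?thesis by blast
qed

lemma power_prime_power_minus_one_prime_part:
  fixes g u :: int and p :: nat
  assumes "prime p" "odd p" "r \<ge> 1" "g - 1 = int p ^ r * u" "\<not> int p dvd u"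
  shows "\<exists>v. g ^ (p ^ k) - 1 = int p ^ (r + k) * v \<and> \<not> int p dvd v"
proof (induction k)
  case 0
  then show ?case using assms by auto
next
  case (Suc k)
  then obtain v where v: "g ^ (p ^ k) - 1 = int p ^ (r + k) * v" "\<not> int p dvd v" by blast
  from power_prime_minus_one_prime_part[OF assms(1,2) _ v] assms(3)
  show ?case by (simp add: mult.commute flip: power_mult)
qed

text \<open>The quadratic bound \<open>\<bar>x\<bar> \<le> (1 + x\<^sup>2) / 2\<close> suffices because \<open>cos\<^sup>2\<close> has average 1/2 over
  the shifts by multiples of \<open>1 / p\<close>.\<close>

lemma sum_abs_cos_shifts_le:
  fixes a :: int and s :: "nat \<Rightarrow> int" and p :: nat
  assumes "p > 0" "\<not> int p dvd a" "\<And>i. i < p \<Longrightarrow> [s i = int i] (mod int p)"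
  shows "(\<Sum>i<p. \<bar>cos (pi * (\<theta> + of_int (a * s i) / real p))\<bar>) \<le> 3 / 4 * real p"
proof -
  define z where "z = cis (2 * pi * of_int a / real p)"
  have z1: "z \<noteq> 1"
  proof
    assume "z = 1"
    then have "cos (2 * pi * of_int a / real p) = 1" by (simp add: z_def complex_eq_iff)
    then obtain k :: int where "2 * pi * of_int a / real p = real_of_int k * 2 * pi"
      using cos_one_2pi_int by auto
    hence "of_int a = real_of_int (k * int p)" using assms(1) by (simp add: field_simps)
    hence "a = k * int p" by (simp only: of_int_eq_iff)
    thus False using assms(2) by simp
  qed
  have zp: "z ^ p = 1"
    using assms(1) by (simp add: z_def Complex.DeMoivre cis_multiple_2pi)
  have zs: "cis (2 * pi * of_int (a * s i) / real p) = z ^ i" if "i < p" for i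
  proof -
    from assms(3)[OF that] obtain k where k: "s i = int i + int p * k"
      by (metis cong_iff_lin cong_sym)
    have "2 * pi * of_int (a * s i) / real p =
        real i * (2 * pi * of_int a / real p) + 2 * pi * of_int (a * k)"
      using assms(1) by (simp add: k field_simps)
    hence "cis (2 * pi * of_int (a * s i) / real p) =
       cis (real i * (2 * pi * of_int a / real p)) * cis (2 * pi * of_int (a * k))"
      by (simp only: cis_mult)
    also have "cis (2 * pi * of_int (a * k)) = 1" by (rule cis_multiple_2pi) simp
    finally show ?thesis by (simp add: z_def Complex.DeMoivre)
  qed
  have "(\<Sum>i<p. z ^ i) = 0" using geometric_sum[OF z1, of p] zp by simp
  moreover have "(\<Sum>i<p. cos (2 * pi * (\<theta> + of_int (a * s i) / real p))) =
      Re (\<Sum>i<p. cis (2 * pi * \<theta>) * cis (2 * pi * of_int (a * s i) / real p))"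
    by (simp only: Re_sum cis_mult) (simp add: algebra_simps)
  moreover have "\<dots> = Re (cis (2 * pi * \<theta>) * (\<Sum>i<p. z ^ i))"
    unfolding sum_distrib_left by (intro arg_cong[where f = Re] sum.cong refl) (simp add: zs del: of_int_mult)
  ultimately have c0: "(\<Sum>i<p. cos (2 * pi * (\<theta> + of_int (a * s i) / real p))) = 0" by simp
  have "\<bar>cos (pi * x)\<bar> \<le> 3 / 4 + cos (2 * pi * x) / 4" for x
  proof -
    have "0 \<le> (1 - \<bar>cos (pi * x)\<bar>)\<^sup>2" by simp
    also have "\<dots> = 1 - 2 * \<bar>cos (pi * x)\<bar> + (cos (pi * x))\<^sup>2"
      by (simp add: power2_eq_square algebra_simps flip: abs_mult)
    also have "(cos (pi * x))\<^sup>2 = (1 + cos (2 * pi * x)) / 2"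
      using cos_double_cos[of "pi * x"] by (simp add: mult.assoc)
    finally show ?thesis by (simp add: field_simps)
  qed
  hence "(\<Sum>i<p. \<bar>cos (pi * (\<theta> + of_int (a * s i) / real p))\<bar>) \<le>
     (\<Sum>i<p. 3 / 4 + cos (2 * pi * (\<theta> + of_int (a * s i) / real p)) / 4)"
    by (intro sum_mono)
  also have "\<dots> = 3 / 4 * real p"
    using c0 by (simp add: sum.distrib flip: sum_divide_distrib)
  finally show ?thesis .
qed

lemma abs_cos_pi_shift: "\<bar>cos (pi * (x + of_int m))\<bar> = \<bar>cos (pi * x)\<bar>"
  by (simp add: distrib_left cos_add)

lemma sum_lessThan_add:
  "(\<Sum>n<m + k. f n) = (\<Sum>n<m. f n) + (\<Sum>i<k. f (m + i))" for f :: "nat \<Rightarrow> real"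
  by (induction k) auto

lemma sum_lessThan_mult:
  "(\<Sum>l<m * n. f l) = (\<Sum>j<n. \<Sum>i<m. f (j + i * n))" for f :: "nat \<Rightarrow> real"
proof -
  have "(\<Sum>l<m * n. f l) = (\<Sum>i<m. \<Sum>j\<in>{i * n..<i * n + n}. f j)" by (simp add: sum.nat_group)
  also have "\<dots> = (\<Sum>i<m. \<Sum>j<n. f (j + i * n))"
  proof (rule sum.cong[OF refl])
    fix i
    show "(\<Sum>j\<in>{i * n..<i * n + n}. f j) = (\<Sum>j<n. f (j + i * n))"
      using sum.shift_bounds_nat_ivl[of f 0 "i * n" n] by (simp add: atLeast0LessThan add.commute)
  qed
  also have "\<dots> = (\<Sum>j<n. \<Sum>i<m. f (j + i * n))" by (rule sum.swap)
  finally show ?thesis .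
qed

locale prime_power_tower =
  fixes p L r n0 :: nat and b h Q u :: int
  assumes prime_p: "prime p" and odd_p: "odd p" and r1: "r \<ge> 1" and L1: "L \<ge> 1"
    and u: "b ^ L - 1 = int p ^ r * u" "\<not> int p dvd u"
    and Q: "Q > 0" "\<not> int p dvd Q" "Q dvd b ^ n0 * (b ^ L - 1)"
    and bh: "\<not> int p dvd b" "\<not> int p dvd h"
begin

lemma p_pos: "p > 0" using prime_p by (simp add: prime_gt_0_nat)

lemma power_diff_tower:
  assumes "n \<ge> n0"
  obtains w where "b ^ (n + L * p ^ k) - b ^ n = Q * int p ^ (r + k) * w" "\<not> int p dvd w"
proof -
  from power_prime_power_minus_one_prime_part[OF prime_p odd_p r1 u, of k]
  obtain v where v: "(b ^ L) ^ (p ^ k) - 1 = int p ^ (r + k) * v" "\<not> int p dvd v" by blast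
  have eq: "b ^ (n + L * p ^ k) - b ^ n = b ^ n * (int p ^ (r + k) * v)"
    unfolding v(1)[symmetric] by (simp add: power_add power_mult algebra_simps)
  have "b ^ L - 1 dvd (b ^ L) ^ (p ^ k) - 1" by (simp add: power_diff_1_eq)
  hence "b ^ n0 * (b ^ L - 1) dvd b ^ n * (int p ^ (r + k) * v)"
    unfolding v(1)[symmetric] using assms by (intro mult_dvd_mono le_imp_power_dvd)
  from dvd_trans[OF Q(3) this] have "Q dvd int p ^ (r + k) * (b ^ n * v)" by (simp add: ac_simps)
  moreover have "coprime Q (int p ^ (r + k))"
    using Q(2) prime_p prime_imp_coprime[of "int p" Q] by (simp add: coprime_commute)
  ultimately have "Q dvd b ^ n * v" by (simp add: coprime_dvd_mult_right_iff)
  then obtain w where w: "b ^ n * v = Q * w" by (elim dvdE)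
  have "\<not> int p dvd b ^ n * v"
    using v(2) bh(1) prime_p prime_dvd_power[of "int p" b n] by (auto simp: prime_dvd_mult_iff)
  hence "\<not> int p dvd w" using w by auto
  moreover have "b ^ (n + L * p ^ k) - b ^ n = Q * int p ^ (r + k) * w"
    unfolding eq using w by (simp add: algebra_simps)
  ultimately show ?thesis by (rule that[rotated])
qed

lemma power_diff_tower_multiple:
  assumes "n \<ge> n0"
  obtains w s where "\<not> int p dvd w"
    "\<And>i. b ^ (n + L * (i * p ^ k)) - b ^ n = Q * int p ^ (r + k) * (w * s i)"
    "\<And>i. [s i = int i] (mod int p)"
proof -
  from power_diff_tower[OF assms] obtain w
    where w: "b ^ (n + L * p ^ k) - b ^ n = Q * int p ^ (r + k) * w" "\<not> int p dvd w" by metis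
  define g where "g = b ^ (L * p ^ k)"
  define s where "s = (\<lambda>i. \<Sum>j<i. g ^ j)"
  have "b ^ (n + L * (i * p ^ k)) - b ^ n = Q * int p ^ (r + k) * (w * s i)" for i
  proof -
    have "b ^ (n + L * (i * p ^ k)) - b ^ n = b ^ n * (g ^ i - 1)"
      unfolding g_def by (simp add: power_add algebra_simps flip: power_mult)
    also have "g ^ i - 1 = (g - 1) * s i" by (simp add: s_def power_diff_1_eq)
    also have "b ^ n * ((g - 1) * s i) = (b ^ (n + L * p ^ k) - b ^ n) * s i"
      unfolding g_def by (simp add: power_add algebra_simps)
    finally show ?thesis by (simp add: w(1))
  qed
  moreover have "[s i = int i] (mod int p)" for i
    unfolding s_def
  proof (rule cong_sum_powers_of_one_mod)
    from power_prime_power_minus_one_prime_part[OF prime_p odd_p r1 u, of k]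
    obtain v where "g - 1 = int p ^ (r + k) * v" by (auto simp: g_def power_mult)
    hence "int p dvd g - 1" using r1 by (simp add: dvd_mult2 dvd_power)
    thus "[g = 1] (mod int p)" by (simp add: cong_iff_dvd_diff)
  qed
  ultimately show ?thesis using w(2) that by blast
qed

definition cos_prod :: "nat \<Rightarrow> (nat \<Rightarrow> real) \<Rightarrow> nat \<Rightarrow> real" where
  "cos_prod k \<theta> n = (\<Prod>t<k. \<bar>cos (pi * (\<theta> t + of_int (h * b ^ n) / of_int (Q * int p ^ (r + t + 1))))\<bar>)"

lemma cos_prod_nonneg: "cos_prod k \<theta> n \<ge> 0"
  by (simp add: cos_prod_def prod_nonneg)

lemma cos_prod_le_1: "cos_prod k \<theta> n \<le> 1"
  unfolding cos_prod_def by (intro prod_le_1) auto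

lemma cos_prod_periodic:
  assumes "n \<ge> n0"
  shows "cos_prod k \<theta> (n + L * (i * p ^ k)) = cos_prod k \<theta> n"
  unfolding cos_prod_def
proof (intro prod.cong refl)
  fix t assume t: "t \<in> {..<k}"
  from power_diff_tower_multiple[OF assms] obtain w s where
    ws: "b ^ (n + L * (i * p ^ k)) - b ^ n = Q * int p ^ (r + k) * (w * s i)" by metis
  have "r + k = (r + t + 1) + (k - t - 1)" using t by simp
  hence "int p ^ (r + k) = int p ^ (r + t + 1) * int p ^ (k - t - 1)"
    by (metis power_add)
  hence eq: "h * b ^ (n + L * (i * p ^ k)) =
      h * b ^ n + Q * int p ^ (r + t + 1) * (h * int p ^ (k - t - 1) * (w * s i))" (is "_ = _ + _ * ?m")
    using ws by (simp add: algebra_simps)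
  have nz: "real_of_int (Q * int p ^ (r + t + 1)) \<noteq> 0" using Q(1) p_pos by simp
  have "\<theta> t + of_int (h * b ^ (n + L * (i * p ^ k))) / of_int (Q * int p ^ (r + t + 1)) =
     \<theta> t + of_int (h * b ^ n) / of_int (Q * int p ^ (r + t + 1)) + of_int ?m"
    unfolding eq of_int_add of_int_mult[of "Q * _"] add_divide_distrib using nz by simp
  thus "\<bar>cos (pi * (\<theta> t + of_int (h * b ^ (n + L * (i * p ^ k))) / of_int (Q * int p ^ (r + t + 1))))\<bar> =
    \<bar>cos (pi * (\<theta> t + of_int (h * b ^ n) / of_int (Q * int p ^ (r + t + 1))))\<bar>"
    using abs_cos_pi_shift by presburger
qed

lemma sum_cos_last_factor:
  assumes "n \<ge> n0"
  shows "(\<Sum>i<p. \<bar>cos (pi * (x + of_int (h * b ^ (n + L * (i * p ^ k))) / of_int (Q * int p ^ (r + k + 1))))\<bar>)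
    \<le> 3 / 4 * real p"
proof -
  from power_diff_tower_multiple[OF assms] obtain w s where ws: "\<not> int p dvd w"
    "\<And>i. b ^ (n + L * (i * p ^ k)) - b ^ n = Q * int p ^ (r + k) * (w * s i)"
    "\<And>i. [s i = int i] (mod int p)" by metis
  have "x + of_int (h * b ^ (n + L * (i * p ^ k))) / of_int (Q * int p ^ (r + k + 1)) =
     x + of_int (h * b ^ n) / of_int (Q * int p ^ (r + k + 1)) + of_int (h * w * s i) / real p" for i
  proof -
    have "h * b ^ (n + L * (i * p ^ k)) = h * b ^ n + Q * int p ^ (r + k) * (h * w * s i)"
      using ws(2)[of i] by (simp add: algebra_simps)
    thus ?thesis using Q(1) p_pos by (simp add: add_divide_distrib)
  qed
  moreover have "\<not> int p dvd h * w" using bh(2) ws(1) prime_p by (simp add: prime_dvd_mult_iff)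
  ultimately show ?thesis using sum_abs_cos_shifts_le[OF p_pos _ ws(3)] by presburger
qed

lemma sum_cos_prod_progression:
  assumes "n \<ge> n0"
  shows "(\<Sum>l<p ^ k. cos_prod k \<theta> (n + L * l)) \<le> (3 / 4 * real p) ^ k"
proof (induction k)
  case 0
  show ?case by (simp add: cos_prod_def)
next
  case (Suc k)
  have "(\<Sum>l<p ^ Suc k. cos_prod (Suc k) \<theta> (n + L * l)) =
     (\<Sum>j<p ^ k. \<Sum>i<p. cos_prod (Suc k) \<theta> (n + L * (j + i * p ^ k)))"
    unfolding power_Suc by (rule sum_lessThan_mult)
  also have "\<dots> \<le> (\<Sum>j<p ^ k. cos_prod k \<theta> (n + L * j) * (3 / 4 * real p))"
  proof (rule sum_mono)
    fix j
    have n: "n + L * j \<ge> n0" using assms by simp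
    have *: "cos_prod (Suc k) \<theta> (n + L * (j + i * p ^ k)) = cos_prod k \<theta> (n + L * j) *
      \<bar>cos (pi * (\<theta> k + of_int (h * b ^ (n + L * j + L * (i * p ^ k))) / of_int (Q * int p ^ (r + k + 1))))\<bar>" for i
    proof -
      have eq: "n + L * (j + i * p ^ k) = n + L * j + L * (i * p ^ k)" by (simp add: algebra_simps)
      have "cos_prod (Suc k) \<theta> m = cos_prod k \<theta> m *
          \<bar>cos (pi * (\<theta> k + of_int (h * b ^ m) / of_int (Q * int p ^ (r + k + 1))))\<bar>" for m
        by (simp add: cos_prod_def)
      from this[of "n + L * j + L * (i * p ^ k)"] show ?thesis
        unfolding eq cos_prod_periodic[OF n] .
    qed
    show "(\<Sum>i<p. cos_prod (Suc k) \<theta> (n + L * (j + i * p ^ k))) \<le> cos_prod k \<theta> (n + L * j) * (3 / 4 * real p)"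
      unfolding * sum_distrib_left[symmetric]
      by (intro mult_left_mono sum_cos_last_factor[OF n] cos_prod_nonneg)
  qed
  also have "\<dots> \<le> (3 / 4 * real p) ^ k * (3 / 4 * real p)"
    unfolding sum_distrib_right[symmetric] by (intro mult_right_mono Suc) simp
  finally show ?case by (simp add: mult.commute)
qed

lemma sum_cos_prod_period:
  assumes "n \<ge> n0"
  shows "(\<Sum>i<p ^ k * L. cos_prod k \<theta> (n + i)) \<le> real (p ^ k * L) * (3 / 4) ^ k"
proof -
  have "(\<Sum>i<p ^ k * L. cos_prod k \<theta> (n + i)) =
     (\<Sum>j<L. \<Sum>l<p ^ k. cos_prod k \<theta> ((n + j) + L * l))"
    unfolding sum_lessThan_mult by (simp add: ac_simps)
  also have "\<dots> \<le> (\<Sum>j<L. (3 / 4 * real p) ^ k)"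
    using assms by (intro sum_mono sum_cos_prod_progression) simp
  also have "\<dots> = real (p ^ k * L) * (3 / 4) ^ k"
    by (simp only: power_mult_distrib sum_constant card_lessThan of_nat_mult of_nat_power mult_ac)
  finally show ?thesis .
qed

lemma sum_cos_prod_le:
  "(\<Sum>n<N. cos_prod k \<theta> n) \<le> real n0 + (real N + real (p ^ k * L)) * (3 / 4) ^ k"
proof -
  define W where "W = p ^ k * L"
  define K where "K = N div W + 1"
  have W: "W > 0" using p_pos L1 by (simp add: W_def)
  have KW: "N \<le> K * W" unfolding K_def
    using W by (metis Suc_eq_plus1 dividend_less_times_div less_imp_le mult.commute mult_Suc_right)
  have "(\<Sum>n<N. cos_prod k \<theta> n) \<le> (\<Sum>n<n0 + K * W. cos_prod k \<theta> n)"
    using KW by (intro sum_mono2) (auto simp: cos_prod_nonneg)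
  also have "\<dots> = (\<Sum>n<n0. cos_prod k \<theta> n) + (\<Sum>i<K * W. cos_prod k \<theta> (n0 + i))"
    by (rule sum_lessThan_add)
  also have "(\<Sum>n<n0. cos_prod k \<theta> n) \<le> real n0"
    using sum_bounded_above[of "{..<n0}" "cos_prod k \<theta>" 1] by (simp add: cos_prod_le_1)
  also have "(\<Sum>i<K * W. cos_prod k \<theta> (n0 + i)) =
      (\<Sum>m<K. \<Sum>i<W. cos_prod k \<theta> ((n0 + m * W) + i))"
    unfolding sum_lessThan_mult[of _ K W] by (subst sum.swap) (simp add: ac_simps)
  also have "\<dots> \<le> (\<Sum>m<K. real W * (3 / 4) ^ k)"
    unfolding W_def by (intro sum_mono sum_cos_prod_period) simp
  also have "\<dots> = real (K * W) * (3 / 4) ^ k" by simp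
  also have "real (K * W) \<le> real N + real W"
    unfolding of_nat_add[symmetric] of_nat_le_iff by (simp add: K_def)
  finally show ?thesis by (simp add: W_def mult_right_mono)
qed

end

primrec block_prime :: "nat \<Rightarrow> nat" where
  "block_prime 0 = 5"
| "block_prime (Suc i) = (LEAST q. prime q \<and> block_prime i < q)"

lemma
  shows prime_block_prime_Suc: "prime (block_prime (Suc i))"
    and block_prime_less_Suc: "block_prime i < block_prime (Suc i)"
    and block_prime_Suc_le: "block_prime (Suc i) \<le> fact (block_prime i) + 1"
proof -
  obtain q where q: "prime q" "block_prime i < q" "q \<le> fact (block_prime i) + 1"
    using next_prime_bound by blast
  have "prime (block_prime (Suc i)) \<and> block_prime i < block_prime (Suc i)"
    unfolding block_prime.simps by (rule LeastI[of _ q]) (use q in auto)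
  thus "prime (block_prime (Suc i))" "block_prime i < block_prime (Suc i)" by auto
  have "block_prime (Suc i) \<le> q"
    unfolding block_prime.simps by (rule Least_le) (use q in auto)
  with q show "block_prime (Suc i) \<le> fact (block_prime i) + 1" by linarith
qed

lemma prime_block_prime: "prime (block_prime i)"
proof (cases i)
  case 0
  have "prime (5::nat)" by (simp add: prime_nat_numeral_eq)
  thus ?thesis using 0 by simp
qed (use prime_block_prime_Suc in blast)

lemma block_prime_ge: "block_prime i \<ge> i + 5"
proof (induction i)
  case (Suc i)
  thus ?case using block_prime_less_Suc[of i] by linarith
qed simp

lemma odd_block_prime: "odd (block_prime i)"
  using prime_odd_nat[OF prime_block_prime] block_prime_ge[of i] by simp

definition block_start :: "nat \<Rightarrow> nat" where
  "block_start i = (\<Sum>k<i. block_prime k ^ 3)"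

lemma block_start_Suc: "block_start (Suc i) = block_start i + block_prime i ^ 3"
  by (simp add: block_start_def)

lemma block_start_mono: "i \<le> j \<Longrightarrow> block_start i \<le> block_start j"
  by (rule lift_Suc_mono_le[of block_start]) (simp_all add: block_start_Suc)

definition moran_base :: "nat \<Rightarrow> int" where
  "moran_base n = int (block_prime (LEAST i. n \<le> block_start (Suc i)))"

lemma moran_base_block:
  assumes "block_start i < n" "n \<le> block_start (Suc i)"
  shows "moran_base n = int (block_prime i)"
proof -
  have "(LEAST i. n \<le> block_start (Suc i)) = i"
  proof (rule Least_equality)
    fix k assume k: "n \<le> block_start (Suc k)"
    show "i \<le> k"
    proof (rule ccontr)
      assume "\<not> i \<le> k"
      hence "block_start (Suc k) \<le> block_start i" by (intro block_start_mono) simp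
      thus False using k assms(1) by simp
    qed
  qed (use assms in simp)
  thus ?thesis by (simp add: moran_base_def)
qed

lemma moran_base_ge: "moran_base n \<ge> 5"
  using block_prime_ge by (simp add: moran_base_def) (metis add_leE)

definition denom :: "nat \<Rightarrow> int" where
  "denom n = (\<Prod>k=1..n. moran_base k)"

lemma denom_0 [simp]: "denom 0 = 1"
  by (simp add: denom_def)

lemma denom_Suc: "denom (Suc n) = denom n * moran_base (Suc n)"
  by (simp add: denom_def)

lemma denom_ge: "denom n \<ge> 5 ^ n"
proof (induction n)
  case (Suc n)
  have "5 ^ n * 5 \<le> denom n * moran_base (Suc n)"
    using Suc moran_base_ge[of "Suc n"] by (intro mult_mono) (auto intro: order_trans[of 0 "5 ^ n"])
  thus ?case by (simp add: denom_Suc mult.commute)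
qed simp

lemma denom_pos: "denom n > 0"
  using denom_ge[of n] by (meson less_le_trans zero_less_numeral zero_less_power)

lemma denom_ge_self: "denom n \<ge> int n"
proof -
  have "int n < 2 ^ n" by (rule of_nat_less_two_power)
  also have "(2::int) ^ n \<le> 5 ^ n" by (rule power_mono) auto
  finally show ?thesis using denom_ge[of n] by linarith
qed

lemma denom_block:
  "t \<le> block_prime i ^ 3 \<Longrightarrow> denom (block_start i + t) = denom (block_start i) * int (block_prime i) ^ t"
proof (induction t)
  case (Suc t)
  have "moran_base (Suc (block_start i + t)) = int (block_prime i)"
    using Suc.prems by (intro moran_base_block) (auto simp: block_start_Suc)
  thus ?case using Suc by (simp add: denom_Suc)
qed simp

lemma denom_block_start_Suc:
  "denom (block_start (Suc i)) = denom (block_start i) * int (block_prime i) ^ (block_prime i ^ 3)"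
  by (simp add: block_start_Suc denom_block)

lemma not_dvd_denom_block_start:
  "prime q \<Longrightarrow> q \<ge> block_prime i \<Longrightarrow> \<not> int q dvd denom (block_start i)"
proof (induction i)
  case 0
  thus ?case by (simp add: block_start_def zdvd1_eq)
next
  case (Suc i)
  have "q > block_prime i" using Suc.prems(2) block_prime_less_Suc[of i] by linarith
  moreover from this have "\<not> int q dvd int (block_prime i) ^ (block_prime i ^ 3)"
    using block_prime_ge[of i] Suc.prems(1) prime_dvd_power[of "int q" "int (block_prime i)"]
      dvd_imp_le[of q "block_prime i"] by auto
  ultimately show ?case using Suc
    by (simp add: denom_block_start_Suc prime_dvd_mult_iff)
qed

lemma exists_period:
  fixes b :: int
  shows "\<exists>E\<ge>1. int E \<le> denom (block_start i) \<and> (\<forall>q. prime q \<longrightarrow> q \<ge> block_prime i \<longrightarrow> \<not> q dvd E) \<and>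
    denom (block_start i) dvd b ^ block_start i * (b ^ E - 1)"
proof (induction i)
  case 0
  show ?case by (intro exI[of _ 1]) (auto simp: block_start_def)
next
  case (Suc i)
  define p where "p = block_prime i"
  define m where "m = p ^ (p ^ 3)"
  from Suc obtain E where E: "E \<ge> 1" "int E \<le> denom (block_start i)"
    "\<And>q. prime q \<Longrightarrow> q \<ge> p \<Longrightarrow> \<not> q dvd E"
    "denom (block_start i) dvd b ^ block_start i * (b ^ E - 1)" unfolding p_def by blast
  have p: "prime p" "p \<ge> 5" using prime_block_prime block_prime_ge[of i] by (auto simp: p_def)
  have m0: "m > 0" using p by (simp add: m_def)
  have tot: "totient m = p ^ (p ^ 3 - 1) * (p - 1)"
    using p by (simp add: m_def totient_prime_power)
  have d: "denom (block_start (Suc i)) = denom (block_start i) * int m"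
    by (simp add: denom_block_start_Suc m_def p_def)
  have cop: "coprime (denom (block_start i)) (int m)"
  proof -
    have "coprime (int p) (denom (block_start i))"
      using not_dvd_denom_block_start[OF p(1), of i] p(1)
      by (intro prime_imp_coprime) (auto simp: p_def)
    thus ?thesis by (simp add: m_def coprime_commute[of "denom (block_start i)"])
  qed
  show ?case
  proof (intro exI[of _ "E * totient m"] conjI allI impI)
    show "1 \<le> E * totient m" using E(1) m0 by (simp add: Suc_le_eq)
    have "int E * int (totient m) \<le> denom (block_start i) * int m"
      using E(2) totient_le[of m] denom_pos[of "block_start i"] by (intro mult_mono) auto
    thus "int (E * totient m) \<le> denom (block_start (Suc i))" by (simp add: d)
  next
    fix q assume q: "prime q" "block_prime (Suc i) \<le> q"
    have qp: "q > p" using q(2) block_prime_less_Suc[of i] by (simp add: p_def)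
    have "\<not> q dvd p ^ (p ^ 3 - 1)"
      using q(1) p qp prime_dvd_power[of q p] dvd_imp_le[of q p] by auto
    moreover have "\<not> q dvd p - 1" using qp p(2) by (auto dest: dvd_imp_le)
    ultimately show "\<not> q dvd E * totient m"
      using E(3)[of q] q(1) qp by (simp add: tot prime_dvd_mult_iff)
  next
    have 1: "denom (block_start i) dvd b ^ block_start (Suc i) * (b ^ (E * totient m) - 1)"
    proof -
      have "b ^ E - 1 dvd b ^ (E * totient m) - 1" by (simp add: power_mult power_diff_1_eq)
      moreover have "b ^ block_start i dvd b ^ block_start (Suc i)"
        by (intro le_imp_power_dvd block_start_mono) simp
      ultimately show ?thesis using dvd_trans[OF E(4)] by (meson mult_dvd_mono)
    qed
    have 2: "int m dvd b ^ block_start (Suc i) * (b ^ (E * totient m) - 1)"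
    proof (cases "int p dvd b")
      case True
      have "int m dvd b ^ (p ^ 3)" using True by (simp add: m_def dvd_power_same)
      also have "b ^ (p ^ 3) dvd b ^ block_start (Suc i)"
        by (intro le_imp_power_dvd) (simp add: block_start_Suc p_def)
      finally show ?thesis by (rule dvd_mult2)
    next
      case False
      have "coprime b (int m)"
        using False p(1) prime_imp_coprime[of "int p" b] by (simp add: m_def coprime_commute)
      define a where "a = nat (b mod int m)"
      have a: "[int a = b] (mod int m)" using m0 by (simp add: a_def cong_def)
      have "coprime (int a) (int m)"
        using \<open>coprime b (int m)\<close> cong_imp_coprime[OF cong_sym[OF a]] by blast
      hence "[a ^ totient m = 1] (mod m)" by (intro euler_theorem) (simp add: coprime_int_iff)
      hence "[int (a ^ totient m) = int 1] (mod int m)" by (simp only: cong_int_iff)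
      hence "[int a ^ totient m = 1] (mod int m)" by simp
      with cong_pow[OF a, of "totient m"] have "[b ^ totient m = 1] (mod int m)"
        using cong_sym cong_trans by blast
      from cong_pow[OF this, of E] have "[b ^ (E * totient m) = 1] (mod int m)"
        by (simp add: mult.commute flip: power_mult)
      hence "int m dvd b ^ (E * totient m) - 1" by (simp add: cong_iff_dvd_diff)
      thus ?thesis by (rule dvd_mult)
    qed
    show "denom (block_start (Suc i)) dvd b ^ block_start (Suc i) * (b ^ (E * totient m) - 1)"
      unfolding d using 1 2 cop by (rule divides_mult)
  qed
qed

definition cos_prefix :: "nat \<Rightarrow> real \<Rightarrow> real" where
  "cos_prefix n \<xi> = (\<Prod>j=1..n. \<bar>cos (pi * \<xi> / of_int (denom j))\<bar>)"

lemma sum_cos_prefix_le: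
  fixes b h :: int
  assumes b: "b \<ge> 2" "int (block_prime i) > b" and h: "h \<noteq> 0" "int (block_prime i) > \<bar>h\<bar>"
    and N: "int N \<ge> (denom (block_start (Suc i)))\<^sup>2"
  shows "(\<Sum>m<N. \<Sum>n<N. cos_prefix (block_start (Suc i)) (of_int (h * (b ^ n - b ^ m))))
    \<le> 3 * (real N)\<^sup>2 * (3 / 4) powr (real (block_prime i) ^ 3 - real (block_prime i))"
proof -
  define p where "p = block_prime i"
  define Q where "Q = denom (block_start i)"
  define n0 where "n0 = block_start i"
  have p: "prime p" "p \<ge> 5" "odd p"
    using prime_block_prime block_prime_ge[of i] odd_block_prime by (auto simp: p_def)
  have bp: "\<not> int p dvd b" using b by (auto simp: p_def dest: zdvd_imp_le)
  have hp: "\<not> int p dvd h" using h dvd_imp_le_int[of h "int p"] by (auto simp: p_def)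
  have Qp: "\<not> int p dvd Q" unfolding Q_def p_def
    by (rule not_dvd_denom_block_start[OF prime_block_prime]) simp
  have Q0: "Q > 0" by (simp add: Q_def denom_pos)
  define z where "z = b ^ (p - 1) - 1"
  have "b ^ 1 \<le> b ^ (p - 1)" using b p by (intro power_increasing) auto
  hence z0: "z > 0" using b by (simp add: z_def)
  have "\<not> is_unit (int p)" using p by simp
  then obtain u where u: "z = int p ^ multiplicity (int p) z * u" "\<not> int p dvd u"
    using z0 multiplicity_decompose'[of z "int p"] by force
  define r where "r = multiplicity (int p) z"
  have "int p dvd z"
  proof -
    have "coprime b (int p)"
      using bp p(1) prime_imp_coprime[of "int p" b] by (simp add: coprime_commute)
    define a where "a = nat b"
    have a: "b = int a" using b by (simp add: a_def)
    have "coprime a p" using \<open>coprime b (int p)\<close> by (simp add: a coprime_int_iff)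
    hence "[a ^ totient p = 1] (mod p)" by (rule euler_theorem)
    hence "[int (a ^ totient p) = int 1] (mod int p)" by (simp only: cong_int_iff)
    thus ?thesis using p(1) by (simp add: z_def a totient_prime cong_iff_dvd_diff)
  qed
  hence r1: "r \<ge> 1" unfolding r_def using z0 p by (simp add: Suc_le_eq prime_multiplicity_gt_zero_iff)
  have rp: "r \<le> p"
  proof (rule ccontr)
    assume "\<not> r \<le> p"
    have "int p ^ r dvd z" unfolding r_def by (rule multiplicity_dvd)
    hence "int p ^ r \<le> z" using z0 by (rule zdvd_imp_le)
    also have "z < b ^ (p - 1)" by (simp add: z_def)
    also have "\<dots> \<le> int p ^ (p - 1)" using b by (intro power_mono) (auto simp: p_def)
    also have "\<dots> \<le> int p ^ r" using \<open>\<not> r \<le> p\<close> p by (intro power_increasing) auto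
    finally show False by simp
  qed
  obtain E where E: "E \<ge> 1" "int E \<le> Q" "\<And>q. prime q \<Longrightarrow> q \<ge> p \<Longrightarrow> \<not> q dvd E"
    "Q dvd b ^ n0 * (b ^ E - 1)" using exists_period[of i b] unfolding Q_def p_def n0_def by blast
  define L where "L = E * (p - 1)"
  have L1: "L \<ge> 1" using E(1) p by (simp add: L_def Suc_le_eq)
  have "b ^ L = (b ^ (p - 1)) ^ E" by (simp add: L_def mult.commute flip: power_mult)
  with power_minus_one_prime_part[OF p(1) r1 _ u(2), of "b ^ (p - 1)" E] u(1) E(3)[of p] p(1)
  obtain v where v: "b ^ L - 1 = int p ^ r * v" "\<not> int p dvd v" unfolding z_def r_def by auto
  have "b ^ E - 1 dvd b ^ L - 1" by (simp add: L_def power_mult power_diff_1_eq)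
  hence QL: "Q dvd b ^ n0 * (b ^ L - 1)" using E(4) by (meson dvd_trans mult_dvd_mono dvd_refl)
  interpret prime_power_tower p L r n0 b h Q v
    using p r1 L1 v Q0 Qp QL bp hp by unfold_locales auto
  have p3: "p ^ 3 \<ge> p" using p by (simp add: power3_eq_cube)
  define k where "k = p ^ 3 - r"
  have k: "r + k = p ^ 3" using rp p3 by (simp add: k_def)
  have den: "denom (n0 + (r + t + 1)) = Q * int p ^ (r + t + 1)" if "t < k" for t
    unfolding n0_def Q_def p_def using that k by (intro denom_block) (simp add: p_def)
  have Q': "denom (block_start (Suc i)) = Q * int p ^ (p ^ 3)"
    by (simp add: denom_block_start_Suc Q_def p_def)
  have le: "cos_prefix (block_start (Suc i)) (of_int (h * (b ^ n - b ^ m))) \<le>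
      cos_prod k (\<lambda>t. - (of_int (h * b ^ m) / of_int (Q * int p ^ (r + t + 1)))) n" (is "_ \<le> ?R") for m n
  proof -
    define f where "f = (\<lambda>j. \<bar>cos (pi * of_int (h * (b ^ n - b ^ m)) / of_int (denom j))\<bar>)"
    have "inj_on (\<lambda>t. n0 + (r + t + 1)) {..<k}" by (auto simp: inj_on_def)
    hence "(\<Prod>t<k. f (n0 + (r + t + 1))) = prod f ((\<lambda>t. n0 + (r + t + 1)) ` {..<k})"
      by (simp add: prod.reindex)
    also have "\<dots> \<ge> prod f {1..block_start (Suc i)}"
    proof -
      define A where "A = (\<lambda>t. n0 + (r + t + 1)) ` {..<k}"
      have "A \<subseteq> {1..block_start (Suc i)}"
        using k by (auto simp: A_def block_start_Suc n0_def p_def)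
      hence "prod f {1..block_start (Suc i)} = prod f ({1..block_start (Suc i)} - A) * prod f A"
        by (intro prod.subset_diff) auto
      also have "\<dots> \<le> 1 * prod f A"
        by (intro mult_right_mono prod_le_1 prod_nonneg) (auto simp: f_def)
      finally show ?thesis by (simp add: A_def)
    qed
    finally have "prod f {1..block_start (Suc i)} \<le> (\<Prod>t<k. f (n0 + (r + t + 1)))" .
    also have "\<dots> = ?R"
      unfolding cos_prod_def
    proof (rule prod.cong[OF refl])
      fix t assume "t \<in> {..<k}"
      thus "f (n0 + (r + t + 1)) = \<bar>cos (pi * (- (of_int (h * b ^ m) / of_int (Q * int p ^ (r + t + 1))) +
          of_int (h * b ^ n) / of_int (Q * int p ^ (r + t + 1))))\<bar>"
        using den[of t] unfolding f_def by (simp add: diff_divide_distrib right_diff_distrib)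
    qed
    finally show ?thesis by (simp add: cos_prefix_def f_def)
  qed
  have "(\<Sum>m<N. \<Sum>n<N. cos_prefix (block_start (Suc i)) (of_int (h * (b ^ n - b ^ m)))) \<le>
     (\<Sum>m<N. real n0 + (real N + real (p ^ k * L)) * (3 / 4) ^ k)"
    by (intro sum_mono order_trans[OF sum_mono[OF le] sum_cos_prod_le])
  also have "\<dots> = real N * (real n0 + (real N + real (p ^ k * L)) * (3 / 4) ^ k)" by simp
  also have "\<dots> \<le> real N * (real N * (3 / 4) ^ k + (real N + real N) * (3 / 4) ^ k)"
  proof (intro mult_left_mono add_mono mult_right_mono order_refl)
    define P where "P = int p ^ (p ^ 3)"
    have P: "P \<ge> int p" unfolding P_def using p power_increasing[of 1 "p ^ 3" "int p"] by (simp add: Suc_le_eq)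
    have NQ: "int N \<ge> (Q * P)\<^sup>2" using N by (simp add: Q' P_def)
    have pk: "int p ^ k \<le> P" unfolding P_def using p k by (intro power_increasing) auto
    have "int L \<le> Q * int p" unfolding L_def using E(2) Q0 by (simp add: mult_mono)
    hence "int p ^ k * int L \<le> P * (Q * int p)" using pk P by (intro mult_mono) auto
    hence "int (p ^ k * L) \<le> P * (Q * int p)" by simp
    also have "\<dots> \<le> P * (Q * P)" using P Q0 by (intro mult_left_mono) auto
    also have "\<dots> \<le> Q * (P * (Q * P))"
      using P Q0 mult_right_mono[of 1 Q "P * (Q * P)"] by simp
    also have "\<dots> \<le> int N" using NQ by (simp add: power2_eq_square ac_simps)
    finally have "int (p ^ k * L) \<le> int N" .
    thus "real (p ^ k * L) \<le> real N" by linarith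
    have "real_of_int (int n0) \<le> of_int Q" unfolding of_int_le_iff Q_def n0_def by (rule denom_ge_self)
    hence "real n0 * (4 / 3) ^ k \<le> of_int Q * (4 / 3) ^ k" by (intro mult_right_mono) auto
    also have "(4 / 3 :: real) ^ k \<le> real p ^ k" using p by (intro power_mono) auto
    also have "real p ^ k \<le> of_int P" using pk by (metis of_int_le_iff of_int_of_nat_eq of_int_power)
    also have "of_int Q * real_of_int P \<le> real N"
    proof -
      have "Q * P * 1 \<le> Q * P * (Q * P)" using P p Q0 by (intro mult_left_mono) (auto simp: mult_le_cancel_left1 int_one_le_iff_zero_less)
      also have "\<dots> \<le> int N" using NQ by (simp add: power2_eq_square)
      finally have "real_of_int (Q * P) \<le> real_of_int (int N)" unfolding of_int_le_iff by simp
      thus ?thesis by simp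
    qed
    finally show "real n0 \<le> real N * (3 / 4) ^ k" using Q0 by (simp add: power_divide field_simps)
  qed auto
  also have "\<dots> = 3 * (real N)\<^sup>2 * (3 / 4) ^ k" by (simp add: power2_eq_square algebra_simps)
  also have "\<dots> \<le> 3 * (real N)\<^sup>2 * (3 / 4) powr (real p ^ 3 - real p)"
  proof (rule mult_left_mono)
    have "real k = real p ^ 3 - real r" using k by (metis add_diff_cancel_left' of_nat_add of_nat_power)
    hence "real p ^ 3 - real p \<le> real k" using rp by simp
    hence "(3 / 4 :: real) powr real k \<le> (3 / 4) powr (real p ^ 3 - real p)"
      by (intro powr_mono') auto
    thus "(3 / 4 :: real) ^ k \<le> (3 / 4) powr (real p ^ 3 - real p)"
      by (simp add: powr_realpow)
  qed simp
  finally show ?thesis by (simp add: p_def)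
qed

lemma ln_denom_block_start_le:
  "ln (of_int (denom (block_start (Suc i)))) \<le> real (block_prime i) ^ 5"
proof -
  have "ln (of_int (denom (block_start (Suc i)))) \<le> real (Suc i) * real (block_prime i) ^ 4"
  proof (induction i)
    case 0
    define p where "p = real (block_prime 0)"
    have p: "p \<ge> 5" using block_prime_ge[of 0] by (simp add: p_def)
    have "ln (of_int (denom (block_start (Suc 0)))) = p ^ 3 * ln p"
      unfolding denom_block_start_Suc[of 0] using p
      by (simp add: block_start_def p_def ln_realpow del: block_prime.simps)
    also have "\<dots> \<le> p ^ 3 * p"
      using p ln_le_minus_one[of p] by (intro mult_left_mono) auto
    also have "\<dots> = real (Suc 0) * p ^ 4" by (simp add: power4_eq_xxxx power3_eq_cube)
    finally show ?case by (simp add: p_def del: block_prime.simps)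
  next
    case (Suc i)
    define p where "p = real (block_prime (Suc i))"
    have p: "p \<ge> 5" using block_prime_ge[of "Suc i"] by (simp add: p_def)
    have le: "real (block_prime i) \<le> p" using block_prime_less_Suc[of i] by (simp add: p_def del: block_prime.simps)
    have "ln (of_int (denom (block_start (Suc (Suc i))))) =
       ln (of_int (denom (block_start (Suc i)))) + p ^ 3 * ln p"
      unfolding denom_block_start_Suc[of "Suc i"] using denom_pos[of "block_start (Suc i)"] p
      by (simp add: ln_mult ln_realpow p_def del: block_prime.simps)
    also have "\<dots> \<le> real (Suc i) * p ^ 4 + p ^ 3 * p"
    proof (intro add_mono mult_left_mono)
      have "real (Suc i) * real (block_prime i) ^ 4 \<le> real (Suc i) * p ^ 4"
        using le by (intro mult_left_mono power_mono) auto
      thus "ln (of_int (denom (block_start (Suc i)))) \<le> real (Suc i) * p ^ 4" using Suc by linarith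
      show "ln p \<le> p" using ln_le_minus_one[of p] p by linarith
    qed (use p in auto)
    also have "\<dots> = real (Suc (Suc i)) * p ^ 4" by (simp add: algebra_simps power4_eq_xxxx power3_eq_cube)
    finally show ?case by (simp add: p_def)
  qed
  also have "\<dots> \<le> real (block_prime i) * real (block_prime i) ^ 4"
    using block_prime_ge[of i] by (intro mult_right_mono) auto
  finally show ?thesis by (simp add: power_Suc[symmetric] numeral_eq_Suc)
qed

lemma ln_denom_block_start_Suc_le:
  "ln (of_int (denom (block_start (Suc (Suc i))))) \<le> 32 * real (block_prime i) powr (5 * real (block_prime i))"
proof -
  define p where "p = block_prime i"
  have p: "p > 0" using block_prime_ge[of i] by (simp add: p_def)
  have "block_prime (Suc i) \<le> fact p + 1" unfolding p_def by (rule block_prime_Suc_le)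
  also have "\<dots> \<le> p ^ p + p ^ p"
    using p fact_le_power[of p, where 'a = nat] by (intro add_mono) (auto simp: Suc_le_eq)
  finally have "real (block_prime (Suc i)) \<le> 2 * real p ^ p"
    by (metis mult_2 of_nat_le_iff of_nat_mult of_nat_numeral of_nat_power)
  hence "real (block_prime (Suc i)) ^ 5 \<le> (2 * real p ^ p) ^ 5" by (intro power_mono) auto
  also have "\<dots> = 32 * real p ^ (p * 5)" by (simp add: power_mult_distrib power_mult)
  also have "real p ^ (p * 5) = real p powr (5 * real p)"
    using p powr_realpow[of "real p" "p * 5"] by (simp add: mult.commute)
  finally show ?thesis using ln_denom_block_start_le[of "Suc i"] unfolding p_def by linarith
qed

lemma block_decay_bounded:
  "\<exists>C. \<forall>p::nat. 3 * (3 / 4) powr (real p ^ 3 - real p) * (64 * real p powr (5 * real p)) ^ 4 \<le> C"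
proof -
  define f where "f = (\<lambda>p::nat. 3 * (3 / 4) powr (real p ^ 3 - real p) * (64 * real p powr (5 * real p)) ^ 4)"
  have "f \<longlonglongrightarrow> 0" unfolding f_def by real_asymp
  hence "Bseq f" by (simp add: convergentI convergent_imp_Bseq)
  then obtain K where "\<And>n. norm (f n) \<le> K" by (auto simp: Bseq_def)
  hence "\<forall>p. f p \<le> K" by (auto intro: order_trans[OF abs_ge_self])
  thus ?thesis unfolding f_def by blast
qed

theorem sum_le_of_cos_prefix_le:
  fixes b h :: int and f :: "real \<Rightarrow> real"
  assumes f: "\<And>n \<xi>. f \<xi> \<le> cos_prefix n \<xi>" and b: "b \<ge> 2" and h: "h \<noteq> 0"
  shows "\<exists>C. \<forall>\<^sub>F N in sequentially.
    (\<Sum>m<N. \<Sum>n<N. f (of_int (h * (b ^ n - b ^ m)))) \<le> C * (real N)\<^sup>2 / ln (real N) ^ 4"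
proof -
  obtain C where C: "\<And>p::nat. 3 * (3 / 4) powr (real p ^ 3 - real p) * (64 * real p powr (5 * real p)) ^ 4 \<le> C"
    using block_decay_bounded by blast
  define R where "R = (\<lambda>i. nat ((denom (block_start (Suc i)))\<^sup>2))"
  have intR: "int (R i) = (denom (block_start (Suc i)))\<^sup>2" for i by (simp add: R_def)
  have R_ge: "R i \<ge> i" for i
  proof -
    have "i < block_start (Suc i)"
    proof (induction i)
      case (Suc i)
      have "block_prime (Suc i) ^ 3 > 0" using block_prime_ge[of "Suc i"] by simp
      thus ?case using Suc unfolding block_start_Suc[of "Suc i"] by linarith
    qed (simp add: block_start_def)
    hence "int i \<le> denom (block_start (Suc i))" using denom_ge_self[of "block_start (Suc i)"] by linarith
    also have "\<dots> \<le> (denom (block_start (Suc i)))\<^sup>2"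
      using denom_pos[of "block_start (Suc i)"] by (simp add: power2_eq_square)
    finally show ?thesis unfolding intR[symmetric] by simp
  qed
  define i0 where "i0 = nat (\<bar>h\<bar> + b)"
  have "(\<Sum>m<N. \<Sum>n<N. f (of_int (h * (b ^ n - b ^ m)))) \<le> C * (real N)\<^sup>2 / ln (real N) ^ 4"
    if N: "N \<ge> R i0 + 2" for N
  proof -
    define i where "i = (GREATEST i. R i \<le> N)"
    have bd: "i \<le> N" if "R i \<le> N" for i using R_ge[of i] that by linarith
    have i: "R i \<le> N" unfolding i_def by (rule GreatestI_nat[where k = i0 and b = N]) (use N bd in auto)
    have i_i0: "i \<ge> i0" unfolding i_def by (rule Greatest_le_nat[where b = N]) (use N bd in auto)
    have "\<not> R (Suc i) \<le> N"
    proof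
      assume "R (Suc i) \<le> N"
      hence "Suc i \<le> i" unfolding i_def by (rule Greatest_le_nat[where b = N]) (use bd in auto)
      thus False by simp
    qed
    hence N_less: "int N < (denom (block_start (Suc (Suc i))))\<^sup>2" unfolding intR[symmetric] by simp
    define p where "p = block_prime i"
    have pi0: "int p \<ge> \<bar>h\<bar> + b + 5" using block_prime_ge[of i] i_i0 b by (simp add: p_def i0_def)
    have "(\<Sum>m<N. \<Sum>n<N. f (of_int (h * (b ^ n - b ^ m)))) \<le>
       (\<Sum>m<N. \<Sum>n<N. cos_prefix (block_start (Suc i)) (of_int (h * (b ^ n - b ^ m))))"
      by (intro sum_mono f)
    also have "\<dots> \<le> 3 * (real N)\<^sup>2 * (3 / 4) powr (real p ^ 3 - real p)"
      unfolding p_def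
    proof (rule sum_cos_prefix_le)
      show "(denom (block_start (Suc i)))\<^sup>2 \<le> int N" using i unfolding intR[symmetric] by simp
    qed (use b h pi0 in \<open>auto simp: p_def\<close>)
    finally have le: "(\<Sum>m<N. \<Sum>n<N. f (of_int (h * (b ^ n - b ^ m)))) \<le>
      3 * (real N)\<^sup>2 * (3 / 4) powr (real p ^ 3 - real p)" .
    have lnN: "ln (real N) > 0" using N by simp
    have "real N \<le> of_int ((denom (block_start (Suc (Suc i))))\<^sup>2)"
      using N_less by linarith
    hence "ln (real N) \<le> ln ((of_int (denom (block_start (Suc (Suc i)))))\<^sup>2)"
      using N by (subst ln_le_cancel_iff) (auto simp: denom_pos)
    also have "\<dots> = 2 * ln (of_int (denom (block_start (Suc (Suc i)))))"
      using denom_pos by (simp add: ln_realpow)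
    also have "\<dots> \<le> 64 * real p powr (5 * real p)"
      using ln_denom_block_start_Suc_le[of i] by (simp add: p_def)
    finally have "ln (real N) ^ 4 \<le> (64 * real p powr (5 * real p)) ^ 4"
      using lnN by (intro power_mono) auto
    hence "3 * (3 / 4) powr (real p ^ 3 - real p) * ln (real N) ^ 4 \<le>
       3 * (3 / 4) powr (real p ^ 3 - real p) * (64 * real p powr (5 * real p)) ^ 4"
      by (intro mult_left_mono) auto
    also have "\<dots> \<le> C" by (rule C)
    finally have "3 * (3 / 4) powr (real p ^ 3 - real p) \<le> C / ln (real N) ^ 4"
      using lnN by (simp add: field_simps)
    hence "(real N)\<^sup>2 * (3 * (3 / 4) powr (real p ^ 3 - real p)) \<le> (real N)\<^sup>2 * (C / ln (real N) ^ 4)"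
      by (intro mult_left_mono) auto
    with le show ?thesis by (simp add: mult_ac)
  qed
  thus ?thesis unfolding eventually_sequentially by blast
qed

section \<open>Bernoulli convolutions\<close>

definition coin_flips :: "(nat \<Rightarrow> bool) measure" where
  "coin_flips = PiM UNIV (\<lambda>_. measure_pmf (bernoulli_pmf (1/2)))"

definition coin_term :: "(nat \<Rightarrow> real) \<Rightarrow> nat \<Rightarrow> (nat \<Rightarrow> bool) \<Rightarrow> real" where
  "coin_term x i \<omega> = (if \<omega> i then x i else 0)"

interpretation coins: product_prob_space "\<lambda>_. measure_pmf (bernoulli_pmf (1/2))" UNIV
  by unfold_locales

interpretation coin_flips: prob_space coin_flips
  unfolding coin_flips_def by (intro prob_space_PiM measure_pmf.prob_space_axioms)

lemma measurable_coin_term [measurable]: "coin_term x i \<in> borel_measurable coin_flips"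
  unfolding coin_term_def coin_flips_def by measurable

lemma distr_coin_term_eq_pmf:
  "distr coin_flips borel (coin_term x i) =
    distr (measure_pmf (bernoulli_pmf (1/2))) borel (\<lambda>c. if c then x i else 0)"
proof -
  have "distr coin_flips borel (coin_term x i) =
      distr (distr coin_flips (measure_pmf (bernoulli_pmf (1/2))) (\<lambda>\<omega>. \<omega> i)) borel (\<lambda>c. if c then x i else 0)"
    unfolding coin_flips_def by (subst distr_distr) (auto simp: comp_def coin_term_def[abs_def])
  also have "distr coin_flips (measure_pmf (bernoulli_pmf (1/2))) (\<lambda>\<omega>. \<omega> i) = measure_pmf (bernoulli_pmf (1/2))"
    unfolding coin_flips_def by (rule coins.PiM_component) simp
  finally show ?thesis .
qed

lemma distr_coin_term:
  "distr coin_flips borel (coin_term x i) = half_mixture (return borel 0) (return borel (x i))"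
proof (rule measure_eqI)
  fix A :: "real set" assume "A \<in> sets (distr coin_flips borel (coin_term x i))"
  hence A [measurable]: "A \<in> sets borel" by simp
  have "emeasure (distr coin_flips borel (coin_term x i)) A =
      emeasure (measure_pmf (bernoulli_pmf (1/2))) ((\<lambda>c. if c then x i else 0) -` A)"
    by (simp add: distr_coin_term_eq_pmf emeasure_distr)
  also have "\<dots> = (indicator A 0 + indicator A (x i)) / 2" (is "emeasure _ ?V = _")
  proof -
    have "emeasure (measure_pmf (bernoulli_pmf (1/2))) ?V =
        (\<integral>\<^sup>+ c. indicator ?V c \<partial>measure_pmf (bernoulli_pmf (1/2)))" by simp
    also have "\<dots> = indicator ?V True * inverse 2 + indicator ?V False * inverse 2"
      by (subst nn_integral_bernoulli_pmf) (auto simp: inverse_ennreal[symmetric])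
    also have "\<dots> = (indicator A 0 + indicator A (x i)) / 2"
      by (simp add: divide_ennreal_def distrib_right add.commute indicator_def)
    finally show ?thesis .
  qed
  finally show "emeasure (distr coin_flips borel (coin_term x i)) A =
      emeasure (half_mixture (return borel 0) (return borel (x i))) A"
    by (simp add: emeasure_half_mixture)
qed simp

lemma indep_coin_term: "coin_flips.indep_vars (\<lambda>_. borel) (coin_term x) UNIV"
proof -
  have "coin_flips.indep_vars (\<lambda>_. measure_pmf (bernoulli_pmf (1/2))) (\<lambda>i \<omega>. \<omega> i) UNIV"
  proof (subst coin_flips.indep_vars_iff_distr_eq_PiM)
    have "distr coin_flips (measure_pmf (bernoulli_pmf (1/2))) (\<lambda>\<omega>. \<omega> i) = measure_pmf (bernoulli_pmf (1/2))" for i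
      unfolding coin_flips_def by (rule coins.PiM_component) simp
    thus "distr coin_flips (PiM UNIV (\<lambda>_. measure_pmf (bernoulli_pmf (1/2)))) (\<lambda>x. \<lambda>i\<in>UNIV. x i) =
        PiM UNIV (\<lambda>i. distr coin_flips (measure_pmf (bernoulli_pmf (1/2))) (\<lambda>\<omega>. \<omega> i))"
      by (simp add: coin_flips_def distr_id restrict_UNIV)
  qed (auto simp: coin_flips_def)
  from coin_flips.indep_vars_compose2[OF this, of "\<lambda>i c. if c then x i else 0" "\<lambda>_. borel"]
  show ?thesis by (simp add: coin_term_def[abs_def])
qed

lemma partial_convolution_eq_distr:
  "partial_convolution (\<lambda>n. half_mixture (return borel 0) (return borel (x n))) n =
    distr coin_flips borel (\<lambda>\<omega>. \<Sum>i=1..n. coin_term x i \<omega>)"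
proof (induction n)
  case 0
  show ?case by (simp add: coin_flips.distr_const)
next
  case (Suc n)
  have "coin_flips.indep_var borel (coin_term x (Suc n)) borel (\<lambda>\<omega>. \<Sum>i\<in>{1..n}. coin_term x i \<omega>)"
    by (rule coin_flips.indep_vars_sum) (auto intro: coin_flips.indep_vars_subset[OF indep_coin_term])
  hence "distr coin_flips borel (\<lambda>\<omega>. coin_term x (Suc n) \<omega> + (\<Sum>i\<in>{1..n}. coin_term x i \<omega>)) =
    (distr coin_flips borel (coin_term x (Suc n)) \<star> distr coin_flips borel (\<lambda>\<omega>. \<Sum>i\<in>{1..n}. coin_term x i \<omega>))"
    by (intro coin_flips.sum_indep_random_variable) simp_all
  also have "\<dots> = (distr coin_flips borel (\<lambda>\<omega>. \<Sum>i\<in>{1..n}. coin_term x i \<omega>) \<star> distr coin_flips borel (coin_term x (Suc n)))"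
    by (intro convolution_commutative prob_space.finite_measure coin_flips.prob_space_distr) simp_all
  finally have "distr coin_flips borel (\<lambda>\<omega>. coin_term x (Suc n) \<omega> + (\<Sum>i\<in>{1..n}. coin_term x i \<omega>)) = \<dots>" .
  thus ?case using Suc by (simp add: distr_coin_term add.commute)
qed

lemma norm_char_coin_term: "norm (char (distr coin_flips borel (coin_term x i)) t) = \<bar>cos (t * x i / 2)\<bar>"
proof -
  have "char (distr coin_flips borel (coin_term x i)) t = (1 + iexp (t * x i)) / 2"
    by (simp add: char_def distr_coin_term_eq_pmf integral_distr integral_measure_pmf[of UNIV] UNIV_bool
      scaleR_conv_of_real field_simps)
  also have "\<dots> = iexp (t * x i / 2) * of_real (cos (t * x i / 2))"
  proof -
    define E F where "E = iexp (t * x i / 2)" and "F = iexp (- (t * x i / 2))"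
    have "iexp (t * x i) = E * E" by (simp add: E_def flip: exp_add)
    moreover have "E * F = 1" by (simp add: E_def F_def flip: exp_add)
    moreover have "complex_of_real (cos (t * x i / 2)) = (E + F) / 2"
      by (simp add: E_def F_def cos_exp_eq flip: cos_of_real)
    ultimately show ?thesis unfolding E_def[symmetric] by (simp add: algebra_simps)
  qed
  finally show ?thesis by (simp add: norm_mult)
qed

lemma norm_char_coin_sum:
  "norm (char (distr coin_flips borel (\<lambda>\<omega>. \<Sum>i=1..n. coin_term x i \<omega>)) t) = (\<Prod>i=1..n. \<bar>cos (t * x i / 2)\<bar>)"
  by (subst coin_flips.char_distr_sum)
    (auto intro: coin_flips.indep_vars_subset[OF indep_coin_term] simp: norm_char_coin_term simp flip: prod_norm)

theorem half_mixture_infinite_convolution: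
  fixes x :: "nat \<Rightarrow> real"
  assumes "summable (\<lambda>n. \<bar>x (Suc n)\<bar>)"
  obtains \<mu> where
    "has_infinite_convolution (\<lambda>n. half_mixture (return borel 0) (return borel (x n))) \<mu>"
    "\<And>\<xi> n. norm (fourier_measure \<mu> \<xi>) \<le> (\<Prod>i=1..n. \<bar>cos (pi * \<xi> * x i)\<bar>)"
proof
  define S where "S = (\<lambda>\<omega>. \<Sum>n. coin_term x (Suc n) \<omega>)"
  define \<mu> where "\<mu> = distr coin_flips borel S"
  have S [measurable]: "S \<in> borel_measurable coin_flips" unfolding S_def by measurable
  interpret \<mu>: real_distribution \<mu>
    unfolding \<mu>_def by (rule coin_flips.real_distribution_distr) simp
  have dist: "real_distribution (distr coin_flips borel (\<lambda>\<omega>. \<Sum>i=1..n. coin_term x i \<omega>))" for n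
    by (rule coin_flips.real_distribution_distr) simp
  have lim: "(\<lambda>n. \<Sum>i=1..n. coin_term x i \<omega>) \<longlonglongrightarrow> S \<omega>" for \<omega>
  proof -
    have "summable (\<lambda>n. coin_term x (Suc n) \<omega>)"
      by (rule summable_comparison_test'[OF assms, of 0]) (simp add: coin_term_def)
    hence "(\<lambda>n. \<Sum>i<n. coin_term x (Suc i) \<omega>) \<longlonglongrightarrow> S \<omega>"
      unfolding S_def by (rule summable_LIMSEQ)
    thus ?thesis by (simp add: sum.atLeast1_atMost_eq)
  qed
  have conv: "weak_conv_m (partial_convolution (\<lambda>n. half_mixture (return borel 0) (return borel (x n)))) \<mu>"
    unfolding partial_convolution_eq_distr
  proof (rule integral_bdd_continuous_conv_imp_weak_conv[OF dist \<mu>.real_distribution_axioms])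
    fix f :: "real \<Rightarrow> real" and B
    assume f: "\<And>x. isCont f x" "\<And>x. \<bar>f x\<bar> \<le> B"
    have [measurable]: "f \<in> borel_measurable borel"
      using f(1) by (intro borel_measurable_continuous_onI continuous_at_imp_continuous_on) auto
    have "(\<lambda>n. \<integral>\<omega>. f (\<Sum>i=1..n. coin_term x i \<omega>) \<partial>coin_flips) \<longlonglongrightarrow> (\<integral>\<omega>. f (S \<omega>) \<partial>coin_flips)"
    proof (rule integral_dominated_convergence[where w = "\<lambda>_. B"])
      show "AE \<omega> in coin_flips. (\<lambda>n. f (\<Sum>i=1..n. coin_term x i \<omega>)) \<longlonglongrightarrow> f (S \<omega>)"
        by (intro AE_I2 isCont_tendsto_compose[OF f(1)] lim)
    qed (use f in auto)
    thus "(\<lambda>n. integral\<^sup>L (distr coin_flips borel (\<lambda>\<omega>. \<Sum>i=1..n. coin_term x i \<omega>)) f) \<longlonglongrightarrow> integral\<^sup>L \<mu> f"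
      by (simp add: \<mu>_def integral_distr)
  qed
  thus "has_infinite_convolution (\<lambda>n. half_mixture (return borel 0) (return borel (x n))) \<mu>"
    unfolding has_infinite_convolution_def using \<mu>.real_distribution_axioms by simp
  fix \<xi> n
  define t where "t = - (2 * pi * \<xi>)"
  have "fourier_measure \<mu> \<xi> = char \<mu> t"
    unfolding fourier_measure_def char_def t_def by (intro Bochner_Integration.integral_cong) (auto simp: algebra_simps)
  moreover have "(\<lambda>N. norm (char (distr coin_flips borel (\<lambda>\<omega>. \<Sum>i=1..N. coin_term x i \<omega>)) t)) \<longlonglongrightarrow> norm (char \<mu> t)"
    using conv unfolding partial_convolution_eq_distr
    by (intro tendsto_norm levy_continuity1 dist \<mu>.real_distribution_axioms)
  moreover have "norm (char (distr coin_flips borel (\<lambda>\<omega>. \<Sum>i=1..N. coin_term x i \<omega>)) t) \<le> (\<Prod>i=1..n. \<bar>cos (t * x i / 2)\<bar>)"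
    if "N \<ge> n" for N
  proof -
    have "{1..N} = {1..n} \<union> {n<..N}" using that by auto
    hence "(\<Prod>i=1..N. \<bar>cos (t * x i / 2)\<bar>) = (\<Prod>i=1..n. \<bar>cos (t * x i / 2)\<bar>) * (\<Prod>i\<in>{n<..N}. \<bar>cos (t * x i / 2)\<bar>)"
      by (simp only:) (rule prod.union_disjoint, auto)
    also have "\<dots> \<le> (\<Prod>i=1..n. \<bar>cos (t * x i / 2)\<bar>) * 1"
      by (intro mult_left_mono prod_le_1 prod_nonneg) auto
    finally show ?thesis by (simp only: norm_char_coin_sum mult_1_right)
  qed
  ultimately have "norm (fourier_measure \<mu> \<xi>) \<le> (\<Prod>i=1..n. \<bar>cos (t * x i / 2)\<bar>)"
    by (auto intro!: LIMSEQ_le_const2)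
  thus "norm (fourier_measure \<mu> \<xi>) \<le> (\<Prod>i=1..n. \<bar>cos (pi * \<xi> * x i)\<bar>)"
    by (simp add: t_def mult.assoc)
qed

section \<open>Weyl sums and normality\<close>

inductive trig_poly :: "(real \<Rightarrow> complex) \<Rightarrow> bool" where
  trig_poly_term: "trig_poly (\<lambda>t. c * cis (2 * pi * of_int k * t))"
| trig_poly_add: "trig_poly f \<Longrightarrow> trig_poly g \<Longrightarrow> trig_poly (\<lambda>t. f t + g t)"

lemma trig_poly_const: "trig_poly (\<lambda>_. c)"
  using trig_poly_term[of c 0] by simp

lemma trig_poly_mult_term:
  "trig_poly g \<Longrightarrow> trig_poly (\<lambda>t. c * cis (2 * pi * of_int k * t) * g t)"
proof (induction rule: trig_poly.induct)
  case (trig_poly_term d l)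
  have "(\<lambda>t. c * cis (2 * pi * of_int k * t) * (d * cis (2 * pi * of_int l * t))) =
      (\<lambda>t. (c * d) * cis (2 * pi * of_int (k + l) * t))"
    by (auto simp: fun_eq_iff algebra_simps simp flip: cis_mult)
  thus ?case by (simp only: trig_poly.trig_poly_term)
next
  case (trig_poly_add f g)
  thus ?case using trig_poly.trig_poly_add by (simp add: distrib_left)
qed

lemma trig_poly_mult: "trig_poly f \<Longrightarrow> trig_poly g \<Longrightarrow> trig_poly (\<lambda>t. f t * g t)"
proof (induction f rule: trig_poly.induct)
  case (trig_poly_add f f')
  thus ?case using trig_poly.trig_poly_add by (simp add: distrib_right)
qed (rule trig_poly_mult_term)

lemma trig_poly_polynomial_on_circle:
  assumes "real_polynomial_function p"
  shows "trig_poly (\<lambda>t. of_real (p (cis (2 * pi * t))))"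
  using assms
proof (induction rule: real_polynomial_function.induct)
  case (linear f)
  then interpret bounded_linear f .
  define c where "c = (of_real (f 1) - \<i> * of_real (f \<i>)) / 2"
  define d where "d = (of_real (f 1) + \<i> * of_real (f \<i>)) / 2"
  have "complex_of_real (f (cis (2 * pi * t))) =
     c * cis (2 * pi * of_int 1 * t) + d * cis (2 * pi * of_int (- 1) * t)" for t
  proof -
    have "cis (2 * pi * t) = cos (2 * pi * t) *\<^sub>R 1 + sin (2 * pi * t) *\<^sub>R \<i>"
      by (simp add: complex_eq_iff)
    hence "f (cis (2 * pi * t)) = cos (2 * pi * t) * f 1 + sin (2 * pi * t) * f \<i>"
      by (metis add scaleR real_scaleR_def)
    thus ?thesis by (simp add: c_def d_def complex_eq_iff field_simps)
  qed
  thus ?case by (simp only: trig_poly.intros)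
next
  case (const c)
  show ?case by (rule trig_poly_const)
next
  case (add f g)
  thus ?case using trig_poly_add by simp
next
  case (mult f g)
  thus ?case using trig_poly_mult by simp
qed

lemma has_integral_cis:
  assumes "k \<noteq> 0"
  shows "((\<lambda>t. cis (2 * pi * of_int k * t)) has_integral 0) {0..1}"
proof -
  define F where "F = (\<lambda>t. cis (2 * pi * of_int k * t) / (2 * pi * of_int k * \<i>))"
  define w where "w = 2 * of_real pi * of_int k * \<i>"
  have w: "w \<noteq> 0" using assms by (simp add: w_def)
  have cis_w: "cis (2 * pi * of_int k * t) = exp (w * of_real t)" for t
    by (simp add: cis_conv_exp w_def mult_ac)
  have F_w: "F = (\<lambda>t. exp (w * of_real t) / w)"
    unfolding F_def cis_w by (simp add: w_def)
  have "(F has_vector_derivative cis (2 * pi * of_int k * t)) (at t within {0..1})" for t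
  proof -
    have "((\<lambda>z. exp (w * z) / w) has_field_derivative exp (w * of_real t)) (at (of_real t))"
      using w by (auto intro!: derivative_eq_intros)
    thus ?thesis unfolding F_w cis_w by (rule has_vector_derivative_real_field)
  qed
  hence "((\<lambda>t. cis (2 * pi * of_int k * t)) has_integral (F 1 - F 0)) {0..1}"
    by (intro fundamental_theorem_of_calculus) auto
  moreover have "F 1 = F 0" by (simp add: F_def cis_multiple_2pi)
  ultimately show ?thesis by simp
qed

lemma cis_eq_in_unit_interval:
  assumes "cis (2 * pi * t) = cis (2 * pi * s)" "0 \<le> t" "t \<le> 1" "0 \<le> s" "s \<le> 1" "t \<noteq> 0" "t \<noteq> 1"
  shows "t = s"
proof -
  have "cis (2 * pi * (t - s)) = 1"
    using assms(1) by (simp add: right_diff_distrib flip: cis_divide)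
  hence "cos (2 * pi * (t - s)) = 1" by (simp add: complex_eq_iff)
  then obtain k :: int where "2 * pi * (t - s) = of_int k * 2 * pi" using cos_one_2pi_int by auto
  hence k: "t - s = of_int k" by simp
  have "\<bar>real_of_int k\<bar> < 1" using k assms by linarith
  hence "k = 0" by linarith
  thus ?thesis using k by simp
qed

locale weyl_sequence =
  fixes y :: "nat \<Rightarrow> real"
  assumes weyl: "\<And>k::int. k \<noteq> 0 \<Longrightarrow> (\<lambda>N. (\<Sum>n<N. cis (2 * pi * of_int k * y n)) / of_nat N) \<longlonglongrightarrow> 0"
begin

lemma trig_poly_average:
  assumes "trig_poly f"
  shows "\<exists>I. (f has_integral I) {0..1} \<and> (\<lambda>N. (\<Sum>n<N. f (y n)) / of_nat N) \<longlonglongrightarrow> I"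
  using assms
proof (induction rule: trig_poly.induct)
  case (trig_poly_term c k)
  show ?case
  proof (cases "k = 0")
    case True
    have "((\<lambda>t. c * cis (2 * pi * of_int k * t)) has_integral c) {0..1}"
      using True has_integral_const_real[of c 0 1] by simp
    moreover have "(\<lambda>N. (\<Sum>n<N. c * cis (2 * pi * of_int k * y n)) / of_nat N) \<longlonglongrightarrow> c"
      by (rule tendsto_eventually, rule eventually_sequentiallyI[of 1]) (simp add: True)
    ultimately show ?thesis by blast
  next
    case False
    from has_integral_mult_right[OF has_integral_cis[OF False], of c]
    have "((\<lambda>t. c * cis (2 * pi * of_int k * t)) has_integral 0) {0..1}" by simp
    moreover from tendsto_mult_left[OF weyl[OF False], of c]
    have "(\<lambda>N. (\<Sum>n<N. c * cis (2 * pi * of_int k * y n)) / of_nat N) \<longlonglongrightarrow> 0"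
      by (simp add: sum_distrib_left)
    ultimately show ?thesis by blast
  qed
next
  case (trig_poly_add f g)
  then obtain I J where
    "(f has_integral I) {0..1}" "(\<lambda>N. (\<Sum>n<N. f (y n)) / of_nat N) \<longlonglongrightarrow> I"
    "(g has_integral J) {0..1}" "(\<lambda>N. (\<Sum>n<N. g (y n)) / of_nat N) \<longlonglongrightarrow> J" by blast
  hence "((\<lambda>t. f t + g t) has_integral I + J) {0..1}"
    "(\<lambda>N. (\<Sum>n<N. f (y n)) / of_nat N + (\<Sum>n<N. g (y n)) / of_nat N) \<longlonglongrightarrow> I + J"
    using has_integral_add tendsto_add by blast+
  thus ?case by (auto simp: sum.distrib add_divide_distrib)
qed

lemma average_less_integral:
  fixes g :: "complex \<Rightarrow> real"
  assumes g: "continuous_on (sphere 0 1) g" and \<epsilon>: "\<epsilon> > 0"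
  shows "\<forall>\<^sub>F N in sequentially.
    (\<Sum>n<N. g (cis (2 * pi * y n))) / real N < integral {0..1} (\<lambda>t. g (cis (2 * pi * t))) + \<epsilon>"
proof -
  have "\<epsilon> / 3 > 0" using \<epsilon> by simp
  from Stone_Weierstrass_real_polynomial_function[OF compact_sphere g this]
  obtain p where p: "real_polynomial_function p" "\<And>z. z \<in> sphere 0 1 \<Longrightarrow> \<bar>g z - p z\<bar> < \<epsilon> / 3" by blast
  have le: "p (cis t) \<le> g (cis t) + \<epsilon> / 3" and ge: "g (cis t) \<le> p (cis t) + \<epsilon> / 3" for t
  proof -
    have "\<bar>g (cis t) - p (cis t)\<bar> < \<epsilon> / 3" by (rule p(2)) simp
    thus "p (cis t) \<le> g (cis t) + \<epsilon> / 3" "g (cis t) \<le> p (cis t) + \<epsilon> / 3" by linarith+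
  qed
  from trig_poly_average[OF trig_poly_polynomial_on_circle[OF p(1)]] obtain I where
    I: "((\<lambda>t. complex_of_real (p (cis (2 * pi * t)))) has_integral I) {0..1}"
    "(\<lambda>N. (\<Sum>n<N. complex_of_real (p (cis (2 * pi * y n)))) / of_nat N) \<longlonglongrightarrow> I" by blast
  have int_p: "((\<lambda>t. p (cis (2 * pi * t))) has_integral Re I) {0..1}"
    using has_integral_linear[OF I(1) bounded_linear_Re] by (simp add: comp_def)
  have lim_p: "(\<lambda>N. (\<Sum>n<N. p (cis (2 * pi * y n))) / real N) \<longlonglongrightarrow> Re I"
    using tendsto_Re[OF I(2)] by (simp only: Re_divide_of_nat Re_sum Re_complex_of_real)
  have cont: "continuous_on {0..1} (\<lambda>t. g (cis (2 * pi * t)))"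
    by (rule continuous_on_compose2[OF g]) (auto intro!: continuous_intros)
  have int_g: "(\<lambda>t. g (cis (2 * pi * t))) integrable_on {0..1}"
    by (rule integrable_continuous_interval[OF cont])
  have "Re I \<le> integral {0..1} (\<lambda>t. g (cis (2 * pi * t)) + \<epsilon> / 3)"
  proof (rule has_integral_le[OF int_p])
    show "((\<lambda>t. g (cis (2 * pi * t)) + \<epsilon> / 3) has_integral integral {0..1} (\<lambda>t. g (cis (2 * pi * t)) + \<epsilon> / 3)) {0..1}"
      by (intro integrable_integral integrable_add int_g) auto
    show "p (cis (2 * pi * t)) \<le> g (cis (2 * pi * t)) + \<epsilon> / 3" for t
      by (rule le)
  qed
  also have "\<dots> = integral {0..1} (\<lambda>t. g (cis (2 * pi * t))) + \<epsilon> / 3"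
    using integral_add[OF int_g integrable_const_ivl[of "\<epsilon> / 3" 0 1]] by simp
  finally have "Re I < integral {0..1} (\<lambda>t. g (cis (2 * pi * t))) + 2 * \<epsilon> / 3" using \<epsilon> by simp
  from order_tendstoD(2)[OF lim_p this] eventually_gt_at_top[of 0] show ?thesis
  proof eventually_elim
    case (elim N)
    have "(\<Sum>n<N. g (cis (2 * pi * y n))) \<le> (\<Sum>n<N. p (cis (2 * pi * y n)) + \<epsilon> / 3)"
    proof (rule sum_mono)
      show "g (cis (2 * pi * y n)) \<le> p (cis (2 * pi * y n)) + \<epsilon> / 3" for n
        by (rule ge)
    qed
    also have "\<dots> = (\<Sum>n<N. p (cis (2 * pi * y n))) + real N * (\<epsilon> / 3)" by (simp add: sum.distrib)
    finally have "(\<Sum>n<N. g (cis (2 * pi * y n))) / real N \<le> (\<Sum>n<N. p (cis (2 * pi * y n))) / real N + \<epsilon> / 3"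
      using elim by (simp add: field_simps)
    thus ?case using elim by simp
  qed
qed

definition freq :: "real \<Rightarrow> real \<Rightarrow> nat \<Rightarrow> real" where
  "freq a c N = real (card {n \<in> {..<N}. y n \<in> {a..<c}}) / real N"

text \<open>An arc is dominated by the functions \<open>max 0 (1 - K dist(z, arc))\<close>, which are continuous on
  the circle and whose integrals tend to the length of the arc.\<close>

lemma freq_less:
  assumes ac: "0 \<le> a" "a \<le> c" "c \<le> 1" and \<epsilon>: "\<epsilon> > 0"
  shows "\<forall>\<^sub>F N in sequentially. freq a c N < c - a + \<epsilon>"
proof -
  define A where "A = (\<lambda>t. cis (2 * pi * t)) ` {a..c}"
  have cA: "closed A" unfolding A_def
    by (intro compact_imp_closed compact_continuous_image continuous_intros) auto
  have A0: "A \<noteq> {}" using ac by (auto simp: A_def)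
  define g where "g = (\<lambda>(K::nat) z. max 0 (1 - real K * infdist z A))"
  have g01: "0 \<le> g K z" "g K z \<le> 1" for K z by (auto simp: g_def infdist_nonneg)
  have cont: "continuous_on S (g K)" for K S unfolding g_def by (intro continuous_intros)
  have cont': "continuous_on {0..1} (\<lambda>t. g K (cis (2 * pi * t)))" for K
    by (rule continuous_on_compose2[OF cont[of UNIV]]) (auto intro!: continuous_intros)
  define l where "l = (\<lambda>t. if cis (2 * pi * t) \<in> A then 1 else 0 :: real)"
  have lim: "(\<lambda>K. g K z) \<longlonglongrightarrow> (if z \<in> A then 1 else 0)" for z
  proof (cases "z \<in> A")
    case False
    hence "infdist z A > 0" using cA A0 in_closed_iff_infdist_zero[of A z] infdist_nonneg[of z A] by auto
    then obtain K0 :: nat where K0: "1 / infdist z A < K0" using reals_Archimedean2 by blast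
    have "g K z = 0" if "K \<ge> K0" for K
    proof -
      have "1 / infdist z A < real K" using K0 that by linarith
      hence "1 < real K * infdist z A" using \<open>infdist z A > 0\<close> by (simp add: field_simps)
      thus ?thesis by (simp add: g_def)
    qed
    thus ?thesis using False by (auto intro!: tendsto_eventually eventually_sequentiallyI)
  qed (simp add: g_def)
  have "(\<lambda>K. integral {0..1} (\<lambda>t. g K (cis (2 * pi * t)))) \<longlonglongrightarrow> integral {0..1} l"
  proof (rule dominated_convergence(2)[where h = "\<lambda>_. 1"])
    show "(\<lambda>t. g K (cis (2 * pi * t))) integrable_on {0..1}" for K
      by (rule integrable_continuous_interval[OF cont'])
    show "norm (g K (cis (2 * pi * t))) \<le> 1" for K t using g01[of K "cis (2 * pi * t)"] by simp
    show "(\<lambda>K. g K (cis (2 * pi * t))) \<longlonglongrightarrow> l t" for t unfolding l_def by (rule lim)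
  qed auto
  also have "integral {0..1} l = integral {0..1} (\<lambda>t. if t \<in> {a..c} then 1 else 0)"
  proof (rule integral_spike[of "{0, 1}"])
    fix t assume "t \<in> {0..1} - {0, 1 :: real}"
    hence t: "0 \<le> t" "t \<le> 1" "t \<noteq> 0" "t \<noteq> 1" by auto
    have "cis (2 * pi * t) \<in> A \<longleftrightarrow> t \<in> {a..c}"
    proof
      assume "cis (2 * pi * t) \<in> A"
      then obtain s where s: "s \<in> {a..c}" "cis (2 * pi * t) = cis (2 * pi * s)" by (auto simp: A_def)
      hence "t = s" using t ac by (intro cis_eq_in_unit_interval) auto
      thus "t \<in> {a..c}" using s by simp
    qed (auto simp: A_def)
    thus "(if t \<in> {a..c} then 1 else 0) = l t" by (simp add: l_def)
  qed auto
  also have "\<dots> = integral {a..c} (\<lambda>_. 1)"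
    using ac by (subst integral_restrict_Int) (simp add: Int_absorb2 Int_absorb1)
  also have "\<dots> = c - a" using ac by simp
  finally have "(\<lambda>K. integral {0..1} (\<lambda>t. g K (cis (2 * pi * t)))) \<longlonglongrightarrow> c - a" .
  from order_tendstoD(2)[OF this, of "c - a + \<epsilon> / 2"] \<epsilon>
  obtain K where K: "integral {0..1} (\<lambda>t. g K (cis (2 * pi * t))) < c - a + \<epsilon> / 2"
    by (auto simp: eventually_sequentially)
  have "\<epsilon> / 2 > 0" using \<epsilon> by simp
  from average_less_integral[OF cont[of _ K] this] show ?thesis
  proof eventually_elim
    case (elim N)
    have "real (card {n \<in> {..<N}. y n \<in> {a..<c}}) = (\<Sum>n\<in>{n \<in> {..<N}. y n \<in> {a..<c}}. 1)" by simp
    also have "\<dots> = (\<Sum>n<N. if y n \<in> {a..<c} then 1 else 0)"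
      by (rule sum.inter_filter) simp
    also have "\<dots> \<le> (\<Sum>n<N. g K (cis (2 * pi * y n)))"
    proof (rule sum_mono)
      fix n
      have "g K (cis (2 * pi * y n)) = 1" if "y n \<in> {a..<c}"
      proof -
        have "cis (2 * pi * y n) \<in> A" using that by (auto simp: A_def)
        thus ?thesis by (simp add: g_def)
      qed
      thus "(if y n \<in> {a..<c} then 1 else 0) \<le> g K (cis (2 * pi * y n))" using g01 by auto
    qed
    finally have "freq a c N \<le> (\<Sum>n<N. g K (cis (2 * pi * y n))) / real N"
      unfolding freq_def by (rule divide_right_mono) simp
    thus ?case using elim K by simp
  qed
qed

theorem freq_tendsto:
  assumes y: "\<And>n. y n \<in> {0..<1}" and ac: "0 \<le> a" "a \<le> c" "c \<le> 1"
  shows "freq a c \<longlonglongrightarrow> c - a"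
proof (rule tendstoI)
  fix \<epsilon> :: real assume \<epsilon>: "\<epsilon> > 0"
  have "\<epsilon> / 2 > 0" using \<epsilon> by simp
  from freq_less[OF ac \<epsilon>] freq_less[OF order_refl ac(1) order_trans[OF ac(2,3)] \<open>\<epsilon> / 2 > 0\<close>]
    freq_less[OF order_trans[OF ac(1,2)] ac(3) order_refl \<open>\<epsilon> / 2 > 0\<close>] eventually_gt_at_top[of 0]
  show "\<forall>\<^sub>F N in sequentially. dist (freq a c N) (c - a) < \<epsilon>"
  proof eventually_elim
    case (elim N)
    let ?S = "\<lambda>a c. {n \<in> {..<N}. y n \<in> {a..<c}}"
    have "{..<N} = ?S 0 a \<union> ?S a c \<union> ?S c 1" using y ac by force
    hence "N = card (?S 0 a \<union> ?S a c \<union> ?S c 1)" by (metis card_lessThan)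
    also have "\<dots> \<le> card (?S 0 a) + card (?S a c) + card (?S c 1)"
      by (meson card_Un_le add_le_mono order_refl order_trans)
    finally have "real N \<le> real (card (?S 0 a)) + real (card (?S a c)) + real (card (?S c 1))" by linarith
    hence "real N / real N \<le> freq 0 a N + freq a c N + freq c 1 N"
      unfolding freq_def add_divide_distrib[symmetric] by (rule divide_right_mono) simp
    hence "1 \<le> freq 0 a N + freq a c N + freq c 1 N" using elim by simp
    thus ?case using elim by (simp add: dist_real_def abs_less_iff)
  qed
qed

end

lemma normal_in_base_if_weyl:
  fixes b :: int
  assumes "\<And>h::int. h \<noteq> 0 \<Longrightarrow>
    (\<lambda>N. (\<Sum>n<N. cis (2 * pi * of_int (h * b ^ Suc n) * x)) / of_nat N) \<longlonglongrightarrow> 0"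
  shows "normal_in_base b x"
proof -
  define y where "y = (\<lambda>n. frac (of_int (b ^ Suc n) * x))"
  have y: "cis (2 * pi * of_int h * y n) = cis (2 * pi * of_int (h * b ^ Suc n) * x)" for h n
  proof -
    have "2 * pi * of_int h * y n =
      2 * pi * of_int (h * b ^ Suc n) * x - 2 * pi * of_int (h * \<lfloor>of_int (b ^ Suc n) * x\<rfloor>)"
      by (simp add: y_def frac_def algebra_simps)
    thus ?thesis by (simp only: cis_divide[symmetric] cis_multiple_2pi[OF Ints_of_int]) simp
  qed
  interpret weyl_sequence y
  proof
    fix h :: int assume "h \<noteq> 0"
    from assms[OF this] show "(\<lambda>N. (\<Sum>n<N. cis (2 * pi * of_int h * y n)) / of_nat N) \<longlonglongrightarrow> 0"
      by (simp only: y)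
  qed
  have y01: "y n \<in> {0..<1}" for n by (simp add: y_def frac_lt_1)
  show ?thesis unfolding normal_in_base_def equidistributed_def
  proof (intro allI impI)
    fix a c :: real assume ac: "0 \<le> a \<and> a < c \<and> c \<le> 1"
    have "card {k \<in> {1..N}. frac (of_int (b ^ k) * x) \<in> {a..<c}} = card {n \<in> {..<N}. y n \<in> {a..<c}}" for N
      by (rule bij_betw_same_card[symmetric, of Suc], rule bij_betw_byWitness[where f' = "\<lambda>k. k - 1"])
        (auto simp: y_def simp del: power_Suc)
    moreover have "freq a c \<longlonglongrightarrow> c - a" using ac y01 by (intro freq_tendsto) auto
    ultimately show "(\<lambda>N. real (card {k \<in> {1..N}. frac (of_int (b ^ k) * x) \<in> {a..<c}}) / real N) \<longlonglongrightarrow> c - a"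
      by (simp add: freq_def[abs_def])
  qed
qed

definition exp_sum :: "(nat \<Rightarrow> real) \<Rightarrow> nat \<Rightarrow> real \<Rightarrow> complex" where
  "exp_sum a N x = (\<Sum>n<N. cis (2 * pi * a n * x))"

lemma norm_exp_sum_le: "norm (exp_sum a N x) \<le> real N"
  unfolding exp_sum_def by (rule order_trans[OF norm_sum]) simp

lemma norm_exp_sum_diff_le:
  assumes "M \<le> N"
  shows "norm (exp_sum a N x) \<le> norm (exp_sum a M x) + real (N - M)"
proof -
  have "exp_sum a N x = exp_sum a M x + (\<Sum>n\<in>{M..<N}. cis (2 * pi * a n * x))"
    unfolding exp_sum_def lessThan_atLeast0 using assms by (simp add: sum.atLeastLessThan_concat)
  moreover have "norm (\<Sum>n\<in>{M..<N}. cis (2 * pi * a n * x)) \<le> real (N - M)"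
    by (rule order_trans[OF norm_sum]) simp
  ultimately show ?thesis using norm_triangle_mono[OF order_refl] by metis
qed

lemma measurable_exp_sum [measurable]: "exp_sum a N \<in> borel_measurable borel"
  unfolding exp_sum_def by (intro borel_measurable_continuous_onI continuous_intros)

context real_distribution
begin

lemma integrable_cis: "integrable M (\<lambda>x. cis (t * x))"
proof (rule integrable_const_bound[of _ 1])
  have "(\<lambda>x. cis (t * x)) \<in> borel_measurable borel"
    by (intro borel_measurable_continuous_onI continuous_intros)
  thus "(\<lambda>x. cis (t * x)) \<in> borel_measurable M" by simp
qed simp

lemma integral_norm_exp_sum_le:
  "(\<integral>x. (norm (exp_sum a N x))\<^sup>2 \<partial>M) \<le> (\<Sum>m<N. \<Sum>n<N. norm (fourier_measure M (a n - a m)))"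
proof -
  have f: "fourier_measure M \<xi> = (\<integral>x. cis (- (2 * pi * \<xi>) * x) \<partial>M)" for \<xi>
    unfolding fourier_measure_def by (intro Bochner_Integration.integral_cong) (auto simp: cis_conv_exp mult_ac)
  have "complex_of_real ((norm (exp_sum a N x))\<^sup>2) =
     (\<Sum>m<N. \<Sum>n<N. cis (- (2 * pi * (a n - a m)) * x))" for x
  proof -
    have "complex_of_real ((norm (exp_sum a N x))\<^sup>2) = exp_sum a N x * cnj (exp_sum a N x)"
      by (rule complex_norm_square)
    also have "\<dots> = (\<Sum>m<N. \<Sum>n<N. cis (2 * pi * a m * x) * cis (- (2 * pi * a n * x)))"
      unfolding exp_sum_def by (simp add: sum_product cis_cnj)
    finally show ?thesis by (simp add: cis_mult algebra_simps)
  qed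
  hence "complex_of_real (\<integral>x. (norm (exp_sum a N x))\<^sup>2 \<partial>M) =
      (\<integral>x. (\<Sum>m<N. \<Sum>n<N. cis (- (2 * pi * (a n - a m)) * x)) \<partial>M)"
    by (simp only: integral_complex_of_real[symmetric])
  also have "\<dots> = (\<Sum>m<N. \<Sum>n<N. fourier_measure M (a n - a m))"
    unfolding f by (subst Bochner_Integration.integral_sum, intro Bochner_Integration.integrable_sum integrable_cis,
      intro sum.cong refl Bochner_Integration.integral_sum integrable_cis)
  finally have "norm (complex_of_real (\<integral>x. (norm (exp_sum a N x))\<^sup>2 \<partial>M)) =
      norm (\<Sum>m<N. \<Sum>n<N. fourier_measure M (a n - a m))" by simp
  also have "\<dots> \<le> (\<Sum>m<N. \<Sum>n<N. norm (fourier_measure M (a n - a m)))"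
    by (intro order_trans[OF norm_sum] sum_mono norm_sum)
  finally show ?thesis by simp
qed

lemma AE_tendsto_zero_if_summable_integrals:
  fixes f :: "nat \<Rightarrow> real \<Rightarrow> real"
  assumes int: "\<And>k. integrable M (f k)" and nonneg: "\<And>k x. f k x \<ge> 0"
    and sum: "summable (\<lambda>k. \<integral>x. f k x \<partial>M)"
  shows "AE x in M. (\<lambda>k. f k x) \<longlonglongrightarrow> 0"
proof -
  have "(\<integral>\<^sup>+x. (\<Sum>k. ennreal (f k x)) \<partial>M) = (\<Sum>k. \<integral>\<^sup>+x. ennreal (f k x) \<partial>M)"
    using int by (intro nn_integral_suminf) auto
  also have "\<dots> = (\<Sum>k. ennreal (\<integral>x. f k x \<partial>M))"
    using int nonneg by (intro suminf_cong nn_integral_eq_integral) auto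
  also have "\<dots> = ennreal (\<Sum>k. \<integral>x. f k x \<partial>M)"
    using nonneg by (intro suminf_ennreal2 sum) auto
  finally have "(\<integral>\<^sup>+x. (\<Sum>k. ennreal (f k x)) \<partial>M) \<noteq> \<infinity>" by simp
  hence "AE x in M. (\<Sum>k. ennreal (f k x)) \<noteq> \<infinity>"
    using int by (intro nn_integral_PInf_AE) auto
  thus ?thesis
  proof eventually_elim
    case (elim x)
    have "summable (\<lambda>k. f k x)"
      using nonneg elim by (intro summable_suminf_not_top) (auto simp: top_ennreal_def[symmetric])
    thus ?case by (rule summable_LIMSEQ_zero)
  qed
qed

text \<open>The averages converge along \<open>N\<^sub>k = \<lfloor>exp (sqrt k)\<rfloor>\<close> by Borel-Cantelli; the gaps are filled
  because \<open>N\<^sub>k\<^sub>+\<^sub>1 / N\<^sub>k\<close> tends to 1.\<close>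

theorem AE_exp_sum_average_tendsto_zero:
  assumes C: "\<forall>\<^sub>F N in sequentially.
    (\<Sum>m<N. \<Sum>n<N. norm (fourier_measure M (a n - a m))) \<le> C * (real N)\<^sup>2 / ln (real N) ^ 4"
  shows "AE x in M. (\<lambda>N. exp_sum a N x / of_nat N) \<longlonglongrightarrow> 0"
proof -
  define K where "K = (\<lambda>k. nat \<lfloor>exp (sqrt (real k))\<rfloor>)"
  define f where "f = (\<lambda>k x. (norm (exp_sum a (K k) x))\<^sup>2 / (real (K k))\<^sup>2)"
  have realK: "real (K k) = of_int \<lfloor>exp (sqrt (real k))\<rfloor>" for k by (simp add: K_def)
  have K_lim: "filterlim K at_top sequentially"
  proof -
    have "filterlim (\<lambda>k. real (K k)) at_top sequentially" unfolding realK by real_asymp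
    thus ?thesis using filterlim_sequentially_iff_filterlim_real by blast
  qed
  have AE: "AE x in M. (\<lambda>k. f k x) \<longlonglongrightarrow> 0"
  proof (rule AE_tendsto_zero_if_summable_integrals)
    show "integrable M (f k)" for k
    proof (rule integrable_const_bound[of _ 1])
      have "(norm (exp_sum a (K k) x))\<^sup>2 \<le> (real (K k))\<^sup>2" for x
        by (intro power_mono norm_exp_sum_le) simp
      thus "AE x in M. norm (f k x) \<le> 1" by (auto simp: f_def divide_le_eq_1)
      show "f k \<in> borel_measurable M" unfolding f_def by simp
    qed
    show "f k x \<ge> 0" for k x by (simp add: f_def)
    show "summable (\<lambda>k. \<integral>x. f k x \<partial>M)"
    proof (rule summable_comparison_test_ev)
      have "summable (\<lambda>k. 1 / real k ^ 2)" using inverse_power_summable[of 2, where 'a = real] by (simp add: field_simps)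
      thus "summable (\<lambda>k. 16 * \<bar>C\<bar> * (1 / real k ^ 2))" by (rule summable_mult)
      have "\<forall>\<^sub>F k in sequentially. ln (real (K k)) \<ge> sqrt (real k) / 2"
        unfolding realK by real_asymp
      with eventually_compose_filterlim[OF C K_lim] eventually_gt_at_top[of 0]
        eventually_compose_filterlim[OF eventually_gt_at_top[of 0] K_lim]
      show "\<forall>\<^sub>F k in sequentially. norm (\<integral>x. f k x \<partial>M) \<le> 16 * \<bar>C\<bar> * (1 / real k ^ 2)"
      proof eventually_elim
        case (elim k)
        have "sqrt (real k) > 0" using elim by simp
        hence l: "ln (real (K k)) > 0" "sqrt (real k) / 2 > 0" using elim by linarith+
        have "(\<integral>x. f k x \<partial>M) = (\<integral>x. (norm (exp_sum a (K k) x))\<^sup>2 \<partial>M) / (real (K k))\<^sup>2"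
          by (simp add: f_def)
        also have "\<dots> \<le> (C * (real (K k))\<^sup>2 / ln (real (K k)) ^ 4) / (real (K k))\<^sup>2"
          by (intro divide_right_mono order_trans[OF integral_norm_exp_sum_le elim(1)]) simp
        also have "\<dots> = C / ln (real (K k)) ^ 4" using elim by simp
        also have "\<dots> \<le> \<bar>C\<bar> / ln (real (K k)) ^ 4" by (intro divide_right_mono) auto
        also have "\<dots> \<le> \<bar>C\<bar> / (sqrt (real k) / 2) ^ 4"
          using elim l by (intro divide_left_mono power_mono mult_pos_pos zero_less_power) linarith+
        also have "(sqrt (real k) / 2) ^ 4 = real k ^ 2 / 16"
          by (simp add: power_divide power4_eq_xxxx power2_eq_square)
        finally have "(\<integral>x. f k x \<partial>M) \<le> 16 * \<bar>C\<bar> * (1 / real k ^ 2)" by (simp add: mult_ac)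
        moreover have "(\<integral>x. f k x \<partial>M) \<ge> 0" by (simp add: f_def)
        ultimately show ?case by simp
      qed
    qed
  qed
  define k where "k = (\<lambda>N::nat. nat \<lfloor>(ln (real N))\<^sup>2\<rfloor>)"
  have realk: "real (k N) = of_int \<lfloor>(ln (real N))\<^sup>2\<rfloor>" for N by (simp add: k_def)
  have k_lim: "filterlim k at_top sequentially"
  proof -
    have "filterlim (\<lambda>N. real (k N)) at_top sequentially" unfolding realk by real_asymp
    thus ?thesis using filterlim_sequentially_iff_filterlim_real by blast
  qed
  have K_le: "K (k N) \<le> N" if "N > 0" for N
  proof -
    have "real (k N) \<le> (ln (real N))\<^sup>2" unfolding realk by linarith
    hence "sqrt (real (k N)) \<le> ln (real N)" using that by (simp add: real_le_lsqrt)
    hence "exp (sqrt (real (k N))) \<le> real N" using that by (metis exp_le_cancel_iff exp_ln of_nat_0_less_iff)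
    hence "real (K (k N)) \<le> real N" unfolding realK by linarith
    thus ?thesis by simp
  qed
  have gap: "(\<lambda>N. (real N - real (K (k N))) / real N) \<longlonglongrightarrow> 0"
  proof (rule tendsto_sandwich[where f = "\<lambda>_. 0"])
    show "(\<lambda>N::nat. (real N - exp (sqrt ((ln (real N))\<^sup>2 - 1)) + 1) / real N) \<longlonglongrightarrow> 0" by real_asymp
    show "\<forall>\<^sub>F N in sequentially. 0 \<le> (real N - real (K (k N))) / real N"
      using eventually_gt_at_top[of 0] 
    proof eventually_elim
      case (elim N)
      thus ?case using K_le[of N] by simp
    qed
    show "\<forall>\<^sub>F N in sequentially. (real N - real (K (k N))) / real N \<le>
        (real N - exp (sqrt ((ln (real N))\<^sup>2 - 1)) + 1) / real N"
    proof (intro always_eventually allI divide_right_mono)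
      fix N
      have "(ln (real N))\<^sup>2 - 1 \<le> real (k N)" unfolding realk by linarith
      hence "exp (sqrt ((ln (real N))\<^sup>2 - 1)) \<le> exp (sqrt (real (k N)))" by simp
      also have "\<dots> \<le> real (K (k N)) + 1" unfolding realK by linarith
      finally show "real N - real (K (k N)) \<le> real N - exp (sqrt ((ln (real N))\<^sup>2 - 1)) + 1" by simp
    qed simp
  qed simp
  from AE show ?thesis
  proof eventually_elim
    case (elim x)
    have "(\<lambda>k. sqrt (f k x)) \<longlonglongrightarrow> sqrt 0" by (intro tendsto_real_sqrt elim)
    hence "(\<lambda>k. norm (exp_sum a (K k) x) / real (K k)) \<longlonglongrightarrow> 0"
      by (simp add: f_def real_sqrt_divide)
    hence "(\<lambda>N. norm (exp_sum a (K (k N)) x) / real (K (k N))) \<longlonglongrightarrow> 0"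
      using k_lim by (rule filterlim_compose)
    from tendsto_add[OF this gap]
    have lim: "(\<lambda>N. norm (exp_sum a (K (k N)) x) / real (K (k N)) + (real N - real (K (k N))) / real N) \<longlonglongrightarrow> 0" by simp
    show ?case
    proof (rule Lim_null_comparison[OF _ lim])
      from eventually_gt_at_top[of 0] eventually_compose_filterlim[OF eventually_gt_at_top[of 0] filterlim_compose[OF K_lim k_lim]]
      show "\<forall>\<^sub>F N in sequentially. norm (exp_sum a N x / of_nat N) \<le>
          norm (exp_sum a (K (k N)) x) / real (K (k N)) + (real N - real (K (k N))) / real N"
      proof eventually_elim
        case (elim N)
        have "norm (exp_sum a N x / of_nat N) = norm (exp_sum a N x) / real N" by (simp add: norm_divide)
        also have "\<dots> \<le> (norm (exp_sum a (K (k N)) x) + real (N - K (k N))) / real N"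
          by (intro divide_right_mono norm_exp_sum_diff_le K_le elim) simp
        also have "\<dots> = norm (exp_sum a (K (k N)) x) / real N + (real N - real (K (k N))) / real N"
          using K_le[OF elim(1)] by (simp add: add_divide_distrib of_nat_diff)
        also have "norm (exp_sum a (K (k N)) x) / real N \<le> norm (exp_sum a (K (k N)) x) / real (K (k N))"
          using K_le[OF elim(1)] elim by (intro divide_left_mono) auto
        finally show ?case by simp
      qed
    qed
  qed
qed

theorem pointwise_absolutely_normal_if_log_decay:
  assumes "\<And>b h::int. b \<ge> 2 \<Longrightarrow> h \<noteq> 0 \<Longrightarrow> \<exists>C. \<forall>\<^sub>F N in sequentially.
    (\<Sum>m<N. \<Sum>n<N. norm (fourier_measure M (of_int (h * (b ^ n - b ^ m))))) \<le> C * (real N)\<^sup>2 / ln (real N) ^ 4"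
  shows "pointwise_absolutely_normal M"
proof -
  have "AE x in M. b \<ge> 2 \<and> h \<noteq> 0 \<longrightarrow>
      (\<lambda>N. (\<Sum>n<N. cis (2 * pi * of_int (h * b ^ n) * x)) / of_nat N) \<longlonglongrightarrow> 0" for b h :: int
  proof (cases "b \<ge> 2 \<and> h \<noteq> 0")
    case True
    with assms obtain C where C: "\<forall>\<^sub>F N in sequentially.
      (\<Sum>m<N. \<Sum>n<N. norm (fourier_measure M (of_int (h * (b ^ n - b ^ m))))) \<le> C * (real N)\<^sup>2 / ln (real N) ^ 4"
      by blast
    have "AE x in M. (\<lambda>N. exp_sum (\<lambda>n. of_int (h * b ^ n)) N x / of_nat N) \<longlonglongrightarrow> 0"
      by (rule AE_exp_sum_average_tendsto_zero[of _ C]) (use C in \<open>simp add: right_diff_distrib\<close>)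
    thus ?thesis by (simp add: exp_sum_def)
  qed auto
  hence "AE x in M. \<forall>b h::int. b \<ge> 2 \<and> h \<noteq> 0 \<longrightarrow>
      (\<lambda>N. (\<Sum>n<N. cis (2 * pi * of_int (h * b ^ n) * x)) / of_nat N) \<longlonglongrightarrow> 0"
    unfolding AE_all_countable by blast
  thus ?thesis unfolding pointwise_absolutely_normal_def
  proof eventually_elim
    case (elim x)
    show ?case unfolding absolutely_normal_def
    proof (intro allI impI normal_in_base_if_weyl)
      fix b h :: int assume bh: "2 \<le> b" "h \<noteq> 0"
      hence "h * b \<noteq> 0" by simp
      moreover have "h * b ^ Suc n = (h * b) * b ^ n" for n by simp
      ultimately show "(\<lambda>N. (\<Sum>n<N. cis (2 * pi * of_int (h * b ^ Suc n) * x)) / of_nat N) \<longlonglongrightarrow> 0"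
        using elim bh(1) by presburger
    qed
  qed
qed

end

lemma summable_inverse_n_ln_pow4: "summable (\<lambda>n. 1 / (real n * ln (real n + 1) ^ 4))"
proof (subst condensation_test)
  fix m :: nat assume "0 < m"
  thus "1 / (real (Suc m) * ln (real (Suc m) + 1) ^ 4) \<le> 1 / (real m * ln (real m + 1) ^ 4)"
    by (intro divide_left_mono mult_mono power_mono mult_pos_pos zero_less_power) auto
next
  show "0 \<le> 1 / (real n * ln (real n + 1) ^ 4)" for n by simp
  have antimono: "1 / y ^ 4 \<le> 1 / x ^ 4" if "0 < x" "x \<le> y" for x y :: real
    using that by (intro divide_left_mono power_mono mult_pos_pos zero_less_power) auto
  show "summable (\<lambda>n. 2 ^ n * (1 / (real (2 ^ n) * ln (real (2 ^ n) + 1) ^ 4)))"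
  proof (rule summable_comparison_test_ev)
    show "summable (\<lambda>n. inverse (real n ^ 4) * (1 / ln 2 ^ 4))"
      by (intro summable_mult2 inverse_power_summable) simp
    show "\<forall>\<^sub>F n in sequentially. norm (2 ^ n * (1 / (real (2 ^ n) * ln (real (2 ^ n) + 1) ^ 4))) \<le>
        inverse (real n ^ 4) * (1 / ln 2 ^ 4)"
      using eventually_gt_at_top[of 0]
    proof eventually_elim
      case (elim n)
      have "ln (2 ^ n) \<le> ln (real (2 ^ n) + 1)" by (subst ln_le_cancel_iff) (auto intro: add_pos_pos)
      hence "real n * ln 2 \<le> ln (real (2 ^ n) + 1)" by (simp add: ln_realpow)
      moreover have "real n * ln 2 > 0" using elim by simp
      ultimately have "1 / ln (real (2 ^ n) + 1) ^ 4 \<le> 1 / (real n * ln 2) ^ 4"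
        by (intro antimono)
      moreover have "0 \<le> 1 / ln (real (2 ^ n) + 1) ^ 4" by simp
      ultimately show ?case by (simp add: field_simps)
    qed
  qed
qed

lemma DEL_criterion_if_log_decay:
  fixes b :: int
  assumes "\<And>h::int. h \<noteq> 0 \<Longrightarrow> \<exists>C. \<forall>\<^sub>F N in sequentially.
    (\<Sum>m<N. \<Sum>n<N. norm (fourier_measure \<mu> (of_int (h * (b ^ n - b ^ m))))) \<le> C * (real N)\<^sup>2 / ln (real N) ^ 4"
  shows "DEL_criterion \<mu> b"
  unfolding DEL_criterion_def Let_def
proof (intro allI impI)
  fix h :: int assume "h \<noteq> 0"
  from assms[OF this] obtain C where C: "\<forall>\<^sub>F N in sequentially.
    (\<Sum>m<N. \<Sum>n<N. norm (fourier_measure \<mu> (of_int (h * (b ^ n - b ^ m))))) \<le> C * (real N)\<^sup>2 / ln (real N) ^ 4"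
    by blast
  let ?S = "\<lambda>N. \<Sum>m<N. \<Sum>n<N. fourier_measure \<mu> (of_int (h * (b ^ n - b ^ m)))"
  show "summable (\<lambda>k. 1 / of_nat (Suc k) ^ 3 * ?S (Suc k))"
  proof (rule summable_comparison_test_ev)
    show "summable (\<lambda>k. \<bar>C\<bar> * (1 / (real k * ln (real k + 1) ^ 4)))"
      by (intro summable_mult summable_inverse_n_ln_pow4)
    from eventually_compose_filterlim[OF C filterlim_Suc] eventually_gt_at_top[of 0]
    show "\<forall>\<^sub>F k in sequentially. norm (1 / of_nat (Suc k) ^ 3 * ?S (Suc k)) \<le> \<bar>C\<bar> * (1 / (real k * ln (real k + 1) ^ 4))"
    proof eventually_elim
      case (elim k)
      let ?N = "Suc k"
      have l: "ln (real ?N) > 0" using elim by simp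
      have "norm (?S ?N) \<le> (\<Sum>m<?N. \<Sum>n<?N. norm (fourier_measure \<mu> (of_int (h * (b ^ n - b ^ m)))))"
        by (intro order_trans[OF norm_sum] sum_mono norm_sum)
      also have "\<dots> \<le> C * (real ?N)\<^sup>2 / ln (real ?N) ^ 4" by (rule elim)
      also have "\<dots> \<le> \<bar>C\<bar> * (real ?N)\<^sup>2 / ln (real ?N) ^ 4"
        by (intro divide_right_mono mult_right_mono) auto
      finally have "1 / real ?N ^ 3 * norm (?S ?N) \<le> 1 / real ?N ^ 3 * (\<bar>C\<bar> * (real ?N)\<^sup>2 / ln (real ?N) ^ 4)"
        by (intro mult_left_mono) auto
      also have "\<dots> = \<bar>C\<bar> * (1 / (real ?N * ln (real ?N) ^ 4))"
        by (simp add: power3_eq_cube power2_eq_square)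
      also have "\<dots> \<le> \<bar>C\<bar> * (1 / (real k * ln (real ?N) ^ 4))"
        using l elim by (intro mult_left_mono divide_left_mono mult_right_mono mult_pos_pos) auto
      finally have le: "1 / real ?N ^ 3 * norm (?S ?N) \<le> \<bar>C\<bar> * (1 / (real k * ln (real ?N) ^ 4))" .
      have "norm (1 / of_nat ?N ^ 3 * ?S ?N) = 1 / real ?N ^ 3 * norm (?S ?N)"
        by (simp only: norm_mult norm_divide norm_power norm_of_nat norm_one)
      moreover have "ln (real ?N) = ln (real k + 1)" by (simp add: add.commute)
      ultimately show ?case using le by presburger
    qed
  qed
qed

section \<open>Riemann theory of trigonometric series\<close>

definition sinc_sq :: "real \<Rightarrow> real" where
  "sinc_sq v = (if v = 0 then 1 else (sin v / v)\<^sup>2)"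

lemma sinc_sq_0 [simp]: "sinc_sq 0 = 1"
  by (simp add: sinc_sq_def)

lemma sinc_sq_nonneg: "sinc_sq v \<ge> 0"
  by (simp add: sinc_sq_def)

lemma sinc_sq_le_1: "sinc_sq v \<le> 1"
proof -
  have "\<bar>sin v / v\<bar> \<le> 1" if "v \<noteq> 0" using abs_sin_x_le_abs_x[of v] that by (simp add: divide_le_eq_1)
  thus ?thesis using abs_square_le_1[of "sin v / v"] by (auto simp: sinc_sq_def)
qed

lemma abs_sinc_sq_le_1: "\<bar>sinc_sq v\<bar> \<le> 1"
  using sinc_sq_nonneg[of v] sinc_sq_le_1[of v] by simp

lemma sinc_sq_le_inverse_square: "v \<noteq> 0 \<Longrightarrow> sinc_sq v \<le> 1 / v\<^sup>2"
  using abs_sin_le_one[of v] abs_square_le_1[of "sin v"]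
  by (simp add: sinc_sq_def power_divide divide_right_mono)

lemma isCont_sinc_sq: "isCont sinc_sq v"
proof -
  have "sinc_sq = (\<lambda>v. (sinc v)\<^sup>2)" by (auto simp: sinc_sq_def)
  thus ?thesis using isCont_power[OF isCont_sinc] by metis
qed

lemma DERIV_sinc_sq:
  fixes v :: real
  assumes "v > 0"
  shows "(sinc_sq has_real_derivative 2 * sin v * (v * cos v - sin v) / v ^ 3) (at v)"
proof (rule has_field_derivative_transform_within_open[where S = "{0<..}"])
  show "((\<lambda>v. (sin v / v)\<^sup>2) has_real_derivative 2 * sin v * (v * cos v - sin v) / v ^ 3) (at v)"
    using assms by (auto intro!: derivative_eq_intros simp: power2_eq_square power3_eq_cube field_simps)
qed (use assms in \<open>auto simp: sinc_sq_def\<close>)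

lemma abs_v_cos_minus_sin_le:
  fixes v :: real
  assumes "v > 0"
  shows "\<bar>v * cos v - sin v\<bar> \<le> v ^ 3"
proof -
  have "\<exists>z>0. z < v \<and> (v * cos v - sin v) - (0 * cos 0 - sin 0) = (v - 0) * (- (z * sin z))"
    by (rule MVT2[OF assms]) (auto intro!: derivative_eq_intros)
  then obtain z where z: "0 < z" "z < v" "v * cos v - sin v = v * (- (z * sin z))" by auto
  have "\<bar>v * cos v - sin v\<bar> = v * (z * \<bar>sin z\<bar>)" using z assms by (simp add: abs_mult)
  also have "\<dots> \<le> v * (v * v)"
    using z assms abs_sin_x_le_abs_x[of z] by (intro mult_left_mono mult_mono) auto
  finally show ?thesis by (simp add: power3_eq_cube)
qed

lemma abs_deriv_sinc_sq_le:
  fixes v :: real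
  assumes "v > 0"
  shows "\<bar>2 * sin v * (v * cos v - sin v) / v ^ 3\<bar> \<le> 8 / (1 + v\<^sup>2)"
proof (cases "v \<le> 1")
  case True
  have "\<bar>2 * sin v * (v * cos v - sin v) / v ^ 3\<bar> = 2 * \<bar>sin v\<bar> * (\<bar>v * cos v - sin v\<bar> / v ^ 3)"
    using assms by (simp add: abs_mult)
  also have "\<dots> \<le> 2 * 1 * 1"
    using assms abs_v_cos_minus_sin_le[OF assms] abs_sin_le_one[of v] by (intro mult_mono) auto
  also have "2 * 1 * 1 \<le> 8 / (1 + v\<^sup>2)"
  proof -
    have "v\<^sup>2 \<le> 1" using assms True by (simp add: power_le_one)
    thus ?thesis by (subst pos_le_divide_eq) (auto intro: add_pos_nonneg)
  qed
  finally show ?thesis .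
next
  case False
  have "\<bar>v * cos v - sin v\<bar> \<le> \<bar>v * cos v\<bar> + \<bar>sin v\<bar>" by (rule abs_triangle_ineq4)
  also have "\<dots> \<le> v * 1 + 1"
    unfolding abs_mult using assms by (intro add_mono mult_mono) auto
  also have "\<dots> \<le> 2 * v" using False by simp
  finally have k: "\<bar>v * cos v - sin v\<bar> \<le> 2 * v" .
  have "\<bar>2 * sin v * (v * cos v - sin v) / v ^ 3\<bar> = 2 * \<bar>sin v\<bar> * \<bar>v * cos v - sin v\<bar> / v ^ 3"
    using assms by (simp add: abs_mult)
  also have "\<dots> \<le> 2 * 1 * (2 * v) / v ^ 3"
    using assms k abs_sin_le_one[of v] by (intro divide_right_mono mult_mono) auto
  also have "\<dots> = 4 / v\<^sup>2" using assms by (simp add: power3_eq_cube power2_eq_square)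
  also have "\<dots> \<le> 8 / (1 + v\<^sup>2)"
  proof -
    have "1 \<le> v\<^sup>2" using False one_le_power[of v 2] by simp
    hence "4 * (1 + v\<^sup>2) \<le> 8 * v\<^sup>2" by simp
    moreover have "1 + v\<^sup>2 > 0" by (intro add_pos_nonneg) auto
    ultimately show ?thesis using assms by (simp add: frac_le_eq divide_simps)
  qed
  finally show ?thesis .
qed

text \<open>Domination by \<open>arctan\<close> bounds the total variation of \<open>sinc_sq\<close> along every partition.\<close>

lemma abs_sinc_sq_diff_le:
  assumes "0 \<le> s" "s \<le> t"
  shows "\<bar>sinc_sq s - sinc_sq t\<bar> \<le> 8 * (arctan t - arctan s)"
proof (cases "s = t")
  case False
  hence st: "s < t" using assms by simp
  have mono: "8 * arctan s + c * sinc_sq s \<le> 8 * arctan t + c * sinc_sq t" if c: "\<bar>c\<bar> = 1" for c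
  proof (rule DERIV_nonneg_imp_increasing_open[OF assms(2)])
    fix v assume "s < v" "v < t"
    hence v: "v > 0" using assms by simp
    let ?d = "2 * sin v * (v * cos v - sin v) / v ^ 3"
    have "((\<lambda>v. 8 * arctan v + c * sinc_sq v) has_real_derivative 8 / (1 + v\<^sup>2) + c * ?d) (at v)"
      using v by (auto intro!: derivative_eq_intros DERIV_sinc_sq simp: field_simps)
    moreover have "\<bar>c * ?d\<bar> \<le> 8 / (1 + v\<^sup>2)"
      using abs_deriv_sinc_sq_le[OF v] c by (simp only: abs_mult mult_1_left)
    hence "8 / (1 + v\<^sup>2) + c * ?d \<ge> 0" unfolding abs_le_iff by (simp add: algebra_simps)
    ultimately show "\<exists>y. ((\<lambda>v. 8 * arctan v + c * sinc_sq v) has_real_derivative y) (at v) \<and> 0 \<le> y" by blast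
  next
    have "isCont (\<lambda>v. 8 * arctan v + c * sinc_sq v) v" for v
      by (intro continuous_intros isCont_sinc_sq)
    thus "continuous_on {s..t} (\<lambda>v. 8 * arctan v + c * sinc_sq v)"
      by (intro continuous_at_imp_continuous_on) auto
  qed
  from mono[of 1] mono[of "-1"] show ?thesis by (simp add: abs_le_iff)
qed simp

lemma sum_abs_sinc_sq_diff_le:
  assumes "h \<ge> 0"
  shows "(\<Sum>n<N. \<bar>sinc_sq (real n * h) - sinc_sq (real (Suc n) * h)\<bar>) \<le> 4 * pi"
proof -
  have "(\<Sum>n<N. \<bar>sinc_sq (real n * h) - sinc_sq (real (Suc n) * h)\<bar>) \<le>
     (\<Sum>n<N. 8 * (arctan (real (Suc n) * h) - arctan (real n * h)))"
    using assms by (intro sum_mono abs_sinc_sq_diff_le mult_right_mono) auto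
  also have "\<dots> = 8 * arctan (real N * h)"
    using sum_lessThan_telescope[of "\<lambda>n. arctan (real n * h)" N] by (simp only: sum_distrib_left[symmetric]) simp
  also have "\<dots> \<le> 8 * (pi / 2)" using arctan_ubound[of "real N * h"] by simp
  finally show ?thesis by simp
qed

lemma sum_by_parts:
  fixes c u :: "nat \<Rightarrow> real"
  shows "(\<Sum>n<N. c n * u n) = (\<Sum>n<N. (\<Sum>k<Suc n. c k) * (u n - u (Suc n))) + (\<Sum>k<N. c k) * u N"
  by (induction N) (auto simp: algebra_simps)

theorem riemann_summation_tendsto_zero:
  fixes c :: "nat \<Rightarrow> real"
  assumes c: "c sums 0" and summ: "\<And>h. h > 0 \<Longrightarrow> summable (\<lambda>n. c n * sinc_sq (real n * h))"
  shows "((\<lambda>h. \<Sum>n. c n * sinc_sq (real n * h)) \<longlongrightarrow> 0) (at_right 0)"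
proof (rule tendstoI)
  fix \<epsilon> :: real assume \<epsilon>: "\<epsilon> > 0"
  define s where "s = (\<lambda>n. \<Sum>k<n. c k)"
  have s0: "s \<longlonglongrightarrow> 0" using c by (simp add: s_def sums_def)
  define \<delta> where "\<delta> = \<epsilon> / (16 * pi)"
  have \<delta>: "\<delta> > 0" using \<epsilon> by (simp add: \<delta>_def)
  obtain n0 where n0: "\<And>n. n \<ge> n0 \<Longrightarrow> \<bar>s n\<bar> < \<delta>"
    using LIMSEQ_D[OF s0 \<delta>] by auto
  define d where "d = (\<lambda>h n. \<bar>sinc_sq (real n * h) - sinc_sq (real (Suc n) * h)\<bar>)"
  have "((\<lambda>h. \<Sum>n<n0. \<bar>s (Suc n)\<bar> * d h n) \<longlongrightarrow> (\<Sum>n<n0. \<bar>s (Suc n)\<bar> * \<bar>sinc_sq (real n * 0) - sinc_sq (real (Suc n) * 0)\<bar>)) (at_right 0)"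
    unfolding d_def by (intro tendsto_intros isCont_tendsto_compose[OF isCont_sinc_sq])
  hence "((\<lambda>h. \<Sum>n<n0. \<bar>s (Suc n)\<bar> * d h n) \<longlongrightarrow> 0) (at_right 0)" by simp
  from order_tendstoD(2)[OF this, of "\<epsilon> / 4"] \<epsilon>
  have "\<forall>\<^sub>F h in at_right 0. (\<Sum>n<n0. \<bar>s (Suc n)\<bar> * d h n) < \<epsilon> / 4" by simp
  moreover have "\<forall>\<^sub>F h in at_right (0::real). h > 0" by (simp add: eventually_at_filter)
  ultimately show "\<forall>\<^sub>F h in at_right 0. dist (\<Sum>n. c n * sinc_sq (real n * h)) 0 < \<epsilon>"
  proof eventually_elim
    case (elim h)
    have bound: "\<bar>\<Sum>n<N. s (Suc n) * (sinc_sq (real n * h) - sinc_sq (real (Suc n) * h))\<bar> \<le> \<epsilon> / 2" for N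
    proof -
      have "\<bar>\<Sum>n<N. s (Suc n) * (sinc_sq (real n * h) - sinc_sq (real (Suc n) * h))\<bar> \<le> (\<Sum>n<N. \<bar>s (Suc n)\<bar> * d h n)"
        unfolding d_def abs_mult[symmetric] by (rule sum_abs)
      also have "\<dots> \<le> (\<Sum>n<N. (if n < n0 then \<bar>s (Suc n)\<bar> * d h n else 0) + \<delta> * d h n)"
      proof (rule sum_mono)
        fix n
        have "d h n \<ge> 0" by (simp add: d_def)
        moreover have "\<bar>s (Suc n)\<bar> \<le> \<delta>" if "\<not> n < n0" using n0[of "Suc n"] that by simp
        ultimately show "\<bar>s (Suc n)\<bar> * d h n \<le> (if n < n0 then \<bar>s (Suc n)\<bar> * d h n else 0) + \<delta> * d h n"
          using \<delta> by (auto intro: mult_right_mono)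
      qed
      also have "\<dots> = (\<Sum>n<N. if n < n0 then \<bar>s (Suc n)\<bar> * d h n else 0) + \<delta> * (\<Sum>n<N. d h n)"
        by (simp add: sum.distrib sum_distrib_left)
      also have "(\<Sum>n<N. if n < n0 then \<bar>s (Suc n)\<bar> * d h n else 0) = (\<Sum>n\<in>{n\<in>{..<N}. n < n0}. \<bar>s (Suc n)\<bar> * d h n)"
        by (rule sum.inter_filter[symmetric]) simp
      also have "\<dots> \<le> (\<Sum>n<n0. \<bar>s (Suc n)\<bar> * d h n)"
        by (intro sum_mono2) (auto simp: d_def)
      also have "\<dots> \<le> \<epsilon> / 4" using elim by simp
      also have "\<delta> * (\<Sum>n<N. d h n) \<le> \<delta> * (4 * pi)"
        unfolding d_def using \<delta> elim by (intro mult_left_mono sum_abs_sinc_sq_diff_le) auto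
      also have "\<delta> * (4 * pi) = \<epsilon> / 4" by (simp add: \<delta>_def)
      finally show ?thesis by simp
    qed
    have "(\<lambda>N. \<Sum>n<N. c n * sinc_sq (real n * h)) \<longlonglongrightarrow> (\<Sum>n. c n * sinc_sq (real n * h))"
      using summ[of h] elim by (intro summable_LIMSEQ) auto
    moreover have "(\<lambda>N. s N * sinc_sq (real N * h)) \<longlonglongrightarrow> 0"
    proof (rule Lim_null_comparison[OF _ tendsto_rabs_zero[OF s0]])
      show "\<forall>\<^sub>F N in sequentially. norm (s N * sinc_sq (real N * h)) \<le> \<bar>s N\<bar>"
        using abs_sinc_sq_le_1 by (auto simp: abs_mult intro!: always_eventually mult_left_le)
    qed
    ultimately have "(\<lambda>N. (\<Sum>n<N. c n * sinc_sq (real n * h)) - s N * sinc_sq (real N * h)) \<longlonglongrightarrow> (\<Sum>n. c n * sinc_sq (real n * h)) - 0"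
      by (rule tendsto_diff)
    moreover have "(\<Sum>n<N. c n * sinc_sq (real n * h)) - s N * sinc_sq (real N * h) =
        (\<Sum>n<N. s (Suc n) * (sinc_sq (real n * h) - sinc_sq (real (Suc n) * h)))" for N
      using sum_by_parts[of c "\<lambda>n. sinc_sq (real n * h)" N] by (simp only: s_def)
    ultimately have "(\<lambda>N. \<Sum>n<N. s (Suc n) * (sinc_sq (real n * h) - sinc_sq (real (Suc n) * h))) \<longlonglongrightarrow> (\<Sum>n. c n * sinc_sq (real n * h))"
      by simp
    hence "\<bar>\<Sum>n. c n * sinc_sq (real n * h)\<bar> \<le> \<epsilon> / 2"
      using bound by (intro LIMSEQ_le_const2[OF tendsto_rabs]) auto
    thus ?case using \<epsilon> by simp
  qed
qed

text \<open>Schwarz: adding \<open>\<epsilon> (x - \<alpha>) (x - \<beta>)\<close> makes the second symmetric derivative positive,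
  which is impossible at an interior maximum.\<close>

lemma schwarz_le_chord:
  fixes F :: "real \<Rightarrow> real"
  assumes ab: "\<alpha> < \<beta>" and cont: "continuous_on {\<alpha>..\<beta>} F"
    and D: "\<And>x. \<alpha> < x \<Longrightarrow> x < \<beta> \<Longrightarrow> ((\<lambda>h. (F (x + h) + F (x - h) - 2 * F x) / h\<^sup>2) \<longlongrightarrow> 0) (at_right 0)"
    and x: "x \<in> {\<alpha>..\<beta>}"
  shows "F x \<le> F \<alpha> + (x - \<alpha>) / (\<beta> - \<alpha>) * (F \<beta> - F \<alpha>)"
proof -
  define L where "L = (\<lambda>x. F \<alpha> + (x - \<alpha>) / (\<beta> - \<alpha>) * (F \<beta> - F \<alpha>))"
  have "F x - L x + \<epsilon> * ((x - \<alpha>) * (x - \<beta>)) \<le> 0" if \<epsilon>: "\<epsilon> > 0" for \<epsilon>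
  proof -
    define G where "G = (\<lambda>x. F x - L x + \<epsilon> * ((x - \<alpha>) * (x - \<beta>)))"
    have "continuous_on {\<alpha>..\<beta>} G" unfolding G_def L_def using ab by (intro continuous_intros cont) auto
    then obtain x0 where x0: "x0 \<in> {\<alpha>..\<beta>}" "\<And>y. y \<in> {\<alpha>..\<beta>} \<Longrightarrow> G y \<le> G x0"
      using continuous_attains_sup[of "{\<alpha>..\<beta>}" G] ab by auto
    have ends: "G \<alpha> = 0" "G \<beta> = 0" using ab by (auto simp: G_def L_def)
    have "G x0 \<le> 0"
    proof (rule ccontr)
      assume "\<not> G x0 \<le> 0"
      hence int: "\<alpha> < x0" "x0 < \<beta>" using ends x0(1) by (auto simp: less_le)
      define r where "r = min (x0 - \<alpha>) (\<beta> - x0)"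
      have r: "r > 0" using int by (simp add: r_def)
      have "\<forall>\<^sub>F h in at_right 0. (F (x0 + h) + F (x0 - h) - 2 * F x0) / h\<^sup>2 > - \<epsilon>"
        using order_tendstoD(1)[OF D[OF int], of "- \<epsilon>"] \<epsilon> by simp
      moreover have "\<forall>\<^sub>F h in at_right 0. h \<in> {0<..<r}" using r by (rule eventually_at_right_real)
      ultimately have "\<forall>\<^sub>F h in at_right (0::real). False"
      proof eventually_elim
        case (elim h)
        have h: "h > 0" using elim by simp
        have "G (x0 + h) \<le> G x0" "G (x0 - h) \<le> G x0" using elim(2) by (auto intro!: x0(2) simp: r_def)
        moreover have "G (x0 + h) + G (x0 - h) - 2 * G x0 =
            F (x0 + h) + F (x0 - h) - 2 * F x0 - (L (x0 + h) + L (x0 - h) - 2 * L x0) + 2 * \<epsilon> * h\<^sup>2"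
          by (simp add: G_def power2_eq_square algebra_simps)
        moreover have "L (x0 + h) + L (x0 - h) - 2 * L x0 = 0"
        proof -
          define q where "q = (F \<beta> - F \<alpha>) / (\<beta> - \<alpha>)"
          have L: "L x = F \<alpha> + (x - \<alpha>) * q" for x by (simp add: L_def q_def)
          show ?thesis unfolding L by (simp add: algebra_simps)
        qed
        ultimately have "F (x0 + h) + F (x0 - h) - 2 * F x0 + 2 * \<epsilon> * h\<^sup>2 \<le> 0" by linarith
        moreover have "F (x0 + h) + F (x0 - h) - 2 * F x0 > - \<epsilon> * h\<^sup>2"
          using elim(1) h by (simp add: pos_less_divide_eq)
        moreover have "\<epsilon> * h\<^sup>2 > 0" using \<epsilon> h by simp
        ultimately show False by linarith
      qed
      thus False by simp
    qed
    thus ?thesis using x0(2)[OF x] by (simp add: G_def)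
  qed
  moreover have "((\<lambda>\<epsilon>. F x - L x + \<epsilon> * ((x - \<alpha>) * (x - \<beta>))) \<longlongrightarrow> F x - L x + 0 * ((x - \<alpha>) * (x - \<beta>))) (at_right 0)"
    by (intro tendsto_intros)
  moreover have "\<forall>\<^sub>F h in at_right (0::real). h > 0" by (simp add: eventually_at_filter)
  ultimately have "F x - L x + 0 * ((x - \<alpha>) * (x - \<beta>)) \<le> 0"
    by (intro tendsto_upperbound) (auto elim: eventually_mono)
  thus ?thesis by (simp add: L_def)
qed

theorem schwarz_affine:
  fixes F :: "real \<Rightarrow> real"
  assumes ab: "\<alpha> < \<beta>" and cont: "continuous_on {\<alpha>..\<beta>} F"
    and D: "\<And>x. \<alpha> < x \<Longrightarrow> x < \<beta> \<Longrightarrow> ((\<lambda>h. (F (x + h) + F (x - h) - 2 * F x) / h\<^sup>2) \<longlongrightarrow> 0) (at_right 0)"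
    and x: "x \<in> {\<alpha>..\<beta>}"
  shows "F x = F \<alpha> + (x - \<alpha>) / (\<beta> - \<alpha>) * (F \<beta> - F \<alpha>)"
proof (rule antisym)
  show "F x \<le> F \<alpha> + (x - \<alpha>) / (\<beta> - \<alpha>) * (F \<beta> - F \<alpha>)" by (rule schwarz_le_chord[OF assms])
  have "- F x \<le> - F \<alpha> + (x - \<alpha>) / (\<beta> - \<alpha>) * (- F \<beta> - - F \<alpha>)"
  proof (rule schwarz_le_chord[OF ab continuous_on_minus[OF cont] _ x])
    fix y assume "\<alpha> < y" "y < \<beta>"
    from tendsto_minus[OF D[OF this]]
    show "((\<lambda>h. (- F (y + h) + - F (y - h) - 2 * - F y) / h\<^sup>2) \<longlongrightarrow> 0) (at_right 0)"
      by (simp add: minus_divide_left algebra_simps)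
  qed
  also have "\<dots> = - F \<alpha> + (x - \<alpha>) / (\<beta> - \<alpha>) * (- (F \<beta> - F \<alpha>))" by simp
  also have "\<dots> = - (F \<alpha> + (x - \<alpha>) / (\<beta> - \<alpha>) * (F \<beta> - F \<alpha>))"
    unfolding mult_minus_right by linarith
  finally show "F \<alpha> + (x - \<alpha>) / (\<beta> - \<alpha>) * (F \<beta> - F \<alpha>) \<le> F x" by simp
qed

definition trig_term :: "(nat \<Rightarrow> real) \<Rightarrow> (nat \<Rightarrow> real) \<Rightarrow> nat \<Rightarrow> real \<Rightarrow> real" where
  "trig_term a b n x = a n * cos (2 * pi * real n * x) + b n * sin (2 * pi * real n * x)"

lemma abs_trig_term_le: "\<bar>trig_term a b n x\<bar> \<le> \<bar>a n\<bar> + \<bar>b n\<bar>"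
proof -
  have "\<bar>trig_term a b n x\<bar> \<le> \<bar>a n * cos (2 * pi * real n * x)\<bar> + \<bar>b n * sin (2 * pi * real n * x)\<bar>"
    unfolding trig_term_def by (rule abs_triangle_ineq)
  also have "\<dots> \<le> \<bar>a n\<bar> * 1 + \<bar>b n\<bar> * 1"
    unfolding abs_mult by (intro add_mono mult_left_mono) auto
  finally show ?thesis by simp
qed

lemma trig_term_frac: "trig_term a b n (frac x) = trig_term a b n x"
proof -
  have "2 * pi * real n * x = 2 * pi * real n * frac x + 2 * pi * of_int (int n * \<lfloor>x\<rfloor>)"
    by (simp add: frac_def algebra_simps)
  thus ?thesis unfolding trig_term_def
    by (simp only: cos_add sin_add cos_int_2pin sin_int_2pin) simp
qed

lemma trig_term_add_diff:
  "trig_term a b n (x + h) + trig_term a b n (x - h) = 2 * cos (2 * pi * real n * h) * trig_term a b n x"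
  by (simp add: trig_term_def distrib_left right_diff_distrib cos_add sin_add cos_diff sin_diff algebra_simps)

lemma trig_term_square_has_integral:
  fixes a b :: "nat \<Rightarrow> real"
  assumes "n > 0" "\<alpha> \<le> \<beta>"
  defines "G \<equiv> \<lambda>x. ((a n)\<^sup>2 + (b n)\<^sup>2) / 2 * x + (((a n)\<^sup>2 - (b n)\<^sup>2) / 2 * sin (4 * pi * real n * x)
      - a n * b n * cos (4 * pi * real n * x)) / (4 * pi * real n)"
  shows "((\<lambda>x. (trig_term a b n x)\<^sup>2) has_integral (G \<beta> - G \<alpha>)) {\<alpha>..\<beta>}"
proof (rule fundamental_theorem_of_calculus[OF assms(2)])
  fix x
  define t where "t = 2 * pi * real n * x"
  have t2: "4 * pi * real n * x = 2 * t" by (simp add: t_def)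
  have "(G has_real_derivative (((a n)\<^sup>2 + (b n)\<^sup>2) / 2 + ((a n)\<^sup>2 - (b n)\<^sup>2) / 2 * cos (4 * pi * real n * x)
      + a n * b n * sin (4 * pi * real n * x))) (at x within {\<alpha>..\<beta>})"
    unfolding G_def using assms(1) by (auto intro!: derivative_eq_intros simp: field_simps)
  also have "((a n)\<^sup>2 + (b n)\<^sup>2) / 2 + ((a n)\<^sup>2 - (b n)\<^sup>2) / 2 * cos (4 * pi * real n * x)
      + a n * b n * sin (4 * pi * real n * x) =
      (a n)\<^sup>2 * ((1 + cos (2 * t)) / 2) + (b n)\<^sup>2 * ((1 - cos (2 * t)) / 2) + a n * b n * sin (2 * t)"
    unfolding t2 by (simp add: field_simps)
  also have "(1 + cos (2 * t)) / 2 = (cos t)\<^sup>2" using cos_double_cos[of t] by simp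
  also have "(1 - cos (2 * t)) / 2 = (sin t)\<^sup>2" using cos_double_sin[of t] by simp
  also have "(a n)\<^sup>2 * (cos t)\<^sup>2 + (b n)\<^sup>2 * (sin t)\<^sup>2 + a n * b n * sin (2 * t) = (trig_term a b n x)\<^sup>2"
  proof -
    have t: "trig_term a b n x = a n * cos t + b n * sin t" by (simp add: trig_term_def t_def)
    show ?thesis unfolding t sin_double by (simp add: power2_eq_square algebra_simps)
  qed
  finally show "(G has_vector_derivative (trig_term a b n x)\<^sup>2) (at x within {\<alpha>..\<beta>})"
    by (simp add: has_real_derivative_iff_has_vector_derivative)
qed

lemma integral_trig_term_square_ge:
  assumes n: "n > 0" and ab: "\<alpha> \<le> \<beta>"
  shows "integral {\<alpha>..\<beta>} (\<lambda>x. (trig_term a b n x)\<^sup>2) \<ge> ((a n)\<^sup>2 + (b n)\<^sup>2) * ((\<beta> - \<alpha>) / 2 - 1 / real n)"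
proof -
  define R where "R = (\<lambda>x. ((a n)\<^sup>2 - (b n)\<^sup>2) / 2 * sin (4 * pi * real n * x) - a n * b n * cos (4 * pi * real n * x))"
  define r where "r = (a n)\<^sup>2 + (b n)\<^sup>2"
  have R: "\<bar>R x\<bar> \<le> r" for x
  proof -
    have "\<bar>R x\<bar> \<le> \<bar>((a n)\<^sup>2 - (b n)\<^sup>2) / 2 * sin (4 * pi * real n * x)\<bar> + \<bar>a n * b n * cos (4 * pi * real n * x)\<bar>"
      unfolding R_def by (rule abs_triangle_ineq4)
    also have "\<dots> \<le> \<bar>((a n)\<^sup>2 - (b n)\<^sup>2) / 2\<bar> * 1 + \<bar>a n * b n\<bar> * 1"
      unfolding abs_mult[of _ "sin _"] abs_mult[of _ "cos _"] by (intro add_mono mult_left_mono) auto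
    also have "\<bar>((a n)\<^sup>2 - (b n)\<^sup>2) / 2\<bar> \<le> r / 2"
      unfolding r_def by (simp add: abs_if field_simps)
    also have "\<bar>a n * b n\<bar> \<le> r / 2"
    proof -
      have "0 \<le> (a n + b n)\<^sup>2" "0 \<le> (a n - b n)\<^sup>2" by simp_all
      thus ?thesis unfolding r_def power2_sum power2_diff by (simp add: abs_le_iff)
    qed
    finally show ?thesis by simp
  qed
  have "integral {\<alpha>..\<beta>} (\<lambda>x. (trig_term a b n x)\<^sup>2) =
     (r / 2 * \<beta> + R \<beta> / (4 * pi * real n)) - (r / 2 * \<alpha> + R \<alpha> / (4 * pi * real n))"
    using trig_term_square_has_integral[OF n ab, of a b] unfolding R_def r_def by (rule integral_unique)
  also have "\<dots> = r * ((\<beta> - \<alpha>) / 2) - (R \<alpha> - R \<beta>) / (4 * pi * real n)"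
    by (simp add: diff_divide_distrib algebra_simps)
  finally have eq: "integral {\<alpha>..\<beta>} (\<lambda>x. (trig_term a b n x)\<^sup>2) =
     r * ((\<beta> - \<alpha>) / 2) - (R \<alpha> - R \<beta>) / (4 * pi * real n)" .
  have "(R \<alpha> - R \<beta>) / (4 * pi * real n) \<le> r * (1 / real n)"
  proof -
    have "1 \<le> pi" using pi_gt3 by simp
    have "(R \<alpha> - R \<beta>) / (4 * pi * real n) \<le> (2 * r) / (4 * pi * real n)"
      using R[of \<alpha>] R[of \<beta>] by (intro divide_right_mono) (auto simp: abs_le_iff)
    also have "\<dots> = r / real n * (1 / (2 * pi))" by simp
    also have "\<dots> \<le> r / real n * 1"
      using \<open>1 \<le> pi\<close> by (intro mult_left_mono) (auto simp: r_def field_simps)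
    finally show ?thesis by simp
  qed
  thus ?thesis unfolding eq r_def[symmetric] right_diff_distrib by linarith
qed

theorem cantor_lebesgue:
  assumes ab: "\<alpha> < \<beta>" and lim: "\<And>x. x \<in> {\<alpha>..\<beta>} \<Longrightarrow> (\<lambda>n. trig_term a b n x) \<longlonglongrightarrow> 0"
  shows "(\<lambda>n. (a n)\<^sup>2 + (b n)\<^sup>2) \<longlonglongrightarrow> 0"
proof -
  define r where "r = (\<lambda>n. (a n)\<^sup>2 + (b n)\<^sup>2)"
  have r0: "r n \<ge> 0" for n by (simp add: r_def)
  define f where "f = (\<lambda>n x. (trig_term a b n x)\<^sup>2 / max 1 (r n))"
  have cont: "continuous_on S (f n)" for S n
    unfolding f_def trig_term_def by (intro continuous_intros) auto
  have f_le: "f n x \<le> 2" for n x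
  proof -
    have "(trig_term a b n x)\<^sup>2 \<le> (\<bar>a n\<bar> + \<bar>b n\<bar>)\<^sup>2"
      using abs_trig_term_le[of a b n x] by (simp add: abs_le_square_iff[symmetric])
    also have "\<dots> \<le> 2 * r n"
      using zero_le_power2[of "\<bar>a n\<bar> - \<bar>b n\<bar>"] unfolding r_def power2_sum power2_diff by simp
    also have "\<dots> \<le> 2 * max 1 (r n)" by simp
    finally show ?thesis by (simp add: f_def pos_divide_le_eq less_max_iff_disj)
  qed
  have f0: "f n x \<ge> 0" for n x by (simp add: f_def)
  have "(\<lambda>n. integral {\<alpha>..\<beta>} (f n)) \<longlonglongrightarrow> integral {\<alpha>..\<beta>} (\<lambda>_. 0)"
  proof (rule dominated_convergence(2)[where h = "\<lambda>_. 2"])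
    show "f n integrable_on {\<alpha>..\<beta>}" for n by (rule integrable_continuous_interval[OF cont])
    show "norm (f n x) \<le> 2" for n x using f_le f0 by simp
    fix x assume x: "x \<in> {\<alpha>..\<beta>}"
    have "(\<lambda>n. (trig_term a b n x)\<^sup>2) \<longlonglongrightarrow> 0\<^sup>2" by (intro tendsto_power lim x)
    hence lim2: "(\<lambda>n. (trig_term a b n x)\<^sup>2) \<longlonglongrightarrow> 0" by simp
    show "(\<lambda>n. f n x) \<longlonglongrightarrow> 0"
    proof (rule Lim_null_comparison[OF always_eventually lim2], intro allI)
      fix n
      have "(trig_term a b n x)\<^sup>2 / max 1 (r n) \<le> (trig_term a b n x)\<^sup>2 / 1"
        by (intro divide_left_mono) auto
      thus "norm (f n x) \<le> (trig_term a b n x)\<^sup>2" using f0[of n x] by (simp add: f_def)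
    qed
  qed auto
  hence int0: "(\<lambda>n. integral {\<alpha>..\<beta>} (f n)) \<longlonglongrightarrow> 0" by simp
  have "(\<lambda>n. (\<beta> - \<alpha>) / 2 - 1 / real n) \<longlonglongrightarrow> (\<beta> - \<alpha>) / 2 - 0" by (intro tendsto_intros lim_1_over_n)
  from order_tendstoD(1)[OF this, of "(\<beta> - \<alpha>) / 4"] ab
  have ev: "\<forall>\<^sub>F n in sequentially. (\<beta> - \<alpha>) / 2 - 1 / real n > (\<beta> - \<alpha>) / 4" by simp
  have "\<forall>\<^sub>F n in sequentially. norm (min 1 (r n)) \<le> 4 / (\<beta> - \<alpha>) * integral {\<alpha>..\<beta>} (f n)"
    using ev eventually_gt_at_top[of 0]
  proof eventually_elim
    case (elim n)
    have "r n * ((\<beta> - \<alpha>) / 4) \<le> r n * ((\<beta> - \<alpha>) / 2 - 1 / real n)"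
      using elim r0 by (intro mult_left_mono) auto
    also have "\<dots> \<le> integral {\<alpha>..\<beta>} (\<lambda>x. (trig_term a b n x)\<^sup>2)"
      unfolding r_def using elim ab by (intro integral_trig_term_square_ge) auto
    also have "\<dots> = integral {\<alpha>..\<beta>} (f n) * max 1 (r n)"
      by (simp add: f_def integral_divide less_max_iff_disj)
    finally have "r n / max 1 (r n) \<le> 4 / (\<beta> - \<alpha>) * integral {\<alpha>..\<beta>} (f n)"
      using ab by (simp add: field_simps max_def split: if_splits)
    moreover have "min 1 (r n) = r n / max 1 (r n)" by (auto simp: min_def max_def)
    ultimately show ?case using r0[of n] by simp
  qed
  moreover have "(\<lambda>n. 4 / (\<beta> - \<alpha>) * integral {\<alpha>..\<beta>} (f n)) \<longlonglongrightarrow> 0"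
    using tendsto_mult_left[OF int0, of "4 / (\<beta> - \<alpha>)"] by simp
  ultimately have min0: "(\<lambda>n. min 1 (r n)) \<longlonglongrightarrow> 0" by (rule Lim_null_comparison)
  have "\<forall>\<^sub>F n in sequentially. min 1 (r n) = r n"
    using order_tendstoD(2)[OF min0, of 1] by (auto elim: eventually_mono simp: min_def split: if_splits)
  with min0 have "r \<longlonglongrightarrow> 0" by (rule Lim_transform_eventually)
  thus ?thesis by (simp add: r_def)
qed

text \<open>The term \<open>n = 0\<close> of the series vanishes because division by 0 yields 0.\<close>

definition riemann_function :: "(nat \<Rightarrow> real) \<Rightarrow> (nat \<Rightarrow> real) \<Rightarrow> real \<Rightarrow> real" where
  "riemann_function a b x = a 0 * x\<^sup>2 / 2 - (\<Sum>n. trig_term a b n x / (2 * pi * real n)\<^sup>2)"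

locale bounded_trig_series =
  fixes a b :: "nat \<Rightarrow> real" and B :: real
  assumes bounded: "\<And>n. \<bar>a n\<bar> + \<bar>b n\<bar> \<le> B"
begin

abbreviation "A \<equiv> trig_term a b"
abbreviation "F \<equiv> riemann_function a b"

lemma abs_A_le: "\<bar>A n x\<bar> \<le> B"
  using abs_trig_term_le bounded by (rule order_trans)

lemma summable_inverse_squares: "summable (\<lambda>n. c / (real n)\<^sup>2)"
  using summable_mult[OF inverse_power_summable[of 2, where 'a = real], of c] by (simp add: field_simps)

lemma riemann_term_le: "\<bar>A n x / (2 * pi * real n)\<^sup>2\<bar> \<le> (B / (2 * pi)\<^sup>2) / (real n)\<^sup>2"
  using abs_A_le[of n x] by (simp add: power_mult_distrib divide_right_mono)

lemma summable_riemann_terms: "summable (\<lambda>n. A n x / (2 * pi * real n)\<^sup>2)"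
  by (rule summable_comparison_test'[OF summable_inverse_squares[of "B / (2 * pi)\<^sup>2"], of 0])
    (simp only: real_norm_def riemann_term_le)

lemma continuous_on_riemann_function: "continuous_on S F"
proof -
  have "uniform_limit UNIV (\<lambda>n x. \<Sum>i<n. A i x / (2 * pi * real i)\<^sup>2) (\<lambda>x. \<Sum>i. A i x / (2 * pi * real i)\<^sup>2) sequentially"
    by (rule Weierstrass_m_test[OF _ summable_inverse_squares[of "B / (2 * pi)\<^sup>2"]])
      (simp only: real_norm_def riemann_term_le)
  hence "continuous_on UNIV (\<lambda>x. \<Sum>i. A i x / (2 * pi * real i)\<^sup>2)"
    by (rule uniform_limit_theorem[rotated])
      (auto intro!: always_eventually continuous_intros simp: trig_term_def divide_inverse)
  hence "continuous_on UNIV F" unfolding riemann_function_def by (intro continuous_intros) auto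
  thus ?thesis by (rule continuous_on_subset) simp
qed

lemma riemann_second_difference:
  assumes h: "h \<noteq> 0"
  shows "(\<lambda>n. A n x * sinc_sq (real n * (pi * h))) sums ((F (x + h) + F (x - h) - 2 * F x) / h\<^sup>2)"
proof -
  have s: "(\<lambda>n. A n y / (2 * pi * real n)\<^sup>2) sums (a 0 * y\<^sup>2 / 2 - F y)" for y
    using summable_sums[OF summable_riemann_terms, of y] by (simp add: riemann_function_def)
  have 0: "(\<lambda>n. if n = 0 then a 0 else 0) sums a 0" using sums_If_finite[of "\<lambda>n. n = 0" "\<lambda>_. a 0"] by simp
  have "(\<lambda>n. (2 * (A n x / (2 * pi * real n)\<^sup>2) - A n (x + h) / (2 * pi * real n)\<^sup>2 - A n (x - h) / (2 * pi * real n)\<^sup>2) / h\<^sup>2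
      + (if n = 0 then a 0 else 0)) sums
    ((2 * (a 0 * x\<^sup>2 / 2 - F x) - (a 0 * (x + h)\<^sup>2 / 2 - F (x + h)) - (a 0 * (x - h)\<^sup>2 / 2 - F (x - h))) / h\<^sup>2 + a 0)"
    by (intro sums_add sums_divide sums_diff sums_mult s 0)
  also have "(2 * (a 0 * x\<^sup>2 / 2 - F x) - (a 0 * (x + h)\<^sup>2 / 2 - F (x + h)) - (a 0 * (x - h)\<^sup>2 / 2 - F (x - h))) / h\<^sup>2 + a 0
      = (F (x + h) + F (x - h) - 2 * F x) / h\<^sup>2"
    using h by (simp add: field_simps power2_eq_square)
  also have "(\<lambda>n. (2 * (A n x / (2 * pi * real n)\<^sup>2) - A n (x + h) / (2 * pi * real n)\<^sup>2 - A n (x - h) / (2 * pi * real n)\<^sup>2) / h\<^sup>2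
      + (if n = 0 then a 0 else 0)) = (\<lambda>n. A n x * sinc_sq (real n * (pi * h)))"
  proof
    fix n
    show "(2 * (A n x / (2 * pi * real n)\<^sup>2) - A n (x + h) / (2 * pi * real n)\<^sup>2 - A n (x - h) / (2 * pi * real n)\<^sup>2) / h\<^sup>2
      + (if n = 0 then a 0 else 0) = A n x * sinc_sq (real n * (pi * h))"
    proof (cases "n = 0")
      case False
      have "2 * (A n x / (2 * pi * real n)\<^sup>2) - A n (x + h) / (2 * pi * real n)\<^sup>2 - A n (x - h) / (2 * pi * real n)\<^sup>2 =
         (2 * A n x - (A n (x + h) + A n (x - h))) / (2 * pi * real n)\<^sup>2"
        by (simp add: diff_divide_distrib add_divide_distrib)
      also have "2 * A n x - (A n (x + h) + A n (x - h)) = 4 * A n x * (sin (real n * (pi * h)))\<^sup>2"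
      proof -
        have c: "cos (2 * pi * real n * h) = 1 - 2 * (sin (real n * (pi * h)))\<^sup>2"
          using cos_double_sin[of "real n * (pi * h)"] by (simp add: mult_ac)
        show ?thesis unfolding trig_term_add_diff c by (simp add: algebra_simps)
      qed
      finally show ?thesis using False h
        by (simp add: sinc_sq_def power_divide power_mult_distrib)
    qed (simp add: trig_term_def)
  qed
  finally show ?thesis .
qed

lemma sum_zero_at_midpoint:
  assumes ab: "\<alpha> < \<beta>" and z: "\<And>x. \<alpha> < x \<Longrightarrow> x < \<beta> \<Longrightarrow> (\<lambda>n. A n x) sums 0"
  shows "(\<lambda>n. A n ((\<alpha> + \<beta>) / 2) * sinc_sq (real n * (pi * ((\<beta> - \<alpha>) / 2)))) sums 0"
proof -
  define m where "m = (\<alpha> + \<beta>) / 2"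
  define h where "h = (\<beta> - \<alpha>) / 2"
  have "((\<lambda>h. (F (x + h) + F (x - h) - 2 * F x) / h\<^sup>2) \<longlongrightarrow> 0) (at_right 0)" if x: "\<alpha> < x" "x < \<beta>" for x
  proof -
    have sums: "(\<lambda>n. A n x * sinc_sq (real n * t)) sums ((F (x + t / pi) + F (x - t / pi) - 2 * F x) / (t / pi)\<^sup>2)"
      if "t > 0" for t
      using riemann_second_difference[of "t / pi" x] that by simp
    have "((\<lambda>t. \<Sum>n. A n x * sinc_sq (real n * t)) \<longlongrightarrow> 0) (at_right 0)"
      by (rule riemann_summation_tendsto_zero[OF z[OF x]]) (use sums sums_summable in blast)
    moreover have "filterlim (\<lambda>h. pi * h) (at_right 0) (at_right (0::real))"
      by (intro filterlim_at_withinI)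
        (auto intro!: tendsto_eq_intros simp: eventually_at_filter)
    ultimately have "((\<lambda>h. \<Sum>n. A n x * sinc_sq (real n * (pi * h))) \<longlongrightarrow> 0) (at_right 0)"
      by (rule filterlim_compose)
    moreover have "\<forall>\<^sub>F h in at_right 0. (\<Sum>n. A n x * sinc_sq (real n * (pi * h))) = (F (x + h) + F (x - h) - 2 * F x) / h\<^sup>2"
      using sums_unique[OF riemann_second_difference] by (auto simp: eventually_at_filter)
    ultimately show ?thesis by (rule Lim_transform_eventually)
  qed
  from schwarz_affine[OF ab continuous_on_riemann_function this, of m]
  have "F m = F \<alpha> + (m - \<alpha>) / (\<beta> - \<alpha>) * (F \<beta> - F \<alpha>)" using ab by (auto simp: m_def)
  also have "(m - \<alpha>) / (\<beta> - \<alpha>) = 1 / 2" using ab by (simp add: m_def field_simps)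
  finally have "F \<beta> + F \<alpha> - 2 * F m = 0" by (simp add: field_simps)
  moreover have "m + h = \<beta>" "m - h = \<alpha>" by (simp_all add: m_def h_def field_simps)
  moreover have "h \<noteq> 0" using ab by (simp add: h_def)
  ultimately show ?thesis using riemann_second_difference[of h m] unfolding m_def h_def by simp
qed

end

section \<open>Sets of uniqueness\<close>

lemma average_cis_progression:
  fixes k :: int
  assumes P: "P > 0" and k: "\<not> int P dvd k"
  shows "(\<Sum>i<P. cis (2 * pi * of_int k * ((real i + c) / real P))) = 0"
proof -
  define z where "z = cis (2 * pi * of_int k / real P)"
  have "z \<noteq> 1"
  proof
    assume "z = 1"
    hence "cos (2 * pi * of_int k / real P) = 1" by (simp add: z_def complex_eq_iff)
    then obtain l :: int where "2 * pi * of_int k / real P = real_of_int l * 2 * pi"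
      using cos_one_2pi_int by auto
    hence "of_int k = real_of_int (l * int P)" using P by (simp add: field_simps)
    hence "k = l * int P" by (simp only: of_int_eq_iff)
    thus False using k by simp
  qed
  moreover have "z ^ P = 1" using P by (simp add: z_def Complex.DeMoivre cis_multiple_2pi)
  ultimately have "(\<Sum>i<P. z ^ i) = 0" by (simp add: geometric_sum)
  moreover have "cis (2 * pi * of_int k * ((real i + c) / real P)) = cis (2 * pi * of_int k * c / real P) * z ^ i" for i
    by (simp add: z_def Complex.DeMoivre cis_mult add_divide_distrib algebra_simps)
  ultimately show ?thesis by (simp flip: sum_distrib_left)
qed

context bounded_trig_series
begin

definition mean_coeff :: "nat \<Rightarrow> nat \<Rightarrow> nat \<Rightarrow> complex" where
  "mean_coeff P m n = (\<Sum>i<P. of_real (A n ((real i + 5/8) / real P)) *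
     cis (- (2 * pi * real m * ((real i + 5/8) / real P)))) / of_nat P"

lemma norm_mean_coeff_le: "norm (mean_coeff P m n) \<le> \<bar>a n\<bar> + \<bar>b n\<bar>"
proof -
  have "norm (\<Sum>i<P. of_real (A n ((real i + 5/8) / real P)) * cis (- (2 * pi * real m * ((real i + 5/8) / real P))))
     \<le> (\<Sum>i<P. \<bar>a n\<bar> + \<bar>b n\<bar>)"
    by (intro order_trans[OF norm_sum] sum_mono) (simp add: norm_mult abs_trig_term_le)
  also have "(\<Sum>i<P. \<bar>a n\<bar> + \<bar>b n\<bar>) = real P * (\<bar>a n\<bar> + \<bar>b n\<bar>)" by simp
  finally have "norm (mean_coeff P m n) \<le> (real P * (\<bar>a n\<bar> + \<bar>b n\<bar>)) / real P"
    unfolding mean_coeff_def norm_divide norm_of_nat by (rule divide_right_mono) simp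
  also have "\<dots> \<le> \<bar>a n\<bar> + \<bar>b n\<bar>" by (cases "P = 0") auto
  finally show ?thesis .
qed

lemma mean_coeff_eq:
  fixes m n P :: nat
  defines "\<gamma> \<equiv> Complex (a n) (- b n)"
  defines "S \<equiv> \<lambda>k::int. (\<Sum>i<P. cis (2 * pi * of_int k * ((real i + 5/8) / real P)))"
  shows "mean_coeff P m n = (\<gamma> / 2 * S (int n - int m) + cnj \<gamma> / 2 * S (- int n - int m)) / of_nat P"
proof -
  have "of_real (A n x) * cis (- (2 * pi * real m * x)) =
     \<gamma> / 2 * cis (2 * pi * of_int (int n - int m) * x) + cnj \<gamma> / 2 * cis (2 * pi * of_int (- int n - int m) * x)" for x
  proof -
    define t where "t = 2 * pi * real n * x"
    have "complex_of_real (A n x) = \<gamma> / 2 * cis t + cnj \<gamma> / 2 * cis (- t)"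
      by (simp add: trig_term_def t_def \<gamma>_def complex_eq_iff field_simps)
    hence "of_real (A n x) * cis (- (2 * pi * real m * x)) =
       \<gamma> / 2 * (cis t * cis (- (2 * pi * real m * x))) + cnj \<gamma> / 2 * (cis (- t) * cis (- (2 * pi * real m * x)))"
      by (simp add: algebra_simps)
    moreover have "cis t * cis (- (2 * pi * real m * x)) = cis (2 * pi * of_int (int n - int m) * x)"
      unfolding cis_mult by (rule arg_cong[where f = cis]) (simp add: t_def algebra_simps)
    moreover have "cis (- t) * cis (- (2 * pi * real m * x)) = cis (2 * pi * of_int (- int n - int m) * x)"
      unfolding cis_mult by (rule arg_cong[where f = cis]) (simp add: t_def algebra_simps)
    ultimately show ?thesis by (simp only:)
  qed
  thus ?thesis unfolding mean_coeff_def S_def by (simp only: sum.distrib sum_distrib_left)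
qed

lemma mean_coeff_eq_0:
  assumes P: "P > 0" "2 * m < P" and n: "n mod P \<noteq> m" "n mod P \<noteq> P - m"
  shows "mean_coeff P m n = 0"
proof -
  have 1: "\<not> int P dvd int n - int m"
  proof
    assume "int P dvd int n - int m"
    hence "int n mod int P = int m mod int P" by (simp add: mod_eq_dvd_iff)
    hence "int (n mod P) = int (m mod P)" by (simp add: zmod_int)
    thus False using n P by simp
  qed
  have 2: "\<not> int P dvd - int n - int m"
  proof
    assume "int P dvd - int n - int m"
    hence "int P dvd int (n + m)" using dvd_minus_iff[of "int P" "int (n + m)"] by simp
    hence d: "P dvd n + m" by (simp only: int_dvd_int_iff)
    have "(n mod P + m) mod P = 0" using d by (simp add: mod_add_left_eq dvd_eq_mod_eq_0[symmetric])
    hence "P dvd n mod P + m" by (simp add: dvd_eq_mod_eq_0)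
    then obtain q where q: "n mod P + m = P * q" by (elim dvdE)
    have "n mod P < P" using P by simp
    hence "P * q < P * 2" using q P by linarith
    hence "q < 2" by simp
    hence "q = 0 \<or> q = 1" by auto
    thus False using q n by auto
  qed
  show ?thesis unfolding mean_coeff_eq average_cis_progression[OF P(1) 1] average_cis_progression[OF P(1) 2] by simp
qed

lemma norm_mean_coeff_same:
  assumes P: "P > 0" "2 * m < P"
  shows "\<bar>a m\<bar> \<le> 2 * norm (mean_coeff P m m)" and "m \<ge> 1 \<Longrightarrow> \<bar>b m\<bar> \<le> 2 * norm (mean_coeff P m m)"
proof -
  have pos: "mean_coeff P m m = Complex (a m) (- b m) / 2" if "m \<ge> 1"
  proof -
    have "\<not> int P dvd - int m - int m"
    proof
      assume "int P dvd - int m - int m"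
      hence "int P dvd int (2 * m)" using dvd_minus_iff[of "int P" "int (2 * m)"] by simp
      hence "P dvd 2 * m" by (simp only: int_dvd_int_iff)
      thus False using P that by (auto dest: dvd_imp_le)
    qed
    note S2 = average_cis_progression[OF P(1) this]
    have S1: "(\<Sum>i<P. cis (2 * pi * of_int (int m - int m) * ((real i + 5/8) / real P))) = of_nat P" by simp
    show ?thesis unfolding mean_coeff_eq S1 S2 using P by simp
  qed
  have zero: "mean_coeff P m m = a 0" if "m = 0"
    using that P by (simp add: mean_coeff_def trig_term_def)
  have nm: "2 * norm (mean_coeff P m m) = cmod (Complex (a m) (- b m))" if "m \<ge> 1"
    unfolding pos[OF that] by (simp add: norm_divide)
  show "\<bar>a m\<bar> \<le> 2 * norm (mean_coeff P m m)"
  proof (cases "m = 0")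
    case False
    thus ?thesis using nm abs_Re_le_cmod[of "Complex (a m) (- b m)"] by simp
  qed (use zero in simp)
  show "\<bar>b m\<bar> \<le> 2 * norm (mean_coeff P m m)" if "m \<ge> 1"
    unfolding nm[OF that] using abs_Im_le_cmod[of "Complex (a m) (- b m)"] by simp
qed

definition class_weight :: "nat \<Rightarrow> real" where
  "class_weight j = (if j = 0 then 1 else 2 / (real j)\<^sup>2)"

lemma class_weight_nonneg: "class_weight j \<ge> 0"
  by (simp add: class_weight_def)

lemma summable_class_weight: "summable class_weight"
  by (rule summable_comparison_test_ev[OF _ summable_inverse_squares[of 2]])
    (use eventually_gt_at_top[of 0] in \<open>auto elim!: eventually_mono simp: class_weight_def\<close>)

lemma sinc_sq_le_class_weight:
  assumes "P > 0"
  shows "sinc_sq (real (i + j * P) * (pi * (1 / (4 * real P)))) \<le> class_weight j"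
proof (cases "j = 0")
  case False
  let ?v = "real (i + j * P) * (pi * (1 / (4 * real P)))"
  have "real j * 3 / 4 \<le> real (j * P) * (3 * (1 / (4 * real P)))" using assms by simp
  also have "\<dots> \<le> ?v" using assms pi_gt3 by (intro mult_mono divide_right_mono) auto
  finally have v: "real j * 3 / 4 \<le> ?v" .
  moreover have "real j * 3 / 4 > 0" using False by simp
  ultimately have "?v > 0" by linarith
  hence "?v \<noteq> 0" by linarith
  hence "sinc_sq ?v \<le> 1 / ?v\<^sup>2" by (rule sinc_sq_le_inverse_square)
  also have "\<dots> \<le> 1 / (real j * 3 / 4)\<^sup>2"
  proof -
    have "1 / y\<^sup>2 \<le> 1 / x\<^sup>2" if "0 < x" "x \<le> y" for x y :: real
      using that by (intro divide_left_mono power_mono mult_pos_pos zero_less_power) auto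
    thus ?thesis using v \<open>real j * 3 / 4 > 0\<close> by blast
  qed
  also have "\<dots> \<le> 2 / (real j)\<^sup>2" by (simp add: power_divide power_mult_distrib divide_simps)
  finally show ?thesis using False by (simp add: class_weight_def)
qed (simp add: class_weight_def sinc_sq_le_1)

text \<open>Averaging the vanishing Riemann sums at the points \<open>(i + 5/8) / P\<close> against \<open>cis (-2 \<pi> m x)\<close>
  leaves only the frequencies congruent to \<open>\<plusminus> m\<close> modulo \<open>P\<close>; apart from \<open>m\<close> itself, their
  coefficients are small.\<close>

lemma mean_coeff_le:
  assumes P: "P > 0" "2 * m < P"
    and z: "\<And>i x. i < P \<Longrightarrow> (real i + 3/8) / real P < x \<Longrightarrow> x < (real i + 7/8) / real P \<Longrightarrow> (\<lambda>n. A n x) sums 0"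
    and \<delta>: "\<And>n. P \<le> 2 * n \<Longrightarrow> \<bar>a n\<bar> + \<bar>b n\<bar> \<le> \<delta>"
  shows "sinc_sq (real m * (pi * (1 / (4 * real P)))) * norm (mean_coeff P m m) \<le> 2 * \<delta> * suminf class_weight"
proof -
  define u where "u = (\<lambda>n. sinc_sq (real n * (pi * (1 / (4 * real P)))))"
  define D where "D = (\<lambda>n. of_real (u n) * mean_coeff P m n)"
  have \<delta>0: "\<delta> \<ge> 0" using \<delta>[of P] by linarith
  have "(\<lambda>n. A n ((real i + 5/8) / real P) * u n) sums 0" if i: "i < P" for i
  proof -
    let ?\<alpha> = "(real i + 3/8) / real P" and ?\<beta> = "(real i + 7/8) / real P"
    have ab: "?\<alpha> < ?\<beta>" using P by (simp add: divide_strict_right_mono)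
    have e: "(?\<alpha> + ?\<beta>) / 2 = (real i + 5/8) / real P" "(?\<beta> - ?\<alpha>) / 2 = 1 / (4 * real P)"
      using P by (simp_all add: field_simps)
    from sum_zero_at_midpoint[OF ab z[OF i]] show ?thesis unfolding e u_def .
  qed
  hence "(\<lambda>n. \<Sum>i<P. of_real (A n ((real i + 5/8) / real P) * u n) *
      cis (- (2 * pi * real m * ((real i + 5/8) / real P)))) sums (\<Sum>i<P. of_real 0 * cis (- (2 * pi * real m * ((real i + 5/8) / real P))))"
    by (intro sums_sum sums_mult2 sums_of_real) auto
  from sums_divide[OF this, of "of_nat P"]
  have "(\<lambda>n. (\<Sum>i<P. of_real (A n ((real i + 5/8) / real P) * u n) *
      cis (- (2 * pi * real m * ((real i + 5/8) / real P)))) / of_nat P) sums 0" by simp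
  also have "(\<lambda>n. (\<Sum>i<P. of_real (A n ((real i + 5/8) / real P) * u n) *
      cis (- (2 * pi * real m * ((real i + 5/8) / real P)))) / of_nat P) = D"
    unfolding D_def mean_coeff_def by (auto simp: fun_eq_iff sum_distrib_left mult_ac)
  finally have "D sums 0" .
  hence D0: "(\<lambda>N. \<Sum>n<N. D n) \<longlonglongrightarrow> 0" by (simp add: sums_def)
  define g where "g = (\<lambda>n. if n = m then 0 else norm (D n))"
  have g_le: "g (i + j * P) \<le> (if i = m \<or> i = P - m then \<delta> * class_weight j else 0)" if i: "i < P" for i j
  proof (cases "i + j * P = m \<or> \<not> (i = m \<or> i = P - m)")
    case True
    have "(i + j * P) mod P = i" using i by simp
    hence "g (i + j * P) = 0" using True mean_coeff_eq_0[OF P, of "i + j * P"] by (auto simp: g_def D_def)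
    thus ?thesis using \<delta>0 class_weight_nonneg[of j] by auto
  next
    case False
    have "P \<le> 2 * (i + j * P)"
    proof (cases "j = 0")
      case True
      thus ?thesis using False P by auto
    next
      case False
      hence "P \<le> j * P" by simp
      also have "j * P \<le> 2 * (i + j * P)" by simp
      finally show ?thesis .
    qed
    hence "norm (mean_coeff P m (i + j * P)) \<le> \<delta>" using norm_mean_coeff_le \<delta> order_trans by blast
    moreover have "u (i + j * P) \<le> class_weight j" "u (i + j * P) \<ge> 0"
      unfolding u_def by (rule sinc_sq_le_class_weight[OF P(1)] sinc_sq_nonneg)+
    ultimately have "u (i + j * P) * norm (mean_coeff P m (i + j * P)) \<le> class_weight j * \<delta>"
      using class_weight_nonneg by (intro mult_mono) auto
    thus ?thesis using False \<open>u (i + j * P) \<ge> 0\<close> by (simp add: g_def D_def norm_mult mult.commute)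
  qed
  have sum_g: "(\<Sum>n<K * P. g n) \<le> 2 * \<delta> * suminf class_weight" for K
  proof -
    have "(\<Sum>n<K * P. g n) = (\<Sum>j<K. \<Sum>i<P. g (i + j * P))"
      unfolding sum_lessThan_mult by (rule sum.swap)
    also have "\<dots> \<le> (\<Sum>j<K. 2 * (\<delta> * class_weight j))"
    proof (rule sum_mono)
      fix j
      have "(\<Sum>i<P. g (i + j * P)) \<le> (\<Sum>i<P. if i = m \<or> i = P - m then \<delta> * class_weight j else 0)"
        using g_le by (intro sum_mono) auto
      also have "\<dots> = (\<Sum>i\<in>{i\<in>{..<P}. i = m \<or> i = P - m}. \<delta> * class_weight j)"
        by (rule sum.inter_filter[symmetric]) simp
      also have "\<dots> \<le> (\<Sum>i\<in>{m, P - m}. \<delta> * class_weight j)"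
        using \<delta>0 class_weight_nonneg by (intro sum_mono2) auto
      also have "\<dots> \<le> 2 * (\<delta> * class_weight j)"
        using \<delta>0 class_weight_nonneg[of j] by (cases "m = P - m") auto
      finally show "(\<Sum>i<P. g (i + j * P)) \<le> 2 * (\<delta> * class_weight j)" .
    qed
    also have "\<dots> = 2 * \<delta> * (\<Sum>j<K. class_weight j)" by (simp add: sum_distrib_left mult_ac)
    also have "\<dots> \<le> 2 * \<delta> * suminf class_weight"
      using \<delta>0 class_weight_nonneg by (intro mult_left_mono sum_le_suminf summable_class_weight) auto
    finally show ?thesis .
  qed
  have "filterlim (\<lambda>K. K * P) at_top sequentially"
    using P by (intro filterlim_subseq) (simp add: strict_mono_def)
  hence lim: "(\<lambda>K. norm ((\<Sum>n<K * P. D n) - D m)) \<longlonglongrightarrow> norm (0 - D m)"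
    by (intro tendsto_norm tendsto_diff tendsto_const filterlim_compose[OF D0])
  have "norm ((\<Sum>n<K * P. D n) - D m) \<le> 2 * \<delta> * suminf class_weight" if "K \<ge> 1" for K
  proof -
    have "P \<le> K * P" using that by simp
    hence "m < K * P" using P by linarith
    hence "(\<Sum>n<K * P. D n) - D m = (\<Sum>n\<in>{..<K * P} - {m}. D n)"
      by (simp add: sum.remove[of "{..<K * P}" m])
    also have "norm \<dots> \<le> (\<Sum>n\<in>{..<K * P} - {m}. g n)"
      unfolding g_def by (rule order_trans[OF norm_sum]) (auto intro!: sum_mono)
    also have "\<dots> \<le> (\<Sum>n<K * P. g n)" by (intro sum_mono2) (auto simp: g_def)
    also have "\<dots> \<le> 2 * \<delta> * suminf class_weight" by (rule sum_g)
    finally show ?thesis .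
  qed
  hence "norm (0 - D m) \<le> 2 * \<delta> * suminf class_weight"
    by (intro LIMSEQ_le_const2[OF lim]) auto
  thus ?thesis by (simp add: D_def u_def norm_mult sinc_sq_nonneg)
qed

end

theorem set_of_uniqueness_if_dilations_avoid:
  assumes E: "E \<subseteq> {0..1}" and P: "\<And>N. \<exists>P\<ge>N. \<forall>x\<in>E. frac (real P * x) \<le> 1 / 4"
  shows "set_of_uniqueness E"
  unfolding set_of_uniqueness_def
proof (intro conjI E allI impI)
  fix a b :: "nat \<Rightarrow> real"
  assume "\<forall>x\<in>{0..1} - E. (\<lambda>n. a n * cos (2 * pi * real n * x) + b n * sin (2 * pi * real n * x)) sums 0"
  hence z0: "(\<lambda>n. trig_term a b n x) sums 0" if "x \<in> {0..1} - E" for x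
    using that by (simp add: trig_term_def)
  have z: "(\<lambda>n. trig_term a b n x) sums 0"
    if P: "P > 0" "\<forall>x\<in>E. frac (real P * x) \<le> 1 / 4"
      and x: "(real i + 3/8) / real P \<le> x" "x \<le> (real i + 7/8) / real P" for P i x
  proof -
    have Px: "real i + 3/8 \<le> real P * x" "real P * x \<le> real i + 7/8" using x P(1) by (simp_all add: field_simps)
    have "real P * frac x = real P * x - of_int (int P * \<lfloor>x\<rfloor>)" by (simp add: frac_def algebra_simps)
    moreover have "frac (real P * x - of_int k) = frac (real P * x)" for k
      by (simp add: frac_def)
    ultimately have "frac (real P * frac x) = frac (real P * x)" by presburger
    also have "frac (real P * x) = real P * x - real i"
    proof -
      have "\<lfloor>real P * x\<rfloor> = int i" using Px by (intro floor_unique) auto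
      thus ?thesis by (simp add: frac_def)
    qed
    also have "\<dots> > 1 / 4" using Px by simp
    finally have "frac x \<notin> E" using P(2) by auto
    moreover have "frac x \<in> {0..1}" using frac_lt_1[of x] by (simp add: less_imp_le)
    ultimately show ?thesis using z0[of "frac x"] by (simp add: trig_term_frac)
  qed
  define r where "r = (\<lambda>n. \<bar>a n\<bar> + \<bar>b n\<bar>)"
  have r0: "r \<longlonglongrightarrow> 0"
  proof -
    obtain Q :: nat where Q: "Q \<ge> 1" "\<forall>x\<in>E. frac (real Q * x) \<le> 1 / 4" using P[of 1] by blast
    have "(\<lambda>n. (a n)\<^sup>2 + (b n)\<^sup>2) \<longlonglongrightarrow> 0"
    proof (rule cantor_lebesgue)
      show "(real 0 + 3/8) / real Q < (real 0 + 7/8) / real Q" using Q(1) by (simp add: divide_strict_right_mono)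
      fix x assume "x \<in> {(real 0 + 3/8) / real Q..(real 0 + 7/8) / real Q}"
      thus "(\<lambda>n. trig_term a b n x) \<longlonglongrightarrow> 0"
        using Q by (intro summable_LIMSEQ_zero sums_summable[OF z[of Q 0]]) auto
    qed
    from tendsto_real_sqrt[OF this] have s: "(\<lambda>n. sqrt ((a n)\<^sup>2 + (b n)\<^sup>2)) \<longlonglongrightarrow> 0" by simp
    have "\<bar>a n\<bar> \<le> sqrt ((a n)\<^sup>2 + (b n)\<^sup>2)" "\<bar>b n\<bar> \<le> sqrt ((a n)\<^sup>2 + (b n)\<^sup>2)" for n
      by (auto intro: real_le_rsqrt)
    hence "a \<longlonglongrightarrow> 0" "b \<longlonglongrightarrow> 0"
      by (auto intro!: Lim_null_comparison[OF always_eventually s])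
    hence "r \<longlonglongrightarrow> \<bar>0\<bar> + \<bar>0\<bar>" unfolding r_def by (intro tendsto_intros)
    thus ?thesis by simp
  qed
  hence "Bseq r" by (intro convergent_imp_Bseq convergentI)
  then obtain B where "\<And>n. norm (r n) \<le> B" by (auto simp: Bseq_def)
  then interpret bounded_trig_series a b B
    by unfold_locales (simp add: r_def)
  have small: "\<exists>P. P > 0 \<and> 2 * m < P \<and> norm (mean_coeff P m m) \<le> \<epsilon>" if \<epsilon>: "\<epsilon> > 0" for m and \<epsilon> :: real
  proof -
    define W where "W = suminf class_weight"
    have W: "W \<ge> 0" unfolding W_def by (intro suminf_nonneg summable_class_weight class_weight_nonneg)
    define \<delta> where "\<delta> = \<epsilon> / (4 * (W + 1))"
    have \<delta>: "\<delta> > 0" using \<epsilon> W by (simp add: \<delta>_def)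
    obtain n0 where n0: "\<And>n. n \<ge> n0 \<Longrightarrow> r n \<le> \<delta>"
      using LIMSEQ_D[OF r0 \<delta>] by (fastforce simp: r_def)
    have "(\<lambda>P. real m * (pi * (1 / (4 * real P)))) \<longlonglongrightarrow> real m * (pi * 0)"
      by real_asymp
    hence "(\<lambda>P. sinc_sq (real m * (pi * (1 / (4 * real P))))) \<longlonglongrightarrow> sinc_sq 0"
      by (intro isCont_tendsto_compose[OF isCont_sinc_sq]) simp
    from order_tendstoD(1)[OF this, of "1/2"] obtain N where
      N: "\<And>P. P \<ge> N \<Longrightarrow> sinc_sq (real m * (pi * (1 / (4 * real P)))) > 1 / 2"
      by (auto simp: eventually_sequentially)
    obtain Q where Q: "Q \<ge> 2 * m + 1 + 2 * n0 + N" "\<forall>x\<in>E. frac (real Q * x) \<le> 1 / 4" using P by blast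
    have "sinc_sq (real m * (pi * (1 / (4 * real Q)))) * norm (mean_coeff Q m m) \<le> 2 * \<delta> * suminf class_weight"
    proof (rule mean_coeff_le)
      show "\<bar>a n\<bar> + \<bar>b n\<bar> \<le> \<delta>" if "Q \<le> 2 * n" for n using n0[of n] Q(1) that by (simp add: r_def)
      show "(\<lambda>n. trig_term a b n x) sums 0" if "(real i + 3/8) / real Q < x" "x < (real i + 7/8) / real Q" for i x
        using that Q by (intro z[of Q i]) auto
    qed (use Q in auto)
    moreover have "1 / 2 * norm (mean_coeff Q m m) \<le> sinc_sq (real m * (pi * (1 / (4 * real Q)))) * norm (mean_coeff Q m m)"
      using N[of Q] Q by (intro mult_right_mono) auto
    ultimately have "norm (mean_coeff Q m m) \<le> 4 * \<delta> * W" by (simp add: W_def)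
    also have "\<dots> \<le> 4 * \<delta> * (W + 1)" using \<delta> by (intro mult_left_mono) auto
    also have "\<dots> = \<epsilon>"
    proof -
      have "4 * W + 4 \<noteq> 0" using W by linarith
      thus ?thesis by (simp add: \<delta>_def field_simps)
    qed
    finally show ?thesis using Q by (intro exI[of _ Q]) auto
  qed
  show "a n = 0" for n
  proof (rule ccontr)
    assume "a n \<noteq> 0"
    hence "\<bar>a n\<bar> / 4 > 0" by simp
    from small[OF this, of n] obtain P where "P > 0" "2 * n < P" "norm (mean_coeff P n n) \<le> \<bar>a n\<bar> / 4" by blast
    with norm_mean_coeff_same(1)[of P n] \<open>a n \<noteq> 0\<close> show False by simp
  qed
  show "b n = 0" if "n \<ge> 1" for n
  proof (rule ccontr)
    assume "b n \<noteq> 0"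
    hence "\<bar>b n\<bar> / 4 > 0" by simp
    from small[OF this, of n] obtain P where "P > 0" "2 * n < P" "norm (mean_coeff P n n) \<le> \<bar>b n\<bar> / 4" by blast
    with norm_mean_coeff_same(2)[of P n] that \<open>b n \<noteq> 0\<close> show False by simp
  qed
qed

lemma denom_dvd: "k \<le> n \<Longrightarrow> denom k dvd denom n"
  by (induction rule: dec_induct) (auto simp: denom_Suc)

lemma denom_add_ge: "denom n * 5 ^ k \<le> denom (n + k)"
proof (induction k)
  case (Suc k)
  have "denom n * 5 ^ k * 5 \<le> denom (n + k) * moran_base (Suc (n + k))"
    using Suc moran_base_ge[of "Suc (n + k)"] denom_pos[of n] denom_pos[of "n + k"]
    by (intro mult_mono) auto
  thus ?case by (simp add: denom_Suc mult_ac)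
qed simp

lemma geometric_sums_quarter: "(\<lambda>n. (1 / 5 :: real) ^ Suc n) sums (1 / 4)"
  using sums_mult[OF geometric_sums[of "1 / 5 :: real"], of "1 / 5"] by simp

lemma moran_set_dilation:
  assumes D: "\<And>n. n \<ge> 1 \<Longrightarrow> D n = {0, 1}" and x: "x \<in> moran_set moran_base D"
  obtains k :: int where "0 \<le> of_int (denom N) * x - of_int k" "of_int (denom N) * x - of_int k \<le> 1 / 4"
    and "N = 0 \<Longrightarrow> k = 0"
proof -
  from x obtain d where d: "\<And>n. n \<ge> 1 \<Longrightarrow> d n \<in> D n"
    and s: "(\<lambda>n. of_int (d (Suc n)) / of_int (denom (Suc n))) sums x"
    unfolding moran_set_def denom_def by auto
  have d01: "d (Suc n) \<in> {0, 1}" for n using d[of "Suc n"] D[of "Suc n"] by simp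
  define k where "k = (\<Sum>n<N. d (Suc n) * (denom N div denom (Suc n)))"
  define t where "t = (\<lambda>n. real_of_int (denom N) * (of_int (d (Suc (n + N))) / of_int (denom (Suc (n + N)))))"
  have "real_of_int k = of_int (denom N) * (\<Sum>n<N. of_int (d (Suc n)) / of_int (denom (Suc n)))"
    unfolding k_def of_int_sum sum_distrib_left
  proof (rule sum.cong[OF refl])
    fix n assume "n \<in> {..<N}"
    hence "denom (Suc n) dvd denom N" by (intro denom_dvd) auto
    thus "real_of_int (d (Suc n) * (denom N div denom (Suc n))) =
        of_int (denom N) * (of_int (d (Suc n)) / of_int (denom (Suc n)))"
      by (simp add: real_of_int_div)
  qed
  with sums_mult[OF sums_split_initial_segment[OF s, of N], of "of_int (denom N)"]
  have t: "t sums (of_int (denom N) * x - of_int k)" by (simp add: t_def right_diff_distrib)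
  have t_bounds: "0 \<le> t n \<and> t n \<le> (1 / 5) ^ Suc n" for n
  proof -
    have "real_of_int (denom N * 5 ^ Suc n) \<le> of_int (denom (N + Suc n))"
      unfolding of_int_le_iff by (rule denom_add_ge)
    hence "of_int (denom N) / of_int (denom (Suc (n + N))) \<le> (1 / 5 :: real) ^ Suc n"
      using denom_pos[of "Suc (n + N)"] by (simp add: field_simps add.commute)
    moreover have "0 \<le> real_of_int (denom N) / of_int (denom (Suc (n + N)))"
      using denom_pos[of N] denom_pos[of "Suc (n + N)"] by simp
    ultimately show ?thesis using d01[of "n + N"] by (auto simp: t_def)
  qed
  show ?thesis
  proof
    show "0 \<le> of_int (denom N) * x - of_int k"
      using sums_le[OF _ sums_zero t] t_bounds by simp
    show "of_int (denom N) * x - of_int k \<le> 1 / 4"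
      using sums_le[OF _ t geometric_sums_quarter] t_bounds by simp
    show "N = 0 \<Longrightarrow> k = 0" by (simp add: k_def)
  qed
qed

lemma set_of_uniqueness_moran_set:
  assumes D: "\<And>n. n \<ge> 1 \<Longrightarrow> D n = {0, 1}"
  shows "set_of_uniqueness (moran_set moran_base D)"
proof (rule set_of_uniqueness_if_dilations_avoid)
  show "moran_set moran_base D \<subseteq> {0..1}"
  proof
    fix x assume "x \<in> moran_set moran_base D"
    from moran_set_dilation[OF D this, of 0] show "x \<in> {0..1}" by force
  qed
  show "\<exists>P\<ge>N. \<forall>x\<in>moran_set moran_base D. frac (real P * x) \<le> 1 / 4" for N
  proof (intro exI[of _ "nat (denom N)"] conjI ballI)
    show "N \<le> nat (denom N)" using denom_ge_self[of N] by linarith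
    fix x assume "x \<in> moran_set moran_base D"
    from moran_set_dilation[OF D this, of N] obtain k :: int where
      k: "0 \<le> of_int (denom N) * x - of_int k" "of_int (denom N) * x - of_int k \<le> 1 / 4" by metis
    have "real (nat (denom N)) = of_int (denom N)" using denom_pos[of N] by simp
    moreover have "\<lfloor>of_int (denom N) * x\<rfloor> = k" using k by (intro floor_unique) auto
    ultimately show "frac (real (nat (denom N)) * x) \<le> 1 / 4" using k by (simp add: frac_def)
  qed
qed

theorem theorem1p3:
  fixes D :: "nat \<Rightarrow> int set"
  assumes "\<And>n. n \<ge> 1 \<Longrightarrow> D n = {0, 1}"
  shows "\<exists>M :: nat \<Rightarrow> int. (\<forall>n\<ge>1. M n \<ge> 2) \<and>
    (\<exists>\<mu> :: real measure.
       has_infinite_convolution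
         (\<lambda>n. half_mixture (return borel 0) (return borel (1 / of_int (\<Prod>k=1..n. M k)))) \<mu> \<and>
       (\<forall>b\<ge>2. DEL_criterion \<mu> b) \<and>
       pointwise_absolutely_normal \<mu>) \<and>
    set_of_uniqueness (moran_set M D)"
proof (intro exI[of _ moran_base] conjI)
  show "\<forall>n\<ge>1. moran_base n \<ge> 2"
  proof (intro allI impI)
    show "moran_base n \<ge> 2" for n using moran_base_ge[of n] by linarith
  qed
  show "set_of_uniqueness (moran_set moran_base D)"
    by (rule set_of_uniqueness_moran_set[OF assms])
  have "summable (\<lambda>n. \<bar>1 / real_of_int (denom (Suc n))\<bar>)"
  proof (rule summable_comparison_test'[OF sums_summable[OF geometric_sums_quarter], of 0])
    fix n
    have "real_of_int (5 ^ Suc n) \<le> of_int (denom (Suc n))" unfolding of_int_le_iff by (rule denom_ge)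
    thus "norm \<bar>1 / real_of_int (denom (Suc n))\<bar> \<le> (1 / 5) ^ Suc n"
      using denom_pos[of "Suc n"] by (simp add: field_simps)
  qed
  from half_mixture_infinite_convolution[OF this] obtain \<mu> where
    conv: "has_infinite_convolution (\<lambda>n. half_mixture (return borel 0) (return borel (1 / of_int (denom n)))) \<mu>"
    and le: "\<And>\<xi> n. norm (fourier_measure \<mu> \<xi>) \<le> (\<Prod>i=1..n. \<bar>cos (pi * \<xi> * (1 / of_int (denom i)))\<bar>)" by metis
  have decay: "\<exists>C. \<forall>\<^sub>F N in sequentially.
      (\<Sum>m<N. \<Sum>n<N. norm (fourier_measure \<mu> (of_int (h * (b ^ n - b ^ m))))) \<le> C * (real N)\<^sup>2 / ln (real N) ^ 4"
    if "b \<ge> 2" "h \<noteq> 0" for b h :: int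
    by (rule sum_le_of_cos_prefix_le[where f = "\<lambda>\<xi>. norm (fourier_measure \<mu> \<xi>)"])
      (use le that in \<open>simp_all add: cos_prefix_def\<close>)
  have "\<forall>b\<ge>2. DEL_criterion \<mu> b"
    using decay by (intro allI impI DEL_criterion_if_log_decay)
  moreover have "pointwise_absolutely_normal \<mu>"
    using conv decay unfolding has_infinite_convolution_def
    by (intro real_distribution.pointwise_absolutely_normal_if_log_decay) auto
  ultimately show "\<exists>\<mu> :: real measure.
       has_infinite_convolution
         (\<lambda>n. half_mixture (return borel 0) (return borel (1 / of_int (\<Prod>k=1..n. moran_base k)))) \<mu> \<and>
       (\<forall>b\<ge>2. DEL_criterion \<mu> b) \<and> pointwise_absolutely_normal \<mu>"
    using conv unfolding denom_def by blast
qed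

end
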